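(* Let $\mathcal D$ be a triangulated category with small coproducts which is compactly generated by the family $\mathcal G=\{G_i\}_{i\in I}$. There is a one-to-one correspondence between: 1) Centrally split triangulated TTF triples on $\mathcal D$. 2) 2-decompositions $(\mathrm{add}(\mathcal G)_1,\mathrm{add}(\mathcal G)_2)$ of $\mathrm{add}(\mathcal G)$ such that $\mathcal D(M_1,M_2[n])=\mathcal D(M_2,M_1[n])=0$ for each $M_1\in\mathrm{add}(\mathcal G)_1$, $M_2\in\mathrm{add}(\mathcal G)_2$ and $n\in\mathbf Z$. 3) Central idempotents $e=\{e_i\}_{i\in I}$ of the ring $\prod_{i\in I}\mathcal D(G_i,G_i)$ such that $(e_j[n])f=fe_i$ for each $i,j\in I$, $n\in\mathbf Z$ and each morphism $f\in\mathcal D(G_i,G_j[n])$.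
   Context: "Compactly generated by $\mathcal G$" ($\mathcal G$ a set of objects) means: each $G_i$ is compact, i.e. $\mathcal D(G_i,?)$ preserves small coproducts, and an object $M$ is zero whenever $\mathcal D(G_i[n],M)=0$ for all $i\in I$, $n\in\mathbf Z$. $\mathrm{add}(\mathcal G)$ is the full subcategory of direct summands of finite coproducts of objects of $\mathcal G$. A 2-decomposition of a full subcategory $\mathcal C$ of an additive category is a pair $(\mathcal C_1,\mathcal C_2)$ of full subcategories of $\mathcal C$ closed under isomorphisms such that $\mathrm{Hom}(X,Y)=\mathrm{Hom}(Y,X)=0$ for $X\in\mathcal C_1$, $Y\in\mathcal C_2$, and every object of $\mathcal C$ is the coproduct of an object of $\mathcal C_1$ and an object of $\mathcal C_2$. A t-structure on $\mathcal D$ is a pair $(\mathcal U,\mathcal V[1])$, where $\mathcal U,\mathcal V$ are full subcategories closed under isomorphisms with $\mathcal D(U,V)=0$ for $U\in\mathcal U,V\in\mathcal V$, $\mathcal U[1]\subseteq\mathcal U$, $\mathcal V[-1]\subseteq\mathcal V$, and every $M\in\mathcal D$ lies in a triangle $M_{\mathcal U}\to M\to M^{\mathcal V}\to M_{\mathcal U}[1]$ with $M_{\mathcal U}\in\mathcal U$, $M^{\mathcal V}\in\mathcal V$. A triangulated TTF triple is a triple $(\mathcal X,\mathcal Y,\mathcal Z)$ of full subcategories such that $(\mathcal X,\mathcal Y)$ and $(\mathcal Y,\mathcal Z)$ are t-structures (so all three classes are triangulated subcategories). It is centrally split if both t-structures split, i.e. for each $M$ the morphisms $M_{\mathcal X}\to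 M$ and $M_{\mathcal Y}\to M$ in the respective truncation triangles of $(\mathcal X,\mathcal Y)$ and $(\mathcal Y,\mathcal Z)$ are sections. *)

theory Defs
  imports "HOL-Algebra.Ring" "HOL-Algebra.Product_Groups" "HOL-Algebra.Free_Abelian_Groups"
begin

unbundle cardinal_syntax

section \<open>Categories, preadditive and additive categories\<close>

record ('o, 'a) cat =
  Obj :: "'o set"
  Arr :: "'a set"
  src :: "'a \<Rightarrow> 'o"
  tgt :: "'a \<Rightarrow> 'o"
  ide :: "'o \<Rightarrow> 'a"
  comp :: "'a \<Rightarrow> 'a \<Rightarrow> 'a" (infixr "\<cdot>\<index>" 70)

definition Hom :: "('o, 'a, 'm) cat_scheme \<Rightarrow> 'o \<Rightarrow> 'o \<Rightarrow> 'a set" where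
  "Hom D X Y = {f \<in> Arr D. src D f = X \<and> tgt D f = Y}"

text \<open>Composition is written in the usual order: \<open>g \<cdot> f\<close> is \<open>g\<close> after \<open>f\<close>.\<close>

locale category =
  fixes D :: "('o, 'a, 'm) cat_scheme" (structure)
  assumes src_Obj: "f \<in> Arr D \<Longrightarrow> src D f \<in> Obj D"
    and tgt_Obj: "f \<in> Arr D \<Longrightarrow> tgt D f \<in> Obj D"
    and ide_Hom: "X \<in> Obj D \<Longrightarrow> ide D X \<in> Hom D X X"
    and comp_Hom: "\<lbrakk>f \<in> Hom D X Y; g \<in> Hom D Y Z\<rbrakk> \<Longrightarrow> g \<cdot> f \<in> Hom D X Z"
    and comp_ide_left: "f \<in> Hom D X Y \<Longrightarrow> ide D Y \<cdot> f = f"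
    and comp_ide_right: "f \<in> Hom D X Y \<Longrightarrow> f \<cdot> ide D X = f"
    and comp_assoc: "\<lbrakk>f \<in> Hom D W X; g \<in> Hom D X Y; h \<in> Hom D Y Z\<rbrakk>
      \<Longrightarrow> (h \<cdot> g) \<cdot> f = h \<cdot> (g \<cdot> f)"

definition is_iso_arr :: "('o, 'a, 'm) cat_scheme \<Rightarrow> 'a \<Rightarrow> bool" where
  "is_iso_arr D f \<longleftrightarrow> f \<in> Arr D \<and> (\<exists>g \<in> Hom D (tgt D f) (src D f).
     g \<cdot>\<^bsub>D\<^esub> f = ide D (src D f) \<and> f \<cdot>\<^bsub>D\<^esub> g = ide D (tgt D f))"

definition is_section :: "('o, 'a, 'm) cat_scheme \<Rightarrow> 'a \<Rightarrow> bool" where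
  "is_section D f \<longleftrightarrow> f \<in> Arr D \<and>
     (\<exists>r \<in> Hom D (tgt D f) (src D f). r \<cdot>\<^bsub>D\<^esub> f = ide D (src D f))"

definition isomorphic_in :: "('o, 'a, 'm) cat_scheme \<Rightarrow> 'o \<Rightarrow> 'o \<Rightarrow> bool" where
  "isomorphic_in D X Y \<longleftrightarrow> (\<exists>f \<in> Hom D X Y. is_iso_arr D f)"

definition is_zero_object :: "('o, 'a, 'm) cat_scheme \<Rightarrow> 'o \<Rightarrow> bool" where
  "is_zero_object D Z \<longleftrightarrow> Z \<in> Obj D \<and>
     (\<forall>X \<in> Obj D. (\<exists>!f. f \<in> Hom D X Z) \<and> (\<exists>!f. f \<in> Hom D Z X))"

definition is_coproduct ::
  "('o, 'a, 'm) cat_scheme \<Rightarrow> 'j set \<Rightarrow> ('j \<Rightarrow> 'o) \<Rightarrow> 'o \<Rightarrow> ('j \<Rightarrow> 'a) \<Rightarrow> bool" where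
  "is_coproduct D J M P \<iota> \<longleftrightarrow> P \<in> Obj D \<and> (\<forall>j \<in> J. \<iota> j \<in> Hom D (M j) P) \<and>
     (\<forall>T \<in> Obj D. \<forall>f. (\<forall>j \<in> J. f j \<in> Hom D (M j) T) \<longrightarrow>
        (\<exists>!h. h \<in> Hom D P T \<and> (\<forall>j \<in> J. h \<cdot>\<^bsub>D\<^esub> \<iota> j = f j)))"

definition is_coproduct2 ::
  "('o, 'a, 'm) cat_scheme \<Rightarrow> 'o \<Rightarrow> 'o \<Rightarrow> 'o \<Rightarrow> 'a \<Rightarrow> 'a \<Rightarrow> bool" where
  "is_coproduct2 D A B P a b \<longleftrightarrow>
     is_coproduct D (UNIV :: bool set) (\<lambda>k. if k then A else B) P (\<lambda>k. if k then a else b)"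

text \<open>Full subcategories are represented by their sets of objects.\<close>

definition full_iso_closed_subcat :: "('o, 'a, 'm) cat_scheme \<Rightarrow> 'o set \<Rightarrow> 'o set \<Rightarrow> bool" where
  "full_iso_closed_subcat D C S \<longleftrightarrow>
     S \<subseteq> C \<and> (\<forall>X \<in> S. \<forall>Y \<in> C. isomorphic_in D X Y \<longrightarrow> Y \<in> S)"

record ('o, 'a) preadd_cat = "('o, 'a) cat" +
  zeroA :: "'o \<Rightarrow> 'o \<Rightarrow> 'a"
  addA :: "'a \<Rightarrow> 'a \<Rightarrow> 'a"

text \<open>The additive group of morphisms, in the (multiplicative) record type of groups.\<close>

definition hom_group :: "('o, 'a, 'm) preadd_cat_scheme \<Rightarrow> 'o \<Rightarrow> 'o \<Rightarrow> 'a monoid" where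
  "hom_group D X Y = \<lparr>carrier = Hom D X Y, mult = addA D, one = zeroA D X Y\<rparr>"

definition negA :: "('o, 'a, 'm) preadd_cat_scheme \<Rightarrow> 'a \<Rightarrow> 'a" where
  "negA D f = inv\<^bsub>hom_group D (src D f) (tgt D f)\<^esub> f"

locale preadditive_category = category D
  for D :: "('o, 'a, 'm) preadd_cat_scheme" (structure) +
  assumes hom_comm_group: "\<lbrakk>X \<in> Obj D; Y \<in> Obj D\<rbrakk> \<Longrightarrow> comm_group (hom_group D X Y)"
    and comp_add_right: "\<lbrakk>f \<in> Hom D X Y; f' \<in> Hom D X Y; g \<in> Hom D Y Z\<rbrakk>
      \<Longrightarrow> g \<cdot> addA D f f' = addA D (g \<cdot> f) (g \<cdot> f')"
    and comp_add_left: "\<lbrakk>f \<in> Hom D X Y; g \<in> Hom D Y Z; g' \<in> Hom D Y Z\<rbrakk>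
      \<Longrightarrow> addA D g g' \<cdot> f = addA D (g \<cdot> f) (g' \<cdot> f)"

locale additive_category = preadditive_category D
  for D :: "('o, 'a, 'm) preadd_cat_scheme" (structure) +
  assumes ex_zero_object: "\<exists>Z. is_zero_object D Z"
    and ex_coproduct2: "\<lbrakk>X \<in> Obj D; Y \<in> Obj D\<rbrakk> \<Longrightarrow> \<exists>P a b. is_coproduct2 D X Y P a b"

definition hom_vanishes :: "('o, 'a, 'm) preadd_cat_scheme \<Rightarrow> 'o \<Rightarrow> 'o \<Rightarrow> bool" where
  "hom_vanishes D X Y \<longleftrightarrow> Hom D X Y = {zeroA D X Y}"


section \<open>Triangulated categories\<close>

text \<open>
  The suspension is an automorphism of the category. It is recorded together with all its
  integral powers: \<open>shO D n X\<close> is \<open>X[n]\<close> and \<open>shA D n f\<close> is \<open>f[n]\<close>; the strict action laws below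
  say precisely that these are the powers of the automorphism \<open>[1]\<close>.
  A distinguished triangle \<open>X \<rightarrow> Y \<rightarrow> Z \<rightarrow> X[1]\<close> is the triple of its morphisms.
\<close>

record ('o, 'a) tri_cat = "('o, 'a) preadd_cat" +
  shO :: "int \<Rightarrow> 'o \<Rightarrow> 'o"
  shA :: "int \<Rightarrow> 'a \<Rightarrow> 'a"
  Tri :: "('a \<times> 'a \<times> 'a) set"

definition is_triangle :: "('o, 'a, 'm) tri_cat_scheme \<Rightarrow> 'a \<Rightarrow> 'a \<Rightarrow> 'a \<Rightarrow> bool" where
  "is_triangle D u v w \<longleftrightarrow> u \<in> Arr D \<and> v \<in> Arr D \<and> w \<in> Arr D \<and>
     src D v = tgt D u \<and> src D w = tgt D v \<and> tgt D w = shO D 1 (src D u)"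

definition triangle_morphism :: "('o, 'a, 'm) tri_cat_scheme \<Rightarrow>
    'a \<times> 'a \<times> 'a \<Rightarrow> 'a \<times> 'a \<times> 'a \<Rightarrow> 'a \<Rightarrow> 'a \<Rightarrow> 'a \<Rightarrow> bool" where
  "triangle_morphism D t t' a b c \<longleftrightarrow> (case (t, t') of ((u, v, w), (u', v', w')) \<Rightarrow>
     a \<in> Hom D (src D u) (src D u') \<and> b \<in> Hom D (tgt D u) (tgt D u') \<and>
     c \<in> Hom D (tgt D v) (tgt D v') \<and>
     b \<cdot>\<^bsub>D\<^esub> u = u' \<cdot>\<^bsub>D\<^esub> a \<and> c \<cdot>\<^bsub>D\<^esub> v = v' \<cdot>\<^bsub>D\<^esub> b \<and> shA D 1 a \<cdot>\<^bsub>D\<^esub> w = w' \<cdot>\<^bsub>D\<^esub> c)"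

locale triangulated_category = additive_category D
  for D :: "('o, 'a, 'm) tri_cat_scheme" (structure) +
  assumes sh_Obj: "X \<in> Obj D \<Longrightarrow> shO D n X \<in> Obj D"
    and sh_Hom: "f \<in> Hom D X Y \<Longrightarrow> shA D n f \<in> Hom D (shO D n X) (shO D n Y)"
    and sh_ide: "X \<in> Obj D \<Longrightarrow> shA D n (ide D X) = ide D (shO D n X)"
    and sh_comp: "\<lbrakk>f \<in> Hom D X Y; g \<in> Hom D Y Z\<rbrakk> \<Longrightarrow> shA D n (g \<cdot> f) = shA D n g \<cdot> shA D n f"
    and sh_add: "\<lbrakk>f \<in> Hom D X Y; g \<in> Hom D X Y\<rbrakk>
      \<Longrightarrow> shA D n (addA D f g) = addA D (shA D n f) (shA D n g)"
    and shO_0: "X \<in> Obj D \<Longrightarrow> shO D 0 X = X"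
    and shA_0: "f \<in> Arr D \<Longrightarrow> shA D 0 f = f"
    and shO_plus: "X \<in> Obj D \<Longrightarrow> shO D (m + n) X = shO D m (shO D n X)"
    and shA_plus: "f \<in> Arr D \<Longrightarrow> shA D (m + n) f = shA D m (shA D n f)"
    \<comment> \<open>TR0 and TR1\<close>
    and Tri_triangle: "(u, v, w) \<in> Tri D \<Longrightarrow> is_triangle D u v w"
    and Tri_iso: "\<lbrakk>(u, v, w) \<in> Tri D; is_triangle D u' v' w';
        triangle_morphism D (u, v, w) (u', v', w') a b c;
        is_iso_arr D a; is_iso_arr D b; is_iso_arr D c\<rbrakk> \<Longrightarrow> (u', v', w') \<in> Tri D"
    and Tri_ide: "\<lbrakk>X \<in> Obj D; is_zero_object D Z\<rbrakk>
      \<Longrightarrow> (ide D X, zeroA D X Z, zeroA D Z (shO D 1 X)) \<in> Tri D"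
    and Tri_cone: "u \<in> Arr D \<Longrightarrow> \<exists>v w. (u, v, w) \<in> Tri D"
    \<comment> \<open>TR2\<close>
    and Tri_rotate: "is_triangle D u v w
      \<Longrightarrow> (u, v, w) \<in> Tri D \<longleftrightarrow> (v, w, negA D (shA D 1 u)) \<in> Tri D"
    \<comment> \<open>TR3\<close>
    and Tri_fill: "\<lbrakk>(u, v, w) \<in> Tri D; (u', v', w') \<in> Tri D;
        a \<in> Hom D (src D u) (src D u'); b \<in> Hom D (tgt D u) (tgt D u'); b \<cdot> u = u' \<cdot> a\<rbrakk>
      \<Longrightarrow> \<exists>c. triangle_morphism D (u, v, w) (u', v', w') a b c"
    \<comment> \<open>TR4, the octahedral axiom\<close>
    and Tri_octahedral: "\<lbrakk>u \<in> Hom D X Y; v \<in> Hom D Y Z;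
        (u, i, i') \<in> Tri D; (v, j, j') \<in> Tri D; (v \<cdot> u, k, k') \<in> Tri D\<rbrakk>
      \<Longrightarrow> \<exists>f g. (f, g, shA D 1 i \<cdot> j') \<in> Tri D \<and>
            f \<in> Hom D (tgt D i) (tgt D k) \<and> g \<in> Hom D (tgt D k) (tgt D j) \<and>
            f \<cdot> i = k \<cdot> v \<and> k' \<cdot> f = i' \<and> g \<cdot> k = j \<and> j' \<cdot> g = shA D 1 u \<cdot> k'"


section \<open>Small coproducts and compact generation\<close>

text \<open>
  The type \<open>'u\<close> plays the role of the universe of sets: a set is small if its cardinality is
  strictly below that of \<open>'u\<close>. All that is required of \<open>'u\<close> is that its cardinal is
  uncountable and regular, that is, that small sets include the countable ones and are closed
  under small unions. Inaccessible cardinals (Grothendieck universes) are the special case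
  of the usual foundations; HOL does not prove that a type of such a cardinality exists.
\<close>

definition universe :: "'u itself \<Rightarrow> bool" where
  "universe (_ :: 'u itself) \<longleftrightarrow>
     natLeq <o |UNIV :: 'u set| \<and> regularCard |UNIV :: 'u set|"

definition small :: "'u itself \<Rightarrow> 'b set \<Rightarrow> bool" where
  "small (_ :: 'u itself) A \<longleftrightarrow> |A| <o |UNIV :: 'u set|"

definition has_small_coproducts :: "'u itself \<Rightarrow> ('o, 'a, 'm) cat_scheme \<Rightarrow> bool" where
  "has_small_coproducts (U :: 'u itself) D \<longleftrightarrow>
     (\<forall>(J :: 'u set) M. small U J \<longrightarrow> (\<forall>j \<in> J. M j \<in> Obj D) \<longrightarrow>
        (\<exists>P \<iota>. is_coproduct D J M P \<iota>))"

text \<open>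
  \<open>D(X, ?)\<close> preserves small coproducts: the canonical map from the direct sum of the groups
  \<open>D(X, M j)\<close> to \<open>D(X, P)\<close>, sending a family \<open>\<phi>\<close> to the (essentially finite) sum of the
  \<open>\<iota> j \<cdot> \<phi> j\<close>, is an isomorphism for every coproduct \<open>P\<close> of a small family.
\<close>

definition compact_object :: "'u itself \<Rightarrow> ('o, 'a, 'm) preadd_cat_scheme \<Rightarrow> 'o \<Rightarrow> bool" where
  "compact_object (U :: 'u itself) D X \<longleftrightarrow> X \<in> Obj D \<and>
     (\<forall>(J :: 'u set) M P \<iota>. small U J \<longrightarrow> (\<forall>j \<in> J. M j \<in> Obj D) \<longrightarrow> is_coproduct D J M P \<iota> \<longrightarrow>
        (\<lambda>\<phi>. gfinprod (hom_group D X P) (\<lambda>j. \<iota> j \<cdot>\<^bsub>D\<^esub> \<phi> j) J)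
          \<in> iso (sum_group J (\<lambda>j. hom_group D X (M j))) (hom_group D X P))"

definition compactly_generated ::
  "'u itself \<Rightarrow> ('o, 'a, 'm) tri_cat_scheme \<Rightarrow> 'i set \<Rightarrow> ('i \<Rightarrow> 'o) \<Rightarrow> bool" where
  "compactly_generated U D I G \<longleftrightarrow> (\<forall>i \<in> I. compact_object U D (G i)) \<and>
     (\<forall>M \<in> Obj D. (\<forall>i \<in> I. \<forall>n. hom_vanishes D (shO D n (G i)) M) \<longrightarrow> is_zero_object D M)"


section \<open>Additive closure and 2-decompositions\<close>

definition add_closure :: "('o, 'a, 'm) cat_scheme \<Rightarrow> 'i set \<Rightarrow> ('i \<Rightarrow> 'o) \<Rightarrow> 'o set" where
  "add_closure D I G = {M \<in> Obj D. \<exists>(n :: nat) k P \<iota>.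
     (\<forall>r < n. k r \<in> I) \<and> is_coproduct D {..<n} (\<lambda>r. G (k r)) P \<iota> \<and>
     (\<exists>N \<in> Obj D. \<exists>a b. is_coproduct2 D M N P a b)}"

definition two_decomposition ::
  "('o, 'a, 'm) preadd_cat_scheme \<Rightarrow> 'o set \<Rightarrow> 'o set \<Rightarrow> 'o set \<Rightarrow> bool" where
  "two_decomposition D C C1 C2 \<longleftrightarrow>
     full_iso_closed_subcat D C C1 \<and> full_iso_closed_subcat D C C2 \<and>
     (\<forall>X \<in> C1. \<forall>Y \<in> C2. hom_vanishes D X Y \<and> hom_vanishes D Y X) \<and>
     (\<forall>M \<in> C. \<exists>X \<in> C1. \<exists>Y \<in> C2. \<exists>a b. is_coproduct2 D X Y M a b)"

definition graded_orthogonal_decompositions ::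
  "('o, 'a, 'm) tri_cat_scheme \<Rightarrow> 'o set \<Rightarrow> ('o set \<times> 'o set) set" where
  "graded_orthogonal_decompositions D C = {(C1, C2). two_decomposition D C C1 C2 \<and>
     (\<forall>M1 \<in> C1. \<forall>M2 \<in> C2. \<forall>n. hom_vanishes D M1 (shO D n M2) \<and> hom_vanishes D M2 (shO D n M1))}"


section \<open>t-structures and TTF triples\<close>

definition t_truncation ::
  "('o, 'a, 'm) tri_cat_scheme \<Rightarrow> 'o set \<Rightarrow> 'o set \<Rightarrow> 'o \<Rightarrow> 'a \<Rightarrow> 'a \<Rightarrow> 'a \<Rightarrow> bool" where
  "t_truncation D U V M f g h \<longleftrightarrow> (f, g, h) \<in> Tri D \<and> src D f \<in> U \<and> tgt D f = M \<and> tgt D g \<in> V"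

text \<open>
  A t-structure is a pair \<open>(U, V[1])\<close>; the second argument below is \<open>W = V[1]\<close>, so that
  the vanishing and truncation conditions involve \<open>V = W[-1]\<close>.
\<close>

definition coaisle :: "('o, 'a, 'm) tri_cat_scheme \<Rightarrow> 'o set \<Rightarrow> 'o set" where
  "coaisle D W = shO D (-1) ` W"

definition t_structure :: "('o, 'a, 'm) tri_cat_scheme \<Rightarrow> 'o set \<Rightarrow> 'o set \<Rightarrow> bool" where
  "t_structure D U W \<longleftrightarrow> W \<subseteq> Obj D \<and> (let V = coaisle D W in
     full_iso_closed_subcat D (Obj D) U \<and> full_iso_closed_subcat D (Obj D) V \<and>
     (\<forall>X \<in> U. \<forall>Y \<in> V. hom_vanishes D X Y) \<and>
     shO D 1 ` U \<subseteq> U \<and> shO D (-1) ` V \<subseteq> V \<and>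
     (\<forall>M \<in> Obj D. \<exists>f g h. t_truncation D U V M f g h))"

definition t_structure_splits :: "('o, 'a, 'm) tri_cat_scheme \<Rightarrow> 'o set \<Rightarrow> 'o set \<Rightarrow> bool" where
  "t_structure_splits D U W \<longleftrightarrow>
     (\<forall>M \<in> Obj D. \<forall>f g h. t_truncation D U (coaisle D W) M f g h \<longrightarrow> is_section D f)"

definition TTF_triple :: "('o, 'a, 'm) tri_cat_scheme \<Rightarrow> 'o set \<Rightarrow> 'o set \<Rightarrow> 'o set \<Rightarrow> bool" where
  "TTF_triple D X Y Z \<longleftrightarrow> t_structure D X Y \<and> t_structure D Y Z"

definition centrally_split_TTF_triples ::
  "('o, 'a, 'm) tri_cat_scheme \<Rightarrow> ('o set \<times> 'o set \<times> 'o set) set" where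
  "centrally_split_TTF_triples D =
     {(X, Y, Z). TTF_triple D X Y Z \<and> t_structure_splits D X Y \<and> t_structure_splits D Y Z}"


section \<open>Central idempotents of the product of the endomorphism rings\<close>

definition endo_ring :: "('o, 'a, 'm) preadd_cat_scheme \<Rightarrow> 'o \<Rightarrow> 'a ring" where
  "endo_ring D X = \<lparr>carrier = Hom D X X, mult = comp D, one = ide D X,
     ring.zero = zeroA D X X, ring.add = addA D\<rparr>"

definition prod_ring :: "'i set \<Rightarrow> ('i \<Rightarrow> ('r, 'm) ring_scheme) \<Rightarrow> ('i \<Rightarrow> 'r) ring" where
  "prod_ring I R = \<lparr>carrier = (\<Pi>\<^sub>E i\<in>I. carrier (R i)),
     mult = (\<lambda>x y. \<lambda>i\<in>I. x i \<otimes>\<^bsub>R i\<^esub> y i), one = (\<lambda>i\<in>I. \<one>\<^bsub>R i\<^esub>),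
     ring.zero = (\<lambda>i\<in>I. \<zero>\<^bsub>R i\<^esub>), ring.add = (\<lambda>x y. \<lambda>i\<in>I. x i \<oplus>\<^bsub>R i\<^esub> y i)\<rparr>"

definition central_idempotents :: "('r, 'm) ring_scheme \<Rightarrow> 'r set" where
  "central_idempotents R =
     {e \<in> carrier R. e \<otimes>\<^bsub>R\<^esub> e = e \<and> (\<forall>x \<in> carrier R. e \<otimes>\<^bsub>R\<^esub> x = x \<otimes>\<^bsub>R\<^esub> e)}"

definition graded_central_idempotents ::
  "('o, 'a, 'm) tri_cat_scheme \<Rightarrow> 'i set \<Rightarrow> ('i \<Rightarrow> 'o) \<Rightarrow> ('i \<Rightarrow> 'a) set" where
  "graded_central_idempotents D I G =
     {e \<in> central_idempotents (prod_ring I (\<lambda>i. endo_ring D (G i))).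
        \<forall>i \<in> I. \<forall>j \<in> I. \<forall>n. \<forall>f \<in> Hom D (G i) (shO D n (G j)).
          shA D n (e j) \<cdot>\<^bsub>D\<^esub> f = f \<cdot>\<^bsub>D\<^esub> e i}"


section \<open>The correspondences\<close>

definition TTF_to_decomposition :: "('o, 'a, 'm) cat_scheme \<Rightarrow> 'i set \<Rightarrow> ('i \<Rightarrow> 'o) \<Rightarrow>
    'o set \<times> 'o set \<times> 'o set \<Rightarrow> 'o set \<times> 'o set" where
  "TTF_to_decomposition D I G = (\<lambda>(X, Y, Z). (X \<inter> add_closure D I G, Y \<inter> add_closure D I G))"

text \<open>
  If \<open>M\<close> is the coproduct of \<open>X \<in> C1\<close> and \<open>Y \<in> C2\<close> with injections \<open>a\<close> and \<open>b\<close>, this is the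
  idempotent \<open>M \<rightarrow> X \<rightarrow> M\<close>. It does not depend on the coproduct decomposition if there are no
  nonzero morphisms between \<open>C1\<close> and \<open>C2\<close>.
\<close>

definition component_idempotent ::
  "('o, 'a, 'm) preadd_cat_scheme \<Rightarrow> 'o set \<Rightarrow> 'o set \<Rightarrow> 'o \<Rightarrow> 'a" where
  "component_idempotent D C1 C2 M = (THE e. e \<in> Hom D M M \<and>
     (\<exists>X \<in> C1. \<exists>Y \<in> C2. \<exists>a b. is_coproduct2 D X Y M a b \<and>
        e \<cdot>\<^bsub>D\<^esub> a = a \<and> e \<cdot>\<^bsub>D\<^esub> b = zeroA D Y M))"

definition decomposition_to_idempotent :: "('o, 'a, 'm) preadd_cat_scheme \<Rightarrow> 'i set \<Rightarrow> ('i \<Rightarrow> 'o) \<Rightarrow>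
    'o set \<times> 'o set \<Rightarrow> 'i \<Rightarrow> 'a" where
  "decomposition_to_idempotent D I G = (\<lambda>(C1, C2). \<lambda>i\<in>I. component_idempotent D C1 C2 (G i))"

end

theory Submission
  imports Defs
begin

text \<open>
  In a centrally split TTF triple \<open>(\<X>, \<Y>, \<Z>)\<close> the two splittings force \<open>\<Z> = \<X>\<close>: both classes consist
  of the objects without nonzero summand in \<open>\<Y>\<close>. What remains is a pair of shift-stable classes
  \<open>\<X>\<close>, \<open>\<Y>\<close> with no nonzero arrows in either direction such that every object is a biproduct of an
  object of \<open>\<X>\<close> and one of \<open>\<Y>\<close> (\<open>centrally_split_TTF_iff\<close>, \<open>orthogonal_split\<close>). Such a pair restricts to
  a graded orthogonal decomposition of \<open>add(\<G>)\<close>, and it is determined by the restriction because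
  \<open>\<G>\<close> detects zero objects: \<open>\<X>\<close> is the class of objects that receive no nonzero arrow from a shift of
  \<open>\<Y> \<inter> add(\<G>)\<close> (\<open>orthogonal_split_eq\<close>).

  The substance is the construction of a splitting from a decomposition. Write each generator as
  \<open>G\<^sub>i = A\<^sub>i \<oplus> B\<^sub>i\<close>. The candidates are \<open>\<X> = perp I B\<close> and \<open>\<Y> = perp I A\<close>, the classes of objects
  receiving no nonzero arrows from shifts of the \<open>B\<^sub>i\<close>, respectively of the \<open>A\<^sub>i\<close>. Every object \<open>M\<close> has a cellular
  approximation: a triangle \<open>T \<rightarrow> M \<rightarrow> Q \<rightarrow> T[1]\<close> with \<open>T\<close> built from the \<open>A\<^sub>i\<close> by coproducts, shifts and cones
  and \<open>Q\<close> in \<open>perp I A\<close> (\<open>cellular_approximation\<close>). Here \<open>T\<close> is a mapping telescope, and compactness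
  enters since arrows from \<open>A\<^sub>i\<close> to it come from a finite stage (\<open>mapping_telescope\<close>). Compactness also
  makes \<open>perp I B\<close> closed under coproducts, so it contains \<open>T\<close>. If \<open>M\<close> lies in \<open>perp I B\<close>, then \<open>Q\<close> lies in
  both classes and is zero; hence \<open>perp I B\<close> is generated by the \<open>A\<^sub>i\<close> and has no nonzero arrows to
  \<open>perp I A\<close> (\<open>perp_orthogonal\<close>). By symmetry there are none back, the connecting arrow \<open>Q \<rightarrow> T[1]\<close>
  vanishes, and \<open>M\<close> is the biproduct of \<open>T\<close> and \<open>Q\<close> (\<open>perp_split\<close>).

  A decomposition gives the idempotents \<open>e\<^sub>i : G\<^sub>i \<rightarrow> A\<^sub>i \<rightarrow> G\<^sub>i\<close>, which commute with all arrows between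
  shifted generators as these are block diagonal. Since \<open>perp I A\<close> and \<open>perp I B\<close> can be described by the
  \<open>e\<^sub>i\<close> (\<open>perp_complement_eq\<close>), the decomposition is determined by them. Conversely idempotents split in
  the presence of countable coproducts (\<open>idempotent_splits\<close>), commutation makes the resulting summands
  orthogonal (\<open>graded_central_idempotent_splits\<close>), and the splitting of the whole category that they
  define restricts to a decomposition with the given idempotents.
\<close>

section \<open>Calculus of arrows\<close>

context category
begin

lemma Hom_iff: "f \<in> Hom D X Y \<longleftrightarrow> f \<in> Arr D \<and> src D f = X \<and> tgt D f = Y"
  by (simp add: Hom_def)

lemma comp_Arr:
  assumes "f \<in> Arr D" "g \<in> Arr D" "src D g = tgt D f"
  shows "g \<cdot> f \<in> Arr D" "src D (g \<cdot> f) = src D f" "tgt D (g \<cdot> f) = tgt D g"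
  using comp_Hom[of f "src D f" "tgt D f" g "tgt D g"] assms by (auto simp: Hom_def)

lemma ide_Arr:
  assumes "X \<in> Obj D"
  shows "ide D X \<in> Arr D" "src D (ide D X) = X" "tgt D (ide D X) = X"
  using ide_Hom[OF assms] by (auto simp: Hom_def)

lemma assoc_Arr:
  assumes "f \<in> Arr D" "g \<in> Arr D" "h \<in> Arr D" "src D g = tgt D f" "src D h = tgt D g"
  shows "(h \<cdot> g) \<cdot> f = h \<cdot> (g \<cdot> f)"
  using comp_assoc[of f "src D f" "tgt D f" g "tgt D g" h "tgt D h"] assms by (auto simp: Hom_def)

lemma ide_left_Arr: "f \<in> Arr D \<Longrightarrow> tgt D f = Y \<Longrightarrow> ide D Y \<cdot> f = f"
  using comp_ide_left[of f "src D f" "tgt D f"] by (auto simp: Hom_def)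

lemma ide_right_Arr: "f \<in> Arr D \<Longrightarrow> src D f = X \<Longrightarrow> f \<cdot> ide D X = f"
  using comp_ide_right[of f "src D f" "tgt D f"] by (auto simp: Hom_def)

lemma Hom_Obj: "f \<in> Hom D X Y \<Longrightarrow> X \<in> Obj D" "f \<in> Hom D X Y \<Longrightarrow> Y \<in> Obj D"
  using src_Obj tgt_Obj by (auto simp: Hom_def)

lemmas arr = Hom_iff comp_Arr ide_Arr assoc_Arr ide_left_Arr ide_right_Arr src_Obj tgt_Obj

lemma comp_reassoc:
  assumes "g \<cdot> f = k" "f \<in> Hom D X Y" "g \<in> Hom D Y Z" "x \<in> Hom D W X"
  shows "g \<cdot> (f \<cdot> x) = k \<cdot> x"
  using comp_assoc[OF assms(4,2,3)] assms(1) by simp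

lemma coproduct_ext:
  assumes "is_coproduct D J M P \<iota>" "f \<in> Hom D P T" "g \<in> Hom D P T"
    and eq: "\<And>j. j \<in> J \<Longrightarrow> f \<cdot> \<iota> j = g \<cdot> \<iota> j"
  shows "f = g"
proof -
  have "\<exists>!h. h \<in> Hom D P T \<and> (\<forall>j \<in> J. h \<cdot> \<iota> j = g \<cdot> \<iota> j)"
    using assms(1) Hom_Obj(2)[OF assms(2)] comp_Hom[OF _ assms(3)] by (auto simp: is_coproduct_def)
  then show ?thesis using assms by blast
qed

lemma coproduct_desc:
  assumes "is_coproduct D J M P \<iota>" "T \<in> Obj D" "\<And>j. j \<in> J \<Longrightarrow> f j \<in> Hom D (M j) T"
  obtains h where "h \<in> Hom D P T" "\<And>j. j \<in> J \<Longrightarrow> h \<cdot> \<iota> j = f j"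
  using assms unfolding is_coproduct_def by blast

lemma coproduct_inj: "is_coproduct D J M P \<iota> \<Longrightarrow> j \<in> J \<Longrightarrow> \<iota> j \<in> Hom D (M j) P"
  and coproduct_Obj: "is_coproduct D J M P \<iota> \<Longrightarrow> P \<in> Obj D"
  unfolding is_coproduct_def by blast+

lemma coproduct_reindex:
  assumes g: "bij_betw g A J" and P: "is_coproduct D J M P \<iota>"
  shows "is_coproduct D A (\<lambda>a. M (g a)) P (\<lambda>a. \<iota> (g a))"
  unfolding is_coproduct_def
proof (intro conjI ballI allI impI)
  show "P \<in> Obj D" using P by (rule coproduct_Obj)
  show "\<iota> (g a) \<in> Hom D (M (g a)) P" if "a \<in> A" for a
    using coproduct_inj[OF P] g that by (auto simp: bij_betw_def)
next
  fix T f assume T: "T \<in> Obj D" and f: "\<forall>a\<in>A. f a \<in> Hom D (M (g a)) T"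
  have "f (inv_into A g j) \<in> Hom D (M j) T" if "j \<in> J" for j
    using f g that bij_betw_inv_into_right[OF g that] inv_into_into[of j g A]
    by (metis bij_betw_imp_surj_on)
  then obtain h where h: "h \<in> Hom D P T" "\<And>j. j \<in> J \<Longrightarrow> h \<cdot> \<iota> j = f (inv_into A g j)"
    using coproduct_desc[OF P T, where f = "\<lambda>j. f (inv_into A g j)"] by blast
  show "\<exists>!h. h \<in> Hom D P T \<and> (\<forall>a\<in>A. h \<cdot> \<iota> (g a) = f a)"
  proof (rule ex1I[of _ h])
    show "h \<in> Hom D P T \<and> (\<forall>a\<in>A. h \<cdot> \<iota> (g a) = f a)"
      using h g bij_betw_inv_into_left[OF g] by (auto simp: bij_betw_def)
    fix k assume k: "k \<in> Hom D P T \<and> (\<forall>a\<in>A. k \<cdot> \<iota> (g a) = f a)"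
    show "k = h"
    proof (rule coproduct_ext[OF P])
      fix j assume "j \<in> J"
      then have "g (inv_into A g j) = j" "inv_into A g j \<in> A"
        using g bij_betw_inv_into_right[OF g] inv_into_into[of j g A] by (auto simp: bij_betw_def)
      then show "k \<cdot> \<iota> j = h \<cdot> \<iota> j" using k h(2)[OF \<open>j \<in> J\<close>] by metis
    qed (use h k in auto)
  qed
qed

lemma coproduct_cong:
  assumes "\<And>j. j \<in> J \<Longrightarrow> M j = M' j" "\<And>j. j \<in> J \<Longrightarrow> \<iota> j = \<iota>' j"
  shows "is_coproduct D J M P \<iota> \<longleftrightarrow> is_coproduct D J M' P \<iota>'"
  using assms unfolding is_coproduct_def by simp

end

context preadditive_category
begin

lemma zeroA_Hom: "X \<in> Obj D \<Longrightarrow> Y \<in> Obj D \<Longrightarrow> zeroA D X Y \<in> Hom D X Y"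
  using comm_groupE(2)[OF hom_comm_group] by (simp add: hom_group_def)

lemma addA_Hom: "f \<in> Hom D X Y \<Longrightarrow> g \<in> Hom D X Y \<Longrightarrow> addA D f g \<in> Hom D X Y"
  using comm_groupE(1)[OF hom_comm_group[of X Y]] Hom_Obj[of f X Y] by (simp add: hom_group_def)

lemma add_assoc:
  "f \<in> Hom D X Y \<Longrightarrow> g \<in> Hom D X Y \<Longrightarrow> h \<in> Hom D X Y
    \<Longrightarrow> addA D (addA D f g) h = addA D f (addA D g h)"
  using comm_groupE(3)[OF hom_comm_group[of X Y]] Hom_Obj[of f X Y] by (simp add: hom_group_def)

lemma add_commute:
  "f \<in> Hom D X Y \<Longrightarrow> g \<in> Hom D X Y \<Longrightarrow> addA D f g = addA D g f"
  using comm_groupE(4)[OF hom_comm_group[of X Y]] Hom_Obj[of f X Y] by (simp add: hom_group_def)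

lemma add_zero_left: "f \<in> Hom D X Y \<Longrightarrow> addA D (zeroA D X Y) f = f"
  using comm_groupE(5)[OF hom_comm_group[of X Y]] Hom_Obj[of f X Y] by (simp add: hom_group_def)

lemma add_zero_right: "f \<in> Hom D X Y \<Longrightarrow> addA D f (zeroA D X Y) = f"
  using add_zero_left add_commute zeroA_Hom Hom_Obj by metis

lemma negA_Hom: "f \<in> Hom D X Y \<Longrightarrow> negA D f \<in> Hom D X Y"
  and add_negA_left: "f \<in> Hom D X Y \<Longrightarrow> addA D (negA D f) f = zeroA D X Y"
  and add_negA_right: "f \<in> Hom D X Y \<Longrightarrow> addA D f (negA D f) = zeroA D X Y"
proof -
  assume f: "f \<in> Hom D X Y"
  interpret h: comm_group "hom_group D X Y"
    using hom_comm_group Hom_Obj[OF f] by blast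
  have f': "f \<in> carrier (hom_group D X Y)" and n: "negA D f = inv\<^bsub>hom_group D X Y\<^esub> f"
    using f by (simp_all add: hom_group_def negA_def Hom_def)
  show "negA D f \<in> Hom D X Y" "addA D (negA D f) f = zeroA D X Y" "addA D f (negA D f) = zeroA D X Y"
    using h.inv_closed[OF f'] h.l_inv[OF f'] h.r_inv[OF f'] unfolding n by (simp_all add: hom_group_def)
qed

lemma add_left_cancel:
  assumes "f \<in> Hom D X Y" "g \<in> Hom D X Y" "h \<in> Hom D X Y" "addA D h f = addA D h g"
  shows "f = g"
proof -
  have "addA D (addA D (negA D h) h) f = addA D (addA D (negA D h) h) g"
    using assms add_assoc[of "negA D h" X Y h] negA_Hom[OF assms(3)] by simp
  then show ?thesis using assms add_negA_left add_zero_left by simp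
qed

lemma comp_zero_right: "g \<in> Hom D Y Z \<Longrightarrow> X \<in> Obj D \<Longrightarrow> g \<cdot> zeroA D X Y = zeroA D X Z"
proof -
  assume g: "g \<in> Hom D Y Z" and X: "X \<in> Obj D"
  let ?z = "zeroA D X Y"
  have z: "?z \<in> Hom D X Y" using X zeroA_Hom Hom_Obj[OF g] by blast
  have gz: "g \<cdot> ?z \<in> Hom D X Z" using comp_Hom[OF z g] .
  have "addA D (g \<cdot> ?z) (g \<cdot> ?z) = addA D (g \<cdot> ?z) (zeroA D X Z)"
    using comp_add_right[OF z z g] add_zero_left[OF z] add_zero_right[OF gz] by simp
  then show ?thesis using add_left_cancel[OF gz _ gz] zeroA_Hom X Hom_Obj[OF g] by blast
qed

lemma comp_zero_left: "f \<in> Hom D X Y \<Longrightarrow> Z \<in> Obj D \<Longrightarrow> zeroA D Y Z \<cdot> f = zeroA D X Z"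
proof -
  assume g: "f \<in> Hom D X Y" and X: "Z \<in> Obj D"
  let ?z = "zeroA D Y Z"
  have z: "?z \<in> Hom D Y Z" using X zeroA_Hom Hom_Obj[OF g] by blast
  have gz: "?z \<cdot> f \<in> Hom D X Z" using comp_Hom[OF g z] .
  have "addA D (?z \<cdot> f) (?z \<cdot> f) = addA D (?z \<cdot> f) (zeroA D X Z)"
    using comp_add_left[OF g z z] add_zero_left[OF z] add_zero_right[OF gz] by simp
  then show ?thesis using add_left_cancel[OF gz _ gz] zeroA_Hom X Hom_Obj[OF g] by blast
qed

definition sub :: "'a \<Rightarrow> 'a \<Rightarrow> 'a" where
  "sub f g = addA D f (negA D g)"

lemma sub_Hom: "f \<in> Hom D X Y \<Longrightarrow> g \<in> Hom D X Y \<Longrightarrow> sub f g \<in> Hom D X Y"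
  unfolding sub_def by (blast intro: addA_Hom negA_Hom)

lemma add_sub_cancel: 
  assumes "f \<in> Hom D X Y" "g \<in> Hom D X Y"
  shows "addA D (sub f g) g = f"
  using assms add_assoc[OF assms(1) negA_Hom[OF assms(2)] assms(2)]
  by (simp add: sub_def add_negA_left add_zero_right)

lemma sub_eq_iff:
  assumes "f \<in> Hom D X Y" "g \<in> Hom D X Y" "h \<in> Hom D X Y"
  shows "sub f g = h \<longleftrightarrow> f = addA D h g"
proof
  show "sub f g = h \<Longrightarrow> f = addA D h g" using add_sub_cancel[OF assms(1,2)] by simp
  assume "f = addA D h g"
  then have "addA D g (sub f g) = addA D g h"
    using add_sub_cancel[OF assms(1,2)] add_commute[OF assms(2) sub_Hom[OF assms(1,2)]]
      add_commute[OF assms(2,3)] by simp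
  then show "sub f g = h" using add_left_cancel[OF sub_Hom[OF assms(1,2)] assms(3,2)] by simp
qed

lemma sub_eq_zero_iff:
  assumes "f \<in> Hom D X Y" "g \<in> Hom D X Y"
  shows "sub f g = zeroA D X Y \<longleftrightarrow> f = g"
  using assms sub_eq_iff[OF assms zeroA_Hom] Hom_Obj[OF assms(1)] add_zero_left by simp

lemma comp_sub_right:
  assumes "f \<in> Hom D X Y" "f' \<in> Hom D X Y" "g \<in> Hom D Y Z"
  shows "g \<cdot> sub f f' = sub (g \<cdot> f) (g \<cdot> f')"
proof -
  have "g \<cdot> f = addA D (g \<cdot> sub f f') (g \<cdot> f')"
    using comp_add_right[OF sub_Hom[OF assms(1,2)] assms(2,3)] add_sub_cancel[OF assms(1,2)] by simp
  then show ?thesis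
    using sub_eq_iff[OF comp_Hom[OF assms(1,3)] comp_Hom[OF assms(2,3)]
        comp_Hom[OF sub_Hom[OF assms(1,2)] assms(3)]] by simp
qed

lemma comp_sub_left:
  assumes "f \<in> Hom D X Y" "g \<in> Hom D Y Z" "g' \<in> Hom D Y Z"
  shows "sub g g' \<cdot> f = sub (g \<cdot> f) (g' \<cdot> f)"
proof -
  have "g \<cdot> f = addA D (sub g g' \<cdot> f) (g' \<cdot> f)"
    using comp_add_left[OF assms(1) sub_Hom[OF assms(2,3)] assms(3)] add_sub_cancel[OF assms(2,3)]
    by simp
  then show ?thesis
    using sub_eq_iff[OF comp_Hom[OF assms(1,2)] comp_Hom[OF assms(1,3)]
        comp_Hom[OF assms(1) sub_Hom[OF assms(2,3)]]] by simp
qed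

lemma negA_unique:
  assumes "f \<in> Hom D X Y" "g \<in> Hom D X Y" "addA D f g = zeroA D X Y"
  shows "g = negA D f"
  using add_left_cancel[OF assms(2) negA_Hom[OF assms(1)] assms(1)] assms add_negA_right[OF assms(1)]
  by simp

lemma comp_negA_left:
  assumes "f \<in> Hom D X Y" "g \<in> Hom D Y Z"
  shows "negA D g \<cdot> f = negA D (g \<cdot> f)"
  using comp_add_left[OF assms(1,2) negA_Hom[OF assms(2)]] add_negA_right[OF assms(2)]
    comp_zero_left[OF assms(1)] Hom_Obj[OF assms(2)] comp_Hom[OF assms(1)] assms(2)
    negA_Hom[OF assms(2)]
  by (intro negA_unique) auto

lemma comp_negA_right:
  assumes "f \<in> Hom D X Y" "g \<in> Hom D Y Z"
  shows "g \<cdot> negA D f = negA D (g \<cdot> f)"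
  using comp_add_right[OF assms(1) negA_Hom[OF assms(1)] assms(2)] add_negA_right[OF assms(1)]
    comp_zero_right[OF assms(2)] Hom_Obj[OF assms(1)] comp_Hom[OF _ assms(2)] assms(1)
    negA_Hom[OF assms(1)]
  by (intro negA_unique) auto

lemma hom_vanishes_iff:
  "X \<in> Obj D \<Longrightarrow> Y \<in> Obj D \<Longrightarrow> hom_vanishes D X Y \<longleftrightarrow> (\<forall>f \<in> Hom D X Y. f = zeroA D X Y)"
  using zeroA_Hom unfolding hom_vanishes_def by blast

lemma is_zero_object_iff:
  "Z \<in> Obj D \<Longrightarrow> is_zero_object D Z \<longleftrightarrow> ide D Z = zeroA D Z Z"
proof
  assume Z: "Z \<in> Obj D"
  show "is_zero_object D Z \<Longrightarrow> ide D Z = zeroA D Z Z"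
    using ide_Hom zeroA_Hom Z unfolding is_zero_object_def by blast
  assume e: "ide D Z = zeroA D Z Z"
  have "f = zeroA D X Z" if "f \<in> Hom D X Z" for f X
    using comp_ide_left[OF that] comp_zero_left[OF that Z] e by simp
  moreover have "f = zeroA D Z X" if "f \<in> Hom D Z X" for f X
    using comp_ide_right[OF that] comp_zero_right[OF that Z] e by simp
  ultimately show "is_zero_object D Z"
    unfolding is_zero_object_def using Z zeroA_Hom by blast
qed

lemma zero_object_Hom:
  assumes "is_zero_object D Z"
  shows "f \<in> Hom D X Z \<Longrightarrow> f = zeroA D X Z" "f \<in> Hom D Z X \<Longrightarrow> f = zeroA D Z X"
  using assms zeroA_Hom Hom_Obj unfolding is_zero_object_def by metis+

lemma coproduct_eq_zero:
  assumes "is_coproduct D J M P \<iota>" "f \<in> Hom D P T" 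
    and "\<And>j. j \<in> J \<Longrightarrow> f \<cdot> \<iota> j = zeroA D (M j) T"
  shows "f = zeroA D P T"
proof (rule coproduct_ext[OF assms(1,2)])
  show "zeroA D P T \<in> Hom D P T" using zeroA_Hom Hom_Obj[OF assms(2)] by blast
  show "f \<cdot> \<iota> j = zeroA D P T \<cdot> \<iota> j" if "j \<in> J" for j
    using assms(3)[OF that] comp_zero_left[OF coproduct_inj[OF assms(1) that]] Hom_Obj[OF assms(2)]
    by simp
qed

text \<open>The product projections exist on any coproduct, whatever its size, because the zero arrows
  allow a family to be prescribed by its value on one summand.\<close>

lemma coproduct_proj:
  assumes P: "is_coproduct D J M P \<iota>" and j: "j \<in> J" and M: "\<And>j. j \<in> J \<Longrightarrow> M j \<in> Obj D"
  obtains p where "p \<in> Hom D P (M j)" "p \<cdot> \<iota> j = ide D (M j)"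
    "\<And>i. i \<in> J \<Longrightarrow> i \<noteq> j \<Longrightarrow> p \<cdot> \<iota> i = zeroA D (M i) (M j)"
proof -
  let ?f = "\<lambda>i. if i = j then ide D (M j) else zeroA D (M i) (M j)"
  have "?f i \<in> Hom D (M i) (M j)" if "i \<in> J" for i
    using M[OF j] M[OF that] ide_Hom zeroA_Hom by auto
  then obtain p where "p \<in> Hom D P (M j)" "\<And>i. i \<in> J \<Longrightarrow> p \<cdot> \<iota> i = ?f i"
    using coproduct_desc[OF P M[OF j], where f = ?f] by blast
  then show ?thesis using that j by auto
qed

section \<open>Biproducts\<close>

definition biproduct :: "'o \<Rightarrow> 'o \<Rightarrow> 'o \<Rightarrow> 'a \<Rightarrow> 'a \<Rightarrow> 'a \<Rightarrow> 'a \<Rightarrow> bool" where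
  "biproduct A B M a b p q \<longleftrightarrow> A \<in> Obj D \<and> B \<in> Obj D \<and> M \<in> Obj D \<and>
     a \<in> Hom D A M \<and> b \<in> Hom D B M \<and> p \<in> Hom D M A \<and> q \<in> Hom D M B \<and>
     p \<cdot> a = ide D A \<and> q \<cdot> b = ide D B \<and> p \<cdot> b = zeroA D B A \<and> q \<cdot> a = zeroA D A B \<and>
     addA D (a \<cdot> p) (b \<cdot> q) = ide D M"

lemma biproduct_ext_source:
  assumes "biproduct A B M a b p q" "f \<in> Hom D M T" "g \<in> Hom D M T" "f \<cdot> a = g \<cdot> a" "f \<cdot> b = g \<cdot> b"
  shows "f = g"
proof -
  have h: "h = addA D ((h \<cdot> a) \<cdot> p) ((h \<cdot> b) \<cdot> q)" if "h \<in> Hom D M T" for h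
    using that assms(1) comp_ide_right[OF that] comp_add_right[of "a \<cdot> p" M M "b \<cdot> q" h T]
    unfolding biproduct_def by (auto simp: arr)
  show ?thesis using h[OF assms(2)] h[OF assms(3)] assms(4,5) by simp
qed

lemma biproduct_sym:
  assumes "biproduct A B M a b p q" shows "biproduct B A M b a q p"
  using assms add_commute[of "a \<cdot> p" M M "b \<cdot> q"] unfolding biproduct_def by (auto simp: arr)

text \<open>Biproduct data amount to a binary coproduct: they supply descents by the formula
  \<open>f p + g q\<close>, and the converse takes for \<open>p\<close> and \<open>q\<close> the arrows that are \<open>(1, 0)\<close> and \<open>(0, 1)\<close> on
  the summands.\<close>

lemma biproduct_imp_coproduct2:
  assumes "biproduct A B M a b p q"
  shows "is_coproduct2 D A B M a b"
  unfolding is_coproduct2_def is_coproduct_def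
proof (intro conjI ballI allI impI)
  show "M \<in> Obj D" "\<And>j. (if j then a else b) \<in> Hom D (if j then A else B) M"
    using assms by (auto simp: biproduct_def)
  fix T f assume T: "T \<in> Obj D" and "\<forall>j\<in>UNIV. f j \<in> Hom D (if j then A else B) T"
  then have f: "f True \<in> Hom D A T" "f False \<in> Hom D B T" by (metis UNIV_I)+
  let ?h = "addA D (f True \<cdot> p) (f False \<cdot> q)"
  have h: "?h \<in> Hom D M T" "?h \<cdot> a = f True" "?h \<cdot> b = f False"
    using f T assms
      comp_add_left[of a A M "f True \<cdot> p" T "f False \<cdot> q"]
      comp_add_left[of b B M "f True \<cdot> p" T "f False \<cdot> q"]
      addA_Hom[of "f True \<cdot> p" M T "f False \<cdot> q"]
      add_zero_left[of "f False" B T] add_zero_right[of "f True" A T]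
      comp_zero_right[of "f True" A T B] comp_zero_right[of "f False" B T A]
    by (auto simp: biproduct_def arr)
  show "\<exists>!h. h \<in> Hom D M T \<and> (\<forall>j\<in>UNIV. h \<cdot> (if j then a else b) = f j)"
  proof (rule ex1I[of _ ?h])
    show "?h \<in> Hom D M T \<and> (\<forall>j\<in>UNIV. ?h \<cdot> (if j then a else b) = f j)" using h by simp
    fix k assume k: "k \<in> Hom D M T \<and> (\<forall>j\<in>UNIV. k \<cdot> (if j then a else b) = f j)"
    then have "k \<cdot> a = f True" "k \<cdot> b = f False" by (metis UNIV_I)+
    then show "k = ?h"
      using k h biproduct_ext_source[OF assms] by auto
  qed
qed

lemma coproduct2_imp_biproduct:
  assumes P: "is_coproduct2 D A B M a b" and A: "A \<in> Obj D" and B: "B \<in> Obj D"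
  obtains p q where "biproduct A B M a b p q"
proof -
  have M: "M \<in> Obj D" using P by (auto simp: is_coproduct2_def is_coproduct_def)
  have a: "a \<in> Hom D A M" and b: "b \<in> Hom D B M"
    using P unfolding is_coproduct2_def is_coproduct_def by (metis UNIV_I)+
  have desc: "\<exists>h. h \<in> Hom D M T \<and> h \<cdot> a = f \<and> h \<cdot> b = g"
    if "f \<in> Hom D A T" "g \<in> Hom D B T" for f g T
  proof -
    note fg = that
    have T: "T \<in> Obj D" using Hom_Obj fg by blast
    obtain h where h: "h \<in> Hom D M T"
      "\<And>j :: bool. h \<cdot> (if j then a else b) = (if j then f else g)"
      by (rule coproduct_desc[OF P[unfolded is_coproduct2_def] T,
            where f = "\<lambda>j. if j then f else g"]) (use fg in auto)
    show ?thesis using h(1) h(2)[of True] h(2)[of False] by auto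
  qed
  have ext: "f = g" if "f \<in> Hom D M T" "g \<in> Hom D M T" "f \<cdot> a = g \<cdot> a" "f \<cdot> b = g \<cdot> b" for f g T
    using coproduct_ext[OF P[unfolded is_coproduct2_def] that(1,2)] that(3,4) by simp
  obtain p where p: "p \<in> Hom D M A" "p \<cdot> a = ide D A" "p \<cdot> b = zeroA D B A"
    using desc[OF ide_Hom[OF A] zeroA_Hom[OF B A]] by blast
  obtain q where q: "q \<in> Hom D M B" "q \<cdot> a = zeroA D A B" "q \<cdot> b = ide D B"
    using desc[OF zeroA_Hom[OF A B] ide_Hom[OF B]] by blast
  have "addA D (a \<cdot> p) (b \<cdot> q) = ide D M"
  proof (rule ext)
    show "addA D (a \<cdot> p) (b \<cdot> q) \<in> Hom D M M" using addA_Hom comp_Hom a b p q by blast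
    show "ide D M \<in> Hom D M M" using ide_Hom M by blast
    show "addA D (a \<cdot> p) (b \<cdot> q) \<cdot> a = ide D M \<cdot> a"
      using a b p q M comp_add_left[of a A M "a \<cdot> p" M "b \<cdot> q"] add_zero_right[OF a]
        comp_zero_right[OF b A]
      by (auto simp: arr)
    show "addA D (a \<cdot> p) (b \<cdot> q) \<cdot> b = ide D M \<cdot> b"
      using a b p q M comp_add_left[of b B M "a \<cdot> p" M "b \<cdot> q"] add_zero_left[OF b]
        comp_zero_right[OF a B]
      by (auto simp: arr)
  qed
  then show ?thesis using that A B M a b p q unfolding biproduct_def by blast
qed

lemma biproductD:
  assumes "biproduct A B M a b p q"
  shows "A \<in> Obj D" "B \<in> Obj D" "M \<in> Obj D"
    "a \<in> Hom D A M" "b \<in> Hom D B M" "p \<in> Hom D M A" "q \<in> Hom D M B"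
    "p \<cdot> a = ide D A" "q \<cdot> b = ide D B" "p \<cdot> b = zeroA D B A" "q \<cdot> a = zeroA D A B"
    "addA D (a \<cdot> p) (b \<cdot> q) = ide D M"
  using assms unfolding biproduct_def by auto

lemma biproduct_trivial_iso:
  assumes "biproduct A B M a b p q" "ide D B = zeroA D B B"
  shows "isomorphic_in D A M"
proof -
  note bp = biproductD[OF assms(1)]
  have "q = zeroA D M B" using comp_ide_left[OF bp(7)] comp_zero_left[OF bp(7) bp(2)] assms(2) by simp
  then have "a \<cdot> p = ide D M"
    using bp comp_zero_right[OF bp(5) bp(3)] add_zero_right[OF comp_Hom[OF bp(6) bp(4)]] by simp
  then show ?thesis
    unfolding isomorphic_in_def is_iso_arr_def using bp
    by (intro bexI[of _ a] conjI bexI[of _ p]) (auto simp: Hom_iff)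
qed

end

section \<open>Triangulated categories\<close>

context triangulated_category
begin

lemma shO_shO: "X \<in> Obj D \<Longrightarrow> shO D m (shO D n X) = shO D (m + n) X"
  by (rule shO_plus[symmetric])

lemma shA_shA: "f \<in> Arr D \<Longrightarrow> shA D m (shA D n f) = shA D (m + n) f"
  by (rule shA_plus[symmetric])

lemma shO_inv: "X \<in> Obj D \<Longrightarrow> shO D n (shO D (-n) X) = X" "X \<in> Obj D \<Longrightarrow> shO D (-n) (shO D n X) = X"
  by (simp_all add: shO_shO shO_0)

lemma shA_inv: "f \<in> Arr D \<Longrightarrow> shA D n (shA D (-n) f) = f" "f \<in> Arr D \<Longrightarrow> shA D (-n) (shA D n f) = f"
  by (simp_all add: shA_shA shA_0)

lemma shA_inject: "f \<in> Arr D \<Longrightarrow> g \<in> Arr D \<Longrightarrow> shA D n f = shA D n g \<longleftrightarrow> f = g"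
  using shA_inv(2)[of f n] shA_inv(2)[of g n] by (metis (mono_tags))

lemma shA_zeroA:
  assumes "X \<in> Obj D" "Y \<in> Obj D"
  shows "shA D n (zeroA D X Y) = zeroA D (shO D n X) (shO D n Y)"
proof -
  let ?z = "zeroA D X Y"
  have z: "?z \<in> Hom D X Y" using assms by (rule zeroA_Hom)
  have "addA D (shA D n ?z) (shA D n ?z) = addA D (shA D n ?z) (zeroA D (shO D n X) (shO D n Y))"
    using sh_add[OF z z, of n] add_zero_left[OF z] add_zero_right[OF sh_Hom[OF z]] by simp
  then show ?thesis
    using add_left_cancel[OF sh_Hom[OF z] zeroA_Hom sh_Hom[OF z]] sh_Obj assms by blast
qed

lemma unshift_Hom:
  assumes "f \<in> Hom D (shO D n X) (shO D n Y)" "X \<in> Obj D" "Y \<in> Obj D"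
  obtains g where "g \<in> Hom D X Y" "f = shA D n g"
proof
  show "shA D (-n) f \<in> Hom D X Y"
    using sh_Hom[OF assms(1), of "-n"] shO_inv assms by simp
  show "f = shA D n (shA D (-n) f)"
    using shA_inv assms by (simp add: Hom_iff)
qed

lemma hom_vanishes_shift:
  assumes "X \<in> Obj D" "Y \<in> Obj D"
  shows "hom_vanishes D (shO D n X) (shO D n Y) \<longleftrightarrow> hom_vanishes D X Y"
proof -
  have "f = zeroA D X Y"
    if v: "hom_vanishes D (shO D n X) (shO D n Y)" and f: "f \<in> Hom D X Y" for f
  proof -
    have "shA D n f = shA D n (zeroA D X Y)"
      using sh_Hom[OF f, of n] v shA_zeroA[OF assms, of n] by (simp add: hom_vanishes_def)
    then show ?thesis using shA_inject f zeroA_Hom[OF assms] by (simp add: Hom_iff)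
  qed
  moreover have "f = zeroA D (shO D n X) (shO D n Y)"
    if v: "hom_vanishes D X Y" and f: "f \<in> Hom D (shO D n X) (shO D n Y)" for f
  proof -
    obtain g where "g \<in> Hom D X Y" "f = shA D n g" using unshift_Hom[OF f assms] by blast
    then show ?thesis using v shA_zeroA[OF assms, of n] by (simp add: hom_vanishes_def)
  qed
  ultimately show ?thesis using hom_vanishes_iff assms sh_Obj by blast
qed

lemma hom_vanishes_shift_left:
  assumes "X \<in> Obj D" "Y \<in> Obj D"
  shows "hom_vanishes D (shO D n X) Y \<longleftrightarrow> hom_vanishes D X (shO D (-n) Y)"
  using hom_vanishes_shift[of X "shO D (-n) Y" n] shO_inv sh_Obj assms by simp

lemma is_zero_object_shift: "is_zero_object D Z \<Longrightarrow> is_zero_object D (shO D n Z)"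
proof -
  assume z: "is_zero_object D Z"
  then have "Z \<in> Obj D" by (simp add: is_zero_object_def)
  then show ?thesis
    using z is_zero_object_iff sh_Obj sh_ide[of Z n] shA_zeroA[of Z Z n] by auto
qed

lemma TriD:
  assumes "(u, v, w) \<in> Tri D" "u \<in> Hom D X Y" "v \<in> Hom D Y Z"
  shows "w \<in> Hom D Z (shO D 1 X)"
  using Tri_triangle[OF assms(1)] assms by (auto simp: is_triangle_def Hom_iff)

lemma TriE:
  assumes "(u, v, w) \<in> Tri D"
  obtains X Y Z where "u \<in> Hom D X Y" "v \<in> Hom D Y Z" "w \<in> Hom D Z (shO D 1 X)"
  using Tri_triangle[OF assms(1)] by (auto simp: is_triangle_def Hom_iff)

lemma cone:
  assumes "u \<in> Hom D X Y"
  obtains Z v w where "(u, v, w) \<in> Tri D" "v \<in> Hom D Y Z" "w \<in> Hom D Z (shO D 1 X)"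
proof -
  obtain v w where t: "(u, v, w) \<in> Tri D" using Tri_cone[of u] assms unfolding Hom_iff by blast
  obtain X' Y' Z where "u \<in> Hom D X' Y'" "v \<in> Hom D Y' Z" "w \<in> Hom D Z (shO D 1 X')"
    using t by (rule TriE)
  then show ?thesis using that t assms by (auto simp: Hom_iff)
qed

lemma Tri_rot: "(u, v, w) \<in> Tri D \<Longrightarrow> (v, w, negA D (shA D 1 u)) \<in> Tri D"
  using Tri_rotate Tri_triangle by blast

lemma Tri_comp_zero:
  assumes t: "(u, v, w) \<in> Tri D" and u: "u \<in> Hom D X Y" and v: "v \<in> Hom D Y Z"
  shows "v \<cdot> u = zeroA D X Z"
proof -
  obtain N where N: "is_zero_object D N" using ex_zero_object by blast
  have X: "X \<in> Obj D" using Hom_Obj u by blast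
  have NO: "N \<in> Obj D" using N by (simp add: is_zero_object_def)
  have "\<exists>c. triangle_morphism D (ide D X, zeroA D X N, zeroA D N (shO D 1 X)) (u, v, w) (ide D X) u c"
    using Tri_fill[OF Tri_ide[OF X N] t, of "ide D X" u] ide_Hom[OF X] u X by (simp add: arr)
  then obtain c where c: "c \<in> Hom D N Z" "c \<cdot> zeroA D X N = v \<cdot> u"
    using v zeroA_Hom[OF X NO] by (auto simp: triangle_morphism_def Hom_iff)
  then show ?thesis using comp_zero_right[OF c(1) X] by simp
qed

lemma Tri_comp_zero_rot:
  assumes t: "(u, v, w) \<in> Tri D" and u: "u \<in> Hom D X Y" and v: "v \<in> Hom D Y Z"
  shows "w \<cdot> v = zeroA D Y (shO D 1 X)" "shA D 1 u \<cdot> w = zeroA D Z (shO D 1 Y)"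
proof -
  have w: "w \<in> Hom D Z (shO D 1 X)" using TriD[OF assms] .
  have u1: "shA D 1 u \<in> Hom D (shO D 1 X) (shO D 1 Y)" using u by (rule sh_Hom)
  show "w \<cdot> v = zeroA D Y (shO D 1 X)"
    using Tri_comp_zero[OF Tri_rot[OF t] v w] .
  have "negA D (shA D 1 u) \<cdot> w = zeroA D Z (shO D 1 Y)"
    using Tri_comp_zero[OF Tri_rot[OF Tri_rot[OF t]] w negA_Hom[OF u1]] .
  then have "negA D (shA D 1 u \<cdot> w) = zeroA D Z (shO D 1 Y)"
    using comp_negA_left[OF w u1] by simp
  then show "shA D 1 u \<cdot> w = zeroA D Z (shO D 1 Y)"
    using add_negA_right[OF comp_Hom[OF w u1]] add_zero_right[OF comp_Hom[OF w u1]] by simp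
qed

text \<open>In a triangle, the second arrow is a weak cokernel of the first, and the first is a weak kernel
  of the second. Both come from extending a morphism between the given triangle and a rotation of
  the trivial triangle on an identity.\<close>

lemma Tri_weak_cokernel:
  assumes t: "(u, v, w) \<in> Tri D" and u: "u \<in> Hom D X Y" and v: "v \<in> Hom D Y Z"
    and f: "f \<in> Hom D Y T" "f \<cdot> u = zeroA D X T"
  obtains s where "s \<in> Hom D Z T" "s \<cdot> v = f"
proof -
  obtain N where N: "is_zero_object D N" using ex_zero_object by blast
  have X: "X \<in> Obj D" and T: "T \<in> Obj D" using Hom_Obj u f by blast+
  have NO: "N \<in> Obj D" using N by (simp add: is_zero_object_def)
  have N1: "shO D 1 N \<in> Obj D" and T1: "shO D 1 T \<in> Obj D" using sh_Obj NO T by blast+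
  have z: "zeroA D N T \<in> Hom D N T" "zeroA D T (shO D 1 N) \<in> Hom D T (shO D 1 N)"
    "zeroA D X N \<in> Hom D X N"
    using zeroA_Hom NO T N1 X by blast+
  have "is_triangle D (zeroA D N T) (ide D T) (zeroA D T (shO D 1 N))"
    unfolding is_triangle_def using z T by (simp add: arr)
  moreover have "negA D (shA D 1 (zeroA D N T)) = zeroA D (shO D 1 N) (shO D 1 T)"
    using shA_zeroA[OF NO T] negA_unique[OF zeroA_Hom[OF N1 T1] zeroA_Hom[OF N1 T1]]
      add_zero_left[OF zeroA_Hom[OF N1 T1]] by simp
  ultimately have t': "(zeroA D N T, ide D T, zeroA D T (shO D 1 N)) \<in> Tri D"
    using Tri_rotate Tri_ide[OF T is_zero_object_shift[OF N, of 1]] by simp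
  have "\<exists>c. triangle_morphism D (u, v, w) (zeroA D N T, ide D T, zeroA D T (shO D 1 N)) (zeroA D X N) f c"
    using Tri_fill[OF t t', of "zeroA D X N" f] u z f comp_zero_right[OF z(1) X] by (simp add: Hom_iff)
  then obtain c where c: "c \<in> Hom D Z T" "c \<cdot> v = ide D T \<cdot> f"
    using v ide_Hom[OF T] by (auto simp: triangle_morphism_def Hom_iff)
  then show ?thesis using that comp_ide_left[OF f(1)] by simp
qed

lemma Tri_weak_kernel:
  assumes t: "(u, v, w) \<in> Tri D" and u: "u \<in> Hom D X Y" and v: "v \<in> Hom D Y Z"
    and f: "f \<in> Hom D T Y" "v \<cdot> f = zeroA D T Z"
  obtains s where "s \<in> Hom D T X" "u \<cdot> s = f"
proof -
  obtain N where N: "is_zero_object D N" using ex_zero_object by blast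
  have X: "X \<in> Obj D" and Z: "Z \<in> Obj D" and T: "T \<in> Obj D" using Hom_Obj u v f by blast+
  have NO: "N \<in> Obj D" using N by (simp add: is_zero_object_def)
  have T1: "shO D 1 T \<in> Obj D" using sh_Obj T by blast
  have w: "w \<in> Hom D Z (shO D 1 X)" using TriD[OF t u v] .
  have u1: "shA D 1 u \<in> Hom D (shO D 1 X) (shO D 1 Y)" using u by (rule sh_Hom)
  have z: "zeroA D T N \<in> Hom D T N" "zeroA D N (shO D 1 T) \<in> Hom D N (shO D 1 T)"
    "zeroA D N Z \<in> Hom D N Z"
    using zeroA_Hom NO T T1 Z by blast+
  have i: "ide D (shO D 1 T) \<in> Hom D (shO D 1 T) (shO D 1 T)" using T1 by (rule ide_Hom)
  have t': "(zeroA D T N, zeroA D N (shO D 1 T), negA D (ide D (shO D 1 T))) \<in> Tri D"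
    using Tri_rot[OF Tri_ide[OF T N]] sh_ide[OF T, of 1] by simp
  have "\<exists>c. triangle_morphism D (zeroA D T N, zeroA D N (shO D 1 T), negA D (ide D (shO D 1 T)))
      (v, w, negA D (shA D 1 u)) f (zeroA D N Z) c"
    using Tri_fill[OF t' Tri_rot[OF t], of f "zeroA D N Z"] z f v comp_zero_right[OF z(3) T]
    by (simp add: Hom_iff)
  then obtain c where c: "c \<in> Hom D (shO D 1 T) (shO D 1 X)"
      "shA D 1 f \<cdot> negA D (ide D (shO D 1 T)) = negA D (shA D 1 u) \<cdot> c"
    using w z by (auto simp: triangle_morphism_def Hom_iff)
  have f1: "shA D 1 f \<in> Hom D (shO D 1 T) (shO D 1 Y)" using f sh_Hom by blast
  have "negA D (shA D 1 f) = negA D (shA D 1 u \<cdot> c)"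
    using c comp_negA_left[OF c(1) u1] comp_negA_right[OF i f1] comp_ide_right[OF f1] by simp
  then have "addA D (negA D (shA D 1 f)) (shA D 1 f) = addA D (negA D (shA D 1 f)) (shA D 1 u \<cdot> c)"
    using add_negA_left[OF f1] add_negA_left[OF comp_Hom[OF c(1) u1]] by simp
  then have "shA D 1 f = shA D 1 u \<cdot> c"
    using add_left_cancel[OF f1 comp_Hom[OF c(1) u1] negA_Hom[OF f1]] by simp
  moreover obtain s where s: "s \<in> Hom D T X" "c = shA D 1 s"
    using unshift_Hom[OF c(1) T X] by blast
  ultimately have "shA D 1 f = shA D 1 (u \<cdot> s)" using sh_comp[OF s(1) u] by simp
  then have "f = u \<cdot> s" using shA_inject f s u comp_Hom[OF s(1) u] by (simp add: Hom_iff)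
  then show ?thesis using that s by simp
qed

text \<open>A section is the inclusion of a direct summand, the complement being its cone.\<close>

lemma Tri_section_biproduct:
  assumes t: "(u, v, w) \<in> Tri D" and u: "u \<in> Hom D X M" and v: "v \<in> Hom D M Z"
    and r: "r \<in> Hom D M X" "r \<cdot> u = ide D X"
  obtains b where "biproduct X Z M u b r v"
proof -
  have O: "X \<in> Obj D" "M \<in> Obj D" "Z \<in> Obj D" using Hom_Obj u v by blast+
  have w: "w \<in> Hom D Z (shO D 1 X)" using TriD[OF t u v] .
  have i: "ide D M \<in> Hom D M M" using O ide_Hom by blast
  have ur: "u \<cdot> r \<in> Hom D M M" using comp_Hom u r by blast
  let ?c = "sub (ide D M) (u \<cdot> r)"
  have c: "?c \<in> Hom D M M" using sub_Hom i ur by blast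
  have "?c \<cdot> u = sub u u"
    using comp_sub_left[OF u i ur] u r O by (simp add: arr)
  then have "?c \<cdot> u = zeroA D X M" using sub_eq_zero_iff u by simp
  then obtain b where b: "b \<in> Hom D Z M" "b \<cdot> v = ?c"
    using Tri_weak_cokernel[OF t u v c] by blast
  have vu: "v \<cdot> u = zeroA D X Z" using Tri_comp_zero[OF t u v] .
  \<comment> \<open>The connecting arrow vanishes because the shift of \<open>u\<close> is a monomorphism, so \<open>v\<close> is epi.\<close>
  have u1: "shA D 1 u \<in> Hom D (shO D 1 X) (shO D 1 M)" and r1: "shA D 1 r \<in> Hom D (shO D 1 M) (shO D 1 X)"
    using u r sh_Hom by blast+
  have "shA D 1 r \<cdot> shA D 1 u = ide D (shO D 1 X)"
    using sh_comp[OF u r(1), of 1] r O sh_ide by simp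
  then have "w = shA D 1 r \<cdot> (shA D 1 u \<cdot> w)"
    using comp_reassoc[OF _ u1 r1 w] comp_ide_left[OF w] by simp
  then have w0: "w = zeroA D Z (shO D 1 X)"
    using Tri_comp_zero_rot(2)[OF t u v] comp_zero_right[OF r1 O(3)] by simp
  have epi: "f = g" if fg: "f \<in> Hom D Z T" "g \<in> Hom D Z T" "f \<cdot> v = g \<cdot> v" for f g T
  proof -
    have "sub f g \<cdot> v = zeroA D M T"
      using comp_sub_left[OF v fg(1,2)] sub_eq_zero_iff[OF comp_Hom comp_Hom] fg v by simp
    then obtain s where s: "s \<in> Hom D (shO D 1 X) T" "s \<cdot> w = sub f g"
      using Tri_weak_cokernel[OF Tri_rot[OF t] v w sub_Hom[OF fg(1,2)]] by blast
    then have "sub f g = zeroA D Z T" using w0 comp_zero_right[OF s(1) O(3)] by simp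
    then show ?thesis using sub_eq_zero_iff fg by simp
  qed
  have "(v \<cdot> b) \<cdot> v = ide D Z \<cdot> v"
  proof -
    have "(v \<cdot> b) \<cdot> v = v \<cdot> ?c" using b v by (simp add: arr)
    also have "\<dots> = sub v ((v \<cdot> u) \<cdot> r)" using comp_sub_right[OF i ur v] u v r by (simp add: arr)
    also have "\<dots> = v" 
      unfolding vu comp_zero_left[OF r(1) O(3)]
      using sub_eq_iff[OF v zeroA_Hom v] add_zero_right[OF v] O by simp
    finally show ?thesis using v by (simp add: arr)
  qed
  then have vb: "v \<cdot> b = ide D Z" using epi[OF comp_Hom[OF b(1) v] ide_Hom] O by blast
  have "(r \<cdot> b) \<cdot> v = zeroA D Z X \<cdot> v"
  proof -
    have "(r \<cdot> b) \<cdot> v = r \<cdot> ?c" using b v r by (simp add: arr)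
    also have "\<dots> = sub r ((r \<cdot> u) \<cdot> r)" 
      using comp_sub_right[OF i ur r(1)] comp_assoc[OF r(1) u r(1)] comp_ide_right[OF r(1)] by simp
    also have "\<dots> = zeroA D M X" using r comp_ide_left[OF r(1)] sub_eq_zero_iff[OF r(1) r(1)] by simp
    finally show ?thesis using comp_zero_left[OF v O(1)] by simp
  qed
  then have rb: "r \<cdot> b = zeroA D Z X" using epi[OF comp_Hom[OF b(1) r(1)] zeroA_Hom] O by blast
  have "addA D (u \<cdot> r) (b \<cdot> v) = ide D M"
    using add_sub_cancel[OF i ur] add_commute[OF ur c] b by simp
  then have "biproduct X Z M u b r v"
    unfolding biproduct_def using O u b r v vb rb vu by blast
  then show ?thesis by (rule that)
qed

lemma section_biproduct:
  assumes u: "u \<in> Hom D X M" and r: "r \<in> Hom D M X" "r \<cdot> u = ide D X"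
  obtains Z b v where "biproduct X Z M u b r v"
proof -
  obtain Z v w where "(u, v, w) \<in> Tri D" "v \<in> Hom D M Z" using cone[OF u] by blast
  then show ?thesis using Tri_section_biproduct u r that by blast
qed

lemma Tri_zero_imp_section:
  assumes t: "(u, v, w) \<in> Tri D" and u: "u \<in> Hom D X M" and v: "v \<in> Hom D M Z"
    and w0: "w = zeroA D Z (shO D 1 X)"
  obtains r where "r \<in> Hom D M X" "r \<cdot> u = ide D X"
proof -
  have O: "X \<in> Obj D" "M \<in> Obj D" "Z \<in> Obj D" using Hom_Obj u v by blast+
  have w: "w \<in> Hom D Z (shO D 1 X)" using TriD[OF t u v] .
  have u1: "shA D 1 u \<in> Hom D (shO D 1 X) (shO D 1 M)" using u sh_Hom by blast
  have X1: "shO D 1 X \<in> Obj D" using O sh_Obj by blast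
  have "ide D (shO D 1 X) \<cdot> w = zeroA D Z (shO D 1 X)" using comp_ide_left[OF w] w0 by simp
  then obtain s where s: "s \<in> Hom D (shO D 1 M) (shO D 1 X)" "s \<cdot> negA D (shA D 1 u) = ide D (shO D 1 X)"
    using Tri_weak_cokernel[OF Tri_rot[OF Tri_rot[OF t]] w negA_Hom[OF u1] ide_Hom[OF X1]] by blast
  have e: "negA D s \<cdot> shA D 1 u = ide D (shO D 1 X)"
    using s comp_negA_left[OF u1 s(1)] comp_negA_right[OF u1 s(1)] by simp
  obtain r where r: "r \<in> Hom D M X" "negA D s = shA D 1 r"
    using unshift_Hom[OF negA_Hom[OF s(1)] O(2,1)] by blast
  then have "shA D 1 (r \<cdot> u) = shA D 1 (ide D X)"
    using e sh_comp[OF u r(1)] sh_ide O by simp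
  then have "r \<cdot> u = ide D X"
    using shA_inject comp_Hom[OF u r(1)] ide_Hom[OF O(1)] by (simp add: Hom_iff)
  then show ?thesis using that r by blast
qed

section \<open>Splitting of idempotents\<close>

text \<open>An idempotent \<open>e\<close> on \<open>X\<close> splits through the mapping telescope \<open>T\<close> of
  \<open>X \<rightarrow> X \<rightarrow> \<dots>\<close> with all transition arrows equal to \<open>e\<close>. The defining arrow \<open>1 - s\<close> of the
  telescope is a split monomorphism here, so \<open>T\<close> is an honest colimit and arrows out of it are
  determined on the stages. A retraction \<open>\<sigma>\<close> of \<open>1 - s\<close> has to satisfy
  \<open>\<sigma>\<iota>\<^sub>k = \<iota>\<^sub>k + \<sigma>\<iota>\<^sub>k\<^sub>+\<^sub>1 e\<close>; solving separately on the images of \<open>1 - e\<close> and \<open>e\<close> gives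
  \<open>\<sigma>\<iota>\<^sub>k = \<iota>\<^sub>k (1 - e) - (\<Sum>i<k. \<iota>\<^sub>i e)\<close>.\<close>

lemma idempotent_splits:
  assumes P: "is_coproduct D (UNIV :: nat set) (\<lambda>_. X) P \<iota>"
    and e: "e \<in> Hom D X X" "e \<cdot> e = e"
  obtains T j r where "j \<in> Hom D X T" "r \<in> Hom D T X" "j \<cdot> r = ide D T" "r \<cdot> j = e"
proof -
  have O: "X \<in> Obj D" "P \<in> Obj D" using Hom_Obj[OF e(1)] coproduct_Obj[OF P] by auto
  have i: "\<iota> k \<in> Hom D X P" for k using coproduct_inj[OF P, of k] by simp
  have ie: "\<iota> k \<cdot> e \<in> Hom D X P" for k using comp_Hom e(1) i by blast
  have iee: "(\<iota> k \<cdot> e) \<cdot> e = \<iota> k \<cdot> e" for k using comp_assoc[OF e(1) e(1) i] e by simp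
  have "\<exists>s. s \<in> Hom D P P \<and> (\<forall>k. s \<cdot> \<iota> k = \<iota> (Suc k) \<cdot> e)"
    by (rule coproduct_desc[OF P O(2), where f = "\<lambda>k. \<iota> (Suc k) \<cdot> e"]) (use ie in auto)
  then obtain s where s: "s \<in> Hom D P P" "\<And>k. s \<cdot> \<iota> k = \<iota> (Suc k) \<cdot> e" by blast
  have iP: "ide D P \<in> Hom D P P" using O ide_Hom by blast
  let ?d = "sub (ide D P) s"
  have d: "?d \<in> Hom D P P" using sub_Hom iP s by blast
  have di: "?d \<cdot> \<iota> k = sub (\<iota> k) (\<iota> (Suc k) \<cdot> e)" for k
    using comp_sub_left[OF i iP s(1)] s comp_ide_left[OF i] by simp
  obtain T q w where t: "(?d, q, w) \<in> Tri D" and q: "q \<in> Hom D P T" and w: "w \<in> Hom D T (shO D 1 P)"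
    using cone[OF d] by blast
  have qi: "q \<cdot> \<iota> k \<in> Hom D X T" for k using comp_Hom i q by blast
  \<comment> \<open>In \<open>T\<close> all stages are identified, with \<open>e\<close> acting as the identity.\<close>
  have step: "q \<cdot> \<iota> k = (q \<cdot> \<iota> (Suc k)) \<cdot> e" for k
  proof -
    have "q \<cdot> (?d \<cdot> \<iota> k) = zeroA D X T"
      using comp_reassoc[OF Tri_comp_zero[OF t d q] d q i] comp_zero_left[OF i] Hom_Obj[OF q] by simp
    then have "sub (q \<cdot> \<iota> k) (q \<cdot> (\<iota> (Suc k) \<cdot> e)) = zeroA D X T"
      unfolding di using comp_sub_right[OF i ie q] by simp
    then show ?thesis using sub_eq_zero_iff[OF qi comp_Hom[OF ie q]] comp_assoc[OF e(1) i q] by simp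
  qed
  have qe: "(q \<cdot> \<iota> k) \<cdot> e = q \<cdot> \<iota> k" for k
    using step[of k] comp_assoc[OF e(1) e(1) qi, of "Suc k"] e(2) by simp
  have const: "q \<cdot> \<iota> k = q \<cdot> \<iota> 0" for k
  proof (induction k)
    case (Suc k)
    then show ?case using step[of k] qe[of "Suc k"] by simp
  qed simp
  define j where "j = q \<cdot> \<iota> 0"
  have j: "j \<in> Hom D X T" unfolding j_def by (rule qi)
  have je: "j \<cdot> e = j" unfolding j_def by (rule qe)
  have "\<exists>g. g \<in> Hom D P X \<and> (\<forall>k. g \<cdot> \<iota> k = e)"
    by (rule coproduct_desc[OF P O(1), where f = "\<lambda>k. e"]) (use e in auto)
  then obtain g where g: "g \<in> Hom D P X" "\<And>k. g \<cdot> \<iota> k = e" by blast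
  have "g \<cdot> ?d = zeroA D P X"
  proof (rule coproduct_eq_zero[OF P comp_Hom[OF d g(1)]])
    fix k :: nat
    have "(g \<cdot> ?d) \<cdot> \<iota> k = sub e (g \<cdot> (\<iota> (Suc k) \<cdot> e))"
      using comp_assoc[OF i d g(1)] di comp_sub_right[OF i ie g(1)] g by simp
    also have "\<dots> = zeroA D X X"
      using comp_reassoc[OF g(2) i g(1) e(1)] e(2) sub_eq_zero_iff[OF e(1) e(1)] by simp
    finally show "(g \<cdot> ?d) \<cdot> \<iota> k = zeroA D X X" .
  qed
  then obtain r where r: "r \<in> Hom D T X" "r \<cdot> q = g"
    using Tri_weak_cokernel[OF t d q g(1)] by blast
  have rj: "r \<cdot> j = e" unfolding j_def using comp_reassoc[OF r(2) q r(1) i] g(2) by simp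
  define c where "c = rec_nat (zeroA D X P) (\<lambda>k x. sub x (\<iota> k \<cdot> e))"
  have c0: "c 0 = zeroA D X P" and cS: "c (Suc k) = sub (c k) (\<iota> k \<cdot> e)" for k
    by (simp_all add: c_def)
  have c: "c k \<in> Hom D X P" for k
    by (induction k) (use c0 cS zeroA_Hom O sub_Hom ie in auto)
  have ce: "c k \<cdot> e = c k" for k
  proof (induction k)
    case 0 then show ?case using c0 comp_zero_left[OF e(1) O(2)] by simp
  next
    case (Suc k)
    then show ?case using cS comp_sub_left[OF e(1) c ie] iee by simp
  qed
  let ?h = "\<lambda>k. addA D (sub (\<iota> k) (\<iota> k \<cdot> e)) (c k)"
  have m: "sub (\<iota> k) (\<iota> k \<cdot> e) \<in> Hom D X P" for k using sub_Hom i ie by blast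
  have h: "?h k \<in> Hom D X P" for k using addA_Hom m c by blast
  have "\<exists>l. l \<in> Hom D P P \<and> (\<forall>k. l \<cdot> \<iota> k = ?h k)"
    by (rule coproduct_desc[OF P O(2), where f = ?h]) (use h in auto)
  then obtain l where l: "l \<in> Hom D P P" "\<And>k. l \<cdot> \<iota> k = ?h k" by blast
  have ld: "l \<cdot> ?d = ide D P"
  proof (rule coproduct_ext[OF P comp_Hom[OF d l(1)] iP])
    fix k :: nat
    have "sub (\<iota> (Suc k)) (\<iota> (Suc k) \<cdot> e) \<cdot> e = zeroA D X P"
      using comp_sub_left[OF e(1) i ie] iee sub_eq_zero_iff[OF ie ie] by simp
    then have "?h (Suc k) \<cdot> e = c (Suc k)"
      using comp_add_left[OF e(1) m c] ce add_zero_left[OF c] by simp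
    then have *: "l \<cdot> (\<iota> (Suc k) \<cdot> e) = c (Suc k)"
      using comp_reassoc[OF l(2) i l(1) e(1)] by simp
    have "?h k = addA D (\<iota> k) (c (Suc k))"
    proof -
      have "?h k = addA D (sub (\<iota> k) (\<iota> k \<cdot> e)) (addA D (\<iota> k \<cdot> e) (c (Suc k)))"
        using add_sub_cancel[OF c ie, of k k] add_commute[OF ie c, of k "Suc k"] cS[of k] by simp
      then show ?thesis
        unfolding add_assoc[OF m ie c, symmetric] add_sub_cancel[OF i ie] by simp
    qed
    then have "sub (?h k) (c (Suc k)) = \<iota> k"
      using sub_eq_iff[OF h c i, of k "Suc k" k] by blast
    then have "l \<cdot> (?d \<cdot> \<iota> k) = \<iota> k"
      unfolding di using comp_sub_right[OF i ie l(1)] * l(2) by simp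
    then show "(l \<cdot> ?d) \<cdot> \<iota> k = ide D P \<cdot> \<iota> k"
      using comp_assoc[OF i d l(1)] comp_ide_left[OF i] by simp
  qed
  \<comment> \<open>Hence \<open>P\<close> is the biproduct of \<open>P\<close> and \<open>T\<close>, so \<open>q\<close> is an epimorphism.\<close>
  obtain b where b: "biproduct P T P ?d b l q" using Tri_section_biproduct[OF t d q l(1) ld] by blast
  note bp = biproductD[OF b]
  have jrq: "(j \<cdot> r) \<cdot> q = q"
  proof (rule coproduct_ext[OF P comp_Hom[OF q comp_Hom[OF r(1) j]] q])
    fix k :: nat
    have "((j \<cdot> r) \<cdot> q) \<cdot> \<iota> k = j \<cdot> (g \<cdot> \<iota> k)"
      using i g r j q comp_assoc[OF q r(1) j] comp_assoc[OF i g(1) j] by simp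
    then show "((j \<cdot> r) \<cdot> q) \<cdot> \<iota> k = q \<cdot> \<iota> k" using g(2) je const[of k] j_def by simp
  qed
  have "j \<cdot> r = ((j \<cdot> r) \<cdot> q) \<cdot> b"
    using comp_assoc[OF bp(5) q comp_Hom[OF r(1) j]] bp(9) comp_ide_right[OF comp_Hom[OF r(1) j]] by simp
  then have "j \<cdot> r = ide D T" using jrq bp(9) by simp
  then show ?thesis using that j r(1) rj by blast
qed

end

section \<open>Smallness\<close>

lemma small_inj:
  assumes "inj_on f A" "f ` A \<subseteq> B" "small TYPE('u) B"
  shows "small TYPE('u) A"
proof -
  have "|A| \<le>o |B|" using assms(1,2) card_of_ordLeq[of A B] by blast
  then show ?thesis using assms(3) ordLeq_ordLess_trans unfolding small_def by blast
qed

lemma small_countable: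
  assumes "universe TYPE('u)"
  shows "small TYPE('u) (A :: 'b :: countable set)"
proof -
  have "|UNIV :: nat set| <o |UNIV :: 'u set|"
    using assms[unfolded universe_def] by (intro ordIso_ordLess_trans[OF card_of_nat]) (rule conjunct1)
  then have "small TYPE('u) (UNIV :: nat set)" unfolding small_def .
  then show ?thesis using small_inj[of "to_nat" A UNIV] by (auto intro: inj_on_subset[OF inj_to_nat])
qed

lemma small_Sigma:
  assumes u: "universe TYPE('u)" and "small TYPE('u) A" "\<And>a. a \<in> A \<Longrightarrow> small TYPE('u) (B a)"
  shows "small TYPE('u) (SIGMA a : A. B a)"
proof -
  have inf: "\<not> finite (UNIV :: 'u set)"
  proof
    assume "finite (UNIV :: 'u set)"
    then have "|UNIV :: 'u set| <o natLeq" by (simp add: finite_iff_ordLess_natLeq)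
    then have "natLeq <o natLeq"
      by (rule ordLess_transitive[OF conjunct1[OF u[unfolded universe_def]]])
    then show False by (simp add: ordLess_irreflexive)
  qed
  have "stable |UNIV :: 'u set|"
    by (rule regularCard_stable)
      (use inf conjunct2[OF u[unfolded universe_def]] in \<open>simp_all add: card_of_Card_order\<close>)
  then show ?thesis using stable_elim[of "|UNIV :: 'u set|" A B] assms(2,3) unfolding small_def by simp
qed

text \<open>Small sets of any type are copies of subsets of the universe, so coproducts indexed by them
  exist and the properties formulated with index sets in the universe extend to them.\<close>

lemma small_reindex:
  assumes "small TYPE('u) A"
  obtains g and J :: "'u set" where "bij_betw g A J" "small TYPE('u) J"
proof -
  have "|A| \<le>o |UNIV :: 'u set|" using assms ordLess_imp_ordLeq unfolding small_def by blast
  then obtain g :: "'a \<Rightarrow> 'u" where g: "inj_on g A" using card_of_ordLeq[of A "UNIV :: 'u set"] by blast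
  have "small TYPE('u) (g ` A)"
    using assms unfolding small_def by (rule ordLeq_ordLess_trans[OF card_of_image])
  then show ?thesis using that g by (auto simp: bij_betw_def)
qed

lemma (in category) ex_small_coproduct:
  assumes "has_small_coproducts TYPE('u) D" "small TYPE('u) A" "\<And>a. a \<in> A \<Longrightarrow> M a \<in> Obj D"
  obtains P \<iota> where "is_coproduct D A M P \<iota>"
proof -
  obtain g and J :: "'u set" where g: "bij_betw g A J" "small TYPE('u) J"
    using small_reindex assms(2) by blast
  have "M (inv_into A g j) \<in> Obj D" if "j \<in> J" for j
    using assms(3) g that by (auto simp: bij_betw_def inv_into_into)
  then obtain P \<iota> where P: "is_coproduct D J (\<lambda>j. M (inv_into A g j)) P \<iota>"
    using assms(1)[unfolded has_small_coproducts_def, rule_format, of J "\<lambda>j. M (inv_into A g j)"]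
      g(2) by blast
  have "is_coproduct D A M P (\<lambda>a. \<iota> (g a))"
    using coproduct_reindex[OF g(1) P] coproduct_cong[of A "\<lambda>a. M (inv_into A g (g a))" M]
      bij_betw_inv_into_left[OF g(1)] by auto
  then show ?thesis by (rule that)
qed

section \<open>Finitely supported arrows\<close>

context triangulated_category
begin

text \<open>Compactness expressed without sums: an arrow \<open>f\<close> into a coproduct only sees the finitely many
  summands in \<open>F\<close>, in that \<open>t f\<close> depends only on the restrictions of \<open>t\<close> to them. In this form the
  property passes to direct summands and shifts by mere composition.\<close>

definition finitely_supporting :: "'u itself \<Rightarrow> 'o \<Rightarrow> bool" where
  "finitely_supporting (U :: 'u itself) X \<longleftrightarrow> X \<in> Obj D \<and>
     (\<forall>(J :: 'u set) M P \<iota> f. small U J \<longrightarrow> (\<forall>j \<in> J. M j \<in> Obj D) \<longrightarrow> is_coproduct D J M P \<iota> \<longrightarrow>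
        f \<in> Hom D X P \<longrightarrow>
        (\<exists>F. finite F \<and> F \<subseteq> J \<and> (\<forall>T. \<forall>t \<in> Hom D P T. \<forall>t' \<in> Hom D P T.
            (\<forall>j \<in> F. t \<cdot> \<iota> j = t' \<cdot> \<iota> j) \<longrightarrow> t \<cdot> f = t' \<cdot> f)))"

lemma finitely_supporting_Obj: "finitely_supporting U X \<Longrightarrow> X \<in> Obj D"
  by (simp add: finitely_supporting_def)

lemma finitely_supportingE:
  fixes J :: "'b set"
  assumes X: "finitely_supporting TYPE('u) X" and J: "small TYPE('u) J"
    and M: "\<And>j. j \<in> J \<Longrightarrow> M j \<in> Obj D" and P: "is_coproduct D J M P \<iota>" and f: "f \<in> Hom D X P"
  obtains F where "finite F" "F \<subseteq> J"
    "\<And>T t t'. t \<in> Hom D P T \<Longrightarrow> t' \<in> Hom D P T \<Longrightarrow> (\<And>j. j \<in> F \<Longrightarrow> t \<cdot> \<iota> j = t' \<cdot> \<iota> j) \<Longrightarrow> t \<cdot> f = t' \<cdot> f"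
proof -
  obtain g and K :: "'u set" where g: "bij_betw g J K" "small TYPE('u) K"
    using small_reindex J by blast
  let ?h = "inv_into J g"
  have h: "bij_betw ?h K J" using g(1) by (rule bij_betw_inv_into)
  have hK: "?h k \<in> J" if "k \<in> K" for k using h that by (auto simp: bij_betw_def)
  have "is_coproduct D K (\<lambda>k. M (?h k)) P (\<lambda>k. \<iota> (?h k))"
    using coproduct_reindex[OF h P] .
  then obtain F where F: "finite F" "F \<subseteq> K"
    "\<forall>T. \<forall>t \<in> Hom D P T. \<forall>t' \<in> Hom D P T. (\<forall>k \<in> F. t \<cdot> \<iota> (?h k) = t' \<cdot> \<iota> (?h k)) \<longrightarrow> t \<cdot> f = t' \<cdot> f"
    using X[unfolded finitely_supporting_def, THEN conjunct2, rule_format,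
        of K "\<lambda>k. M (?h k)" P "\<lambda>k. \<iota> (?h k)" f] g(2) f M hK by blast
  show ?thesis
  proof (rule that)
    show "finite (?h ` F)" "?h ` F \<subseteq> J" using F hK by auto
    show "t \<cdot> f = t' \<cdot> f"
      if "t \<in> Hom D P T" "t' \<in> Hom D P T" "\<And>j. j \<in> ?h ` F \<Longrightarrow> t \<cdot> \<iota> j = t' \<cdot> \<iota> j" for T t t'
      using F(3) that by blast
  qed
qed

lemma compact_imp_finitely_supporting:
  assumes "compact_object TYPE('u) D X"
  shows "finitely_supporting TYPE('u) X"
  unfolding finitely_supporting_def
proof (intro conjI allI impI)
  show X: "X \<in> Obj D" using assms by (simp add: compact_object_def)
  fix J :: "'u set" and M P \<iota> f
  assume J: "small TYPE('u) J" and M: "\<forall>j\<in>J. M j \<in> Obj D" and P: "is_coproduct D J M P \<iota>"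
    and f: "f \<in> Hom D X P"
  let ?H = "hom_group D X P"
  interpret h: comm_group ?H using hom_comm_group X coproduct_Obj[OF P] by blast
  let ?c = "\<lambda>\<phi>. gfinprod ?H (\<lambda>j. \<iota> j \<cdot> \<phi> j) J"
  let ?S = "sum_group J (\<lambda>j. hom_group D X (M j))"
  have "?c \<in> iso ?S ?H" using assms J M P unfolding compact_object_def by blast
  then have "?c ` carrier ?S = carrier ?H" by (simp add: iso_def bij_betw_def)
  moreover have "f \<in> carrier ?H" using f by (simp add: hom_group_def)
  ultimately obtain \<phi> where \<phi>: "\<phi> \<in> carrier ?S" "f = ?c \<phi>" by blast
  have gr: "group (hom_group D X (M j))" if "j \<in> J" for j
    using hom_comm_group X M that by (simp add: comm_group_def)
  have \<phi>H: "\<phi> j \<in> Hom D X (M j)" if "j \<in> J" for j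
    using \<phi>(1) that carrier_sum_group[of J "\<lambda>j. hom_group D X (M j)", OF gr]
    by (auto simp: hom_group_def PiE_def Pi_def)
  have c: "\<iota> j \<cdot> \<phi> j \<in> Hom D X P" if "j \<in> J" for j
    using \<phi>H coproduct_inj[OF P] comp_Hom that by blast
  \<comment> \<open>The summands that contribute to the sum representing \<open>f\<close> form its support.\<close>
  let ?F = "{j \<in> J. \<iota> j \<cdot> \<phi> j \<noteq> \<one>\<^bsub>?H\<^esub>}"
  have agree: "finprod ?H (\<lambda>j. \<iota> j \<cdot> \<phi> j) E \<in> Hom D X P \<and> 
      t \<cdot> finprod ?H (\<lambda>j. \<iota> j \<cdot> \<phi> j) E = t' \<cdot> finprod ?H (\<lambda>j. \<iota> j \<cdot> \<phi> j) E"
    if "finite E" "E \<subseteq> J" and t: "t \<in> Hom D P T" "t' \<in> Hom D P T" "\<forall>j\<in>E. t \<cdot> \<iota> j = t' \<cdot> \<iota> j"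
    for E t t' T
    using that(1,2,5)
  proof (induction E rule: finite_induct)
    case empty
    have "finprod ?H (\<lambda>j. \<iota> j \<cdot> \<phi> j) {} = zeroA D X P"
      by (simp only: h.finprod_empty) (simp add: hom_group_def)
    then show ?case
      using comp_zero_right[OF t(1) X] comp_zero_right[OF t(2) X] zeroA_Hom[OF X coproduct_Obj[OF P]]
      by simp
  next
    case (insert j E)
    let ?s = "finprod ?H (\<lambda>j. \<iota> j \<cdot> \<phi> j) E"
    have s: "?s \<in> Hom D X P" "t \<cdot> ?s = t' \<cdot> ?s" using insert by auto
    have j: "j \<in> J" using insert by blast
    have "(\<lambda>j. \<iota> j \<cdot> \<phi> j) \<in> E \<rightarrow> carrier ?H" "\<iota> j \<cdot> \<phi> j \<in> carrier ?H"
      using c insert.prems by (auto simp: hom_group_def)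
    then have ins: "finprod ?H (\<lambda>j. \<iota> j \<cdot> \<phi> j) (insert j E) = addA D (\<iota> j \<cdot> \<phi> j) ?s"
      using h.finprod_insert[OF insert.hyps] by (simp add: hom_group_def)
    have "t \<cdot> (\<iota> j \<cdot> \<phi> j) = t' \<cdot> (\<iota> j \<cdot> \<phi> j)"
      using comp_assoc[OF \<phi>H[OF j] coproduct_inj[OF P j] t(1)]
        comp_assoc[OF \<phi>H[OF j] coproduct_inj[OF P j] t(2)] insert.prems by simp
    then show ?case
      unfolding ins using addA_Hom[OF c[OF j] s(1)] comp_add_right[OF c[OF j] s(1) t(1)]
        comp_add_right[OF c[OF j] s(1) t(2)] s(2) by simp
  qed
  show "\<exists>F. finite F \<and> F \<subseteq> J \<and> (\<forall>T. \<forall>t \<in> Hom D P T. \<forall>t' \<in> Hom D P T.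
            (\<forall>j \<in> F. t \<cdot> \<iota> j = t' \<cdot> \<iota> j) \<longrightarrow> t \<cdot> f = t' \<cdot> f)"
  proof (cases "finite ?F")
    case True
    then have "f = finprod ?H (\<lambda>j. \<iota> j \<cdot> \<phi> j) ?F" using \<phi>(2) by (simp add: gfinprod_def)
    have "t \<cdot> f = t' \<cdot> f"
      if "t \<in> Hom D P T" "t' \<in> Hom D P T" "\<forall>j\<in>?F. t \<cdot> \<iota> j = t' \<cdot> \<iota> j" for T t t'
      unfolding \<open>f = finprod ?H (\<lambda>j. \<iota> j \<cdot> \<phi> j) ?F\<close>
      using agree[OF True _ that] by blast
    then show ?thesis using True by (intro exI[of _ ?F]) blast
  next
    case False
    then have "f = \<one>\<^bsub>?H\<^esub>" using \<phi>(2) by (simp add: gfinprod_def)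
    then have f0: "f = zeroA D X P" by (simp add: hom_group_def)
    have "t \<cdot> f = zeroA D X T" if "t \<in> Hom D P T" for t T
      unfolding f0 using comp_zero_right[OF that X] .
    then show ?thesis by (intro exI[of _ "{}"]) simp
  qed
qed

lemma finitely_supporting_retract:
  assumes X: "finitely_supporting TYPE('u) X" and s: "s \<in> Hom D Y X" "r \<in> Hom D X Y" "r \<cdot> s = ide D Y"
  shows "finitely_supporting TYPE('u) Y"
  unfolding finitely_supporting_def
proof (intro conjI allI impI)
  show "Y \<in> Obj D" using Hom_Obj s by blast
  fix J :: "'u set" and M P \<iota> f
  assume J: "small TYPE('u) J" and M: "\<forall>j\<in>J. M j \<in> Obj D" and P: "is_coproduct D J M P \<iota>"
    and f: "f \<in> Hom D Y P"
  obtain F where F: "finite F" "F \<subseteq> J"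
    "\<And>T t t'. t \<in> Hom D P T \<Longrightarrow> t' \<in> Hom D P T \<Longrightarrow> (\<And>j. j \<in> F \<Longrightarrow> t \<cdot> \<iota> j = t' \<cdot> \<iota> j)
      \<Longrightarrow> t \<cdot> (f \<cdot> r) = t' \<cdot> (f \<cdot> r)"
    by (rule finitely_supportingE[OF X J _ P comp_Hom[OF s(2) f]]) (use M in blast)+
  have fr: "(t \<cdot> (f \<cdot> r)) \<cdot> s = t \<cdot> f" if "t \<in> Hom D P T" for t T
    using that f s by (simp add: arr)
  show "\<exists>F. finite F \<and> F \<subseteq> J \<and> (\<forall>T. \<forall>t \<in> Hom D P T. \<forall>t' \<in> Hom D P T.
            (\<forall>j \<in> F. t \<cdot> \<iota> j = t' \<cdot> \<iota> j) \<longrightarrow> t \<cdot> f = t' \<cdot> f)"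
  proof (intro exI[of _ F] conjI allI ballI impI F(1,2))
    fix T t t' assume t: "t \<in> Hom D P T" "t' \<in> Hom D P T" "\<forall>j \<in> F. t \<cdot> \<iota> j = t' \<cdot> \<iota> j"
    then have "(t \<cdot> (f \<cdot> r)) \<cdot> s = (t' \<cdot> (f \<cdot> r)) \<cdot> s"
      using F(3)[OF t(1,2)] by simp
    then show "t \<cdot> f = t' \<cdot> f" using fr[OF t(1)] fr[OF t(2)] by simp
  qed
qed

lemma coproduct_shift:
  assumes P: "is_coproduct D J M P \<iota>" and M: "\<And>j. j \<in> J \<Longrightarrow> M j \<in> Obj D"
  shows "is_coproduct D J (\<lambda>j. shO D n (M j)) (shO D n P) (\<lambda>j. shA D n (\<iota> j))"
  unfolding is_coproduct_def
proof (intro conjI ballI allI impI)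
  have PO: "P \<in> Obj D" using P by (rule coproduct_Obj)
  show "shO D n P \<in> Obj D" using PO sh_Obj by blast
  show "shA D n (\<iota> j) \<in> Hom D (shO D n (M j)) (shO D n P)" if "j \<in> J" for j
    using sh_Hom coproduct_inj[OF P that] by blast
  fix T f assume T: "T \<in> Obj D" and f: "\<forall>j\<in>J. f j \<in> Hom D (shO D n (M j)) T"
  have T': "shO D (-n) T \<in> Obj D" using T sh_Obj by blast
  have "shA D (-n) (f j) \<in> Hom D (M j) (shO D (-n) T)" if "j \<in> J" for j
    using sh_Hom[of "f j" "shO D n (M j)" T "-n"] f that shO_inv M by simp
  then obtain h where h: "h \<in> Hom D P (shO D (-n) T)" "\<And>j. j \<in> J \<Longrightarrow> h \<cdot> \<iota> j = shA D (-n) (f j)"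
    using coproduct_desc[OF P T', where f = "\<lambda>j. shA D (-n) (f j)"] by blast
  show "\<exists>!h. h \<in> Hom D (shO D n P) T \<and> (\<forall>j\<in>J. h \<cdot> shA D n (\<iota> j) = f j)"
  proof (rule ex1I[of _ "shA D n h"])
    have "shA D n h \<cdot> shA D n (\<iota> j) = f j" if "j \<in> J" for j
      using sh_comp[OF coproduct_inj[OF P that] h(1), of n] h(2)[OF that] shA_inv f that
      by (auto simp: Hom_iff)
    then show "shA D n h \<in> Hom D (shO D n P) T \<and> (\<forall>j\<in>J. shA D n h \<cdot> shA D n (\<iota> j) = f j)"
      using sh_Hom[OF h(1), of n] shO_inv T by simp
    fix k assume k: "k \<in> Hom D (shO D n P) T \<and> (\<forall>j\<in>J. k \<cdot> shA D n (\<iota> j) = f j)"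
    then have "k \<in> Hom D (shO D n P) (shO D n (shO D (-n) T))" using shO_inv T by simp
    then obtain k' where k': "k' \<in> Hom D P (shO D (-n) T)" "k = shA D n k'"
      using unshift_Hom[OF _ PO T'] by blast
    have "k' = h"
    proof (rule coproduct_ext[OF P k'(1) h(1)])
      fix j assume j: "j \<in> J"
      have "shA D n (k' \<cdot> \<iota> j) = f j"
        using sh_comp[OF coproduct_inj[OF P j] k'(1), of n] k k'(2) j by simp
      then have "shA D (-n) (f j) = k' \<cdot> \<iota> j"
        using shA_inv(2)[of "k' \<cdot> \<iota> j" n] comp_Hom[OF coproduct_inj[OF P j] k'(1)] by (auto simp: Hom_iff)
      then show "k' \<cdot> \<iota> j = h \<cdot> \<iota> j" using h(2)[OF j] by simp
    qed
    then show "k = shA D n h" using k' by simp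
  qed
qed

lemma finitely_supporting_shift:
  assumes X: "finitely_supporting TYPE('u) X"
  shows "finitely_supporting TYPE('u) (shO D n X)"
  unfolding finitely_supporting_def
proof (intro conjI allI impI)
  have XO: "X \<in> Obj D" using X by (rule finitely_supporting_Obj)
  then show "shO D n X \<in> Obj D" using sh_Obj by blast
  fix J :: "'u set" and M P \<iota> f
  assume J: "small TYPE('u) J" and M: "\<forall>j\<in>J. M j \<in> Obj D" and P: "is_coproduct D J M P \<iota>"
    and f: "f \<in> Hom D (shO D n X) P"
  have f': "shA D (-n) f \<in> Hom D X (shO D (-n) P)" using sh_Hom[OF f, of "-n"] shO_inv XO by simp
  have P': "is_coproduct D J (\<lambda>j. shO D (-n) (M j)) (shO D (-n) P) (\<lambda>j. shA D (-n) (\<iota> j))"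
    using coproduct_shift[OF P] M by blast
  obtain F where F: "finite F" "F \<subseteq> J"
    "\<And>T t t'. t \<in> Hom D (shO D (-n) P) T \<Longrightarrow> t' \<in> Hom D (shO D (-n) P) T
      \<Longrightarrow> (\<And>j. j \<in> F \<Longrightarrow> t \<cdot> shA D (-n) (\<iota> j) = t' \<cdot> shA D (-n) (\<iota> j))
      \<Longrightarrow> t \<cdot> shA D (-n) f = t' \<cdot> shA D (-n) f"
    by (rule finitely_supportingE[OF X J _ P' f']) (use M sh_Obj in blast)+
  show "\<exists>F. finite F \<and> F \<subseteq> J \<and> (\<forall>T. \<forall>t \<in> Hom D P T. \<forall>t' \<in> Hom D P T.
            (\<forall>j \<in> F. t \<cdot> \<iota> j = t' \<cdot> \<iota> j) \<longrightarrow> t \<cdot> f = t' \<cdot> f)"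
  proof (intro exI[of _ F] conjI allI ballI impI F(1,2))
    fix T t t' assume t: "t \<in> Hom D P T" "t' \<in> Hom D P T" "\<forall>j \<in> F. t \<cdot> \<iota> j = t' \<cdot> \<iota> j"
    have "shA D (-n) t \<cdot> shA D (-n) (\<iota> j) = shA D (-n) t' \<cdot> shA D (-n) (\<iota> j)" if "j \<in> F" for j
      using sh_comp[OF coproduct_inj[OF P] t(1), of j "-n"] sh_comp[OF coproduct_inj[OF P] t(2), of j "-n"]
        t(3) F(2) that by auto
    then have "shA D (-n) t \<cdot> shA D (-n) f = shA D (-n) t' \<cdot> shA D (-n) f"
      using F(3)[OF sh_Hom[OF t(1), of "-n"] sh_Hom[OF t(2), of "-n"]] by blast
    then have "shA D (-n) (t \<cdot> f) = shA D (-n) (t' \<cdot> f)"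
      using sh_comp[OF f t(1)] sh_comp[OF f t(2)] by simp
    then show "t \<cdot> f = t' \<cdot> f"
      using shA_inject comp_Hom[OF f t(1)] comp_Hom[OF f t(2)] by (simp add: Hom_iff)
  qed
qed

text \<open>The support of a finitely supported arrow can be removed one summand at a time when all its
  components vanish.\<close>

lemma finitely_supported_eq_zero:
  assumes X: "finitely_supporting TYPE('u) X" and J: "small TYPE('u) J"
    and M: "\<And>j. j \<in> J \<Longrightarrow> M j \<in> Obj D" and P: "is_coproduct D J M P \<iota>" and f: "f \<in> Hom D X P"
    and p0: "\<And>j p. \<lbrakk>j \<in> J; p \<in> Hom D P (M j); p \<cdot> \<iota> j = ide D (M j);
      \<And>i. i \<in> J \<Longrightarrow> i \<noteq> j \<Longrightarrow> p \<cdot> \<iota> i = zeroA D (M i) (M j)\<rbrakk> \<Longrightarrow> p \<cdot> f = zeroA D X (M j)"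
  shows "f = zeroA D X P"
proof -
  obtain F where F: "finite F" "F \<subseteq> J"
    "\<And>T t t'. t \<in> Hom D P T \<Longrightarrow> t' \<in> Hom D P T \<Longrightarrow> (\<And>j. j \<in> F \<Longrightarrow> t \<cdot> \<iota> j = t' \<cdot> \<iota> j) \<Longrightarrow> t \<cdot> f = t' \<cdot> f"
    by (rule finitely_supportingE[OF X J M P f]) blast+
  have PO: "P \<in> Obj D" and XO: "X \<in> Obj D" using Hom_Obj f by blast+
  have iP: "ide D P \<in> Hom D P P" using PO ide_Hom by blast
  have "\<exists>t \<in> Hom D P P. t \<cdot> f = f \<and> (\<forall>j\<in>F. t \<cdot> \<iota> j = zeroA D (M j) P)"
    using F(1,2)
  proof (induction F rule: finite_induct)
    case empty
    then show ?case using iP comp_ide_left[OF f] by blast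
  next
    case (insert k F)
    then obtain t where t: "t \<in> Hom D P P" "t \<cdot> f = f" "\<forall>j\<in>F. t \<cdot> \<iota> j = zeroA D (M j) P" by auto
    have k: "k \<in> J" using insert by blast
    obtain p where p: "p \<in> Hom D P (M k)" "p \<cdot> \<iota> k = ide D (M k)"
      "\<And>i. i \<in> J \<Longrightarrow> i \<noteq> k \<Longrightarrow> p \<cdot> \<iota> i = zeroA D (M i) (M k)"
      using coproduct_proj[OF P k M] by blast
    have \<iota>k: "\<iota> k \<in> Hom D (M k) P" using coproduct_inj[OF P k] .
    let ?u = "sub (ide D P) (\<iota> k \<cdot> p)"
    have ip: "\<iota> k \<cdot> p \<in> Hom D P P" using comp_Hom[OF p(1) \<iota>k] .
    have u: "?u \<in> Hom D P P" using sub_Hom iP ip by blast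
    have u_comp: "?u \<cdot> x = sub x (\<iota> k \<cdot> (p \<cdot> x))" if "x \<in> Hom D Y P" for x Y
      using comp_sub_left[OF that iP ip] comp_ide_left[OF that] comp_assoc[OF that p(1) \<iota>k] by simp
    have "?u \<cdot> f = sub f (zeroA D X P)"
      using u_comp[OF f] p0[OF k p] comp_zero_right[OF \<iota>k XO] by simp
    then have uf: "?u \<cdot> f = f"
      using sub_eq_iff[OF f zeroA_Hom f] add_zero_right[OF f] XO PO by simp
    have "?u \<cdot> \<iota> k = zeroA D (M k) P"
      using u_comp[OF \<iota>k] p(2) comp_ide_right[OF \<iota>k] sub_eq_zero_iff[OF \<iota>k \<iota>k] by simp
    moreover have "?u \<cdot> \<iota> i = \<iota> i" if i: "i \<in> F" "i \<noteq> k" for i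
    proof -
      have iJ: "i \<in> J" using insert.prems i by blast
      have \<iota>i: "\<iota> i \<in> Hom D (M i) P" using coproduct_inj[OF P iJ] .
      have "?u \<cdot> \<iota> i = sub (\<iota> i) (zeroA D (M i) P)"
        using u_comp[OF \<iota>i] p(3)[OF iJ i(2)] comp_zero_right[OF \<iota>k M[OF iJ]] by simp
      then show ?thesis
        using sub_eq_iff[OF \<iota>i zeroA_Hom \<iota>i] add_zero_right[OF \<iota>i] M[OF iJ] PO by simp
    qed
    ultimately have "(t \<cdot> ?u) \<cdot> \<iota> i = zeroA D (M i) P" if "i \<in> insert k F" for i
    proof -
      have iJ: "i \<in> J" using insert.prems that by blast
      have \<iota>i: "\<iota> i \<in> Hom D (M i) P" using coproduct_inj[OF P iJ] .
      have "(t \<cdot> ?u) \<cdot> \<iota> i = t \<cdot> (?u \<cdot> \<iota> i)" using comp_assoc[OF \<iota>i u t(1)] .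
      then show ?thesis
        using \<open>?u \<cdot> \<iota> k = zeroA D (M k) P\<close> \<open>\<And>i. i \<in> F \<Longrightarrow> i \<noteq> k \<Longrightarrow> ?u \<cdot> \<iota> i = \<iota> i\<close> t(3) that
          comp_zero_right[OF t(1) M[OF iJ]] by (cases "i = k") auto
    qed
    moreover have "(t \<cdot> ?u) \<cdot> f = f" using comp_assoc[OF f u t(1)] uf t(2) by simp
    ultimately show ?case using comp_Hom[OF u t(1)] by blast
  qed
  then obtain t where t: "t \<in> Hom D P P" "t \<cdot> f = f" "\<And>j. j \<in> F \<Longrightarrow> t \<cdot> \<iota> j = zeroA D (M j) P" by blast
  have z: "zeroA D P P \<in> Hom D P P" using zeroA_Hom PO by blast
  have "t \<cdot> f = zeroA D P P \<cdot> f"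
  proof (rule F(3)[OF t(1) z])
    fix j assume j: "j \<in> F"
    then show "t \<cdot> \<iota> j = zeroA D P P \<cdot> \<iota> j"
      using t(3) comp_zero_left[OF coproduct_inj[OF P, of j] PO] F(2) by auto
  qed
  then show ?thesis using t(2) comp_zero_left[OF f PO] by simp
qed

section \<open>Mapping telescopes\<close>

text \<open>The telescope \<open>T\<close> of \<open>N\<^sub>0 \<rightarrow> N\<^sub>1 \<rightarrow> \<dots>\<close> is the cone of \<open>1 - \<sigma>\<close> on the coproduct of the stages, where
  \<open>\<sigma>\<close> shifts each stage into the next. It is a weak colimit, and an honest one as seen by finitely
  supporting objects: for them \<open>1 - \<sigma>\<close> is injective on arrows, also after a shift, so an arrow to \<open>T\<close>
  lifts to the coproduct, where finite support moves it to a single stage.\<close>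

lemma mapping_telescope:
  assumes u: "universe TYPE('u)" and P: "is_coproduct D (UNIV :: nat set) N P \<iota>"
    and s: "\<And>k. s k \<in> Hom D (N k) (N (Suc k))"
  obtains T q d w where "(d, q, w) \<in> Tri D" "d \<in> Hom D P P" "q \<in> Hom D P T"
    "\<And>k. q \<cdot> \<iota> k = (q \<cdot> \<iota> (Suc k)) \<cdot> s k"
    "\<And>M g. (\<And>k. g k \<in> Hom D (N k) M) \<Longrightarrow> (\<And>k. g (Suc k) \<cdot> s k = g k)
      \<Longrightarrow> \<exists>h \<in> Hom D T M. \<forall>k. h \<cdot> (q \<cdot> \<iota> k) = g k"
    "\<And>X x. finitely_supporting TYPE('u) X \<Longrightarrow> x \<in> Hom D X T
      \<Longrightarrow> \<exists>k. \<exists>y \<in> Hom D X (N k). x = (q \<cdot> \<iota> k) \<cdot> y"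
proof -
  have NO: "N k \<in> Obj D" for k using Hom_Obj s by blast
  have PO: "P \<in> Obj D" using coproduct_Obj[OF P] .
  have i: "\<iota> k \<in> Hom D (N k) P" for k using coproduct_inj[OF P, of k] by simp
  have si: "\<iota> (Suc k) \<cdot> s k \<in> Hom D (N k) P" for k using comp_Hom i s by blast
  have iP: "ide D P \<in> Hom D P P" using PO ide_Hom by blast
  have "\<exists>\<sigma>. \<sigma> \<in> Hom D P P \<and> (\<forall>k. \<sigma> \<cdot> \<iota> k = \<iota> (Suc k) \<cdot> s k)"
    by (rule coproduct_desc[OF P PO, where f = "\<lambda>k. \<iota> (Suc k) \<cdot> s k"]) (use si in auto)
  then obtain \<sigma> where \<sigma>: "\<sigma> \<in> Hom D P P" "\<And>k. \<sigma> \<cdot> \<iota> k = \<iota> (Suc k) \<cdot> s k" by blast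
  let ?d = "sub (ide D P) \<sigma>"
  have d: "?d \<in> Hom D P P" using sub_Hom iP \<sigma> by blast
  have d_comp: "?d \<cdot> x = sub x (\<sigma> \<cdot> x)" if "x \<in> Hom D X P" for x X
    using comp_sub_left[OF that iP \<sigma>(1)] comp_ide_left[OF that] by simp
  obtain T q w where t: "(?d, q, w) \<in> Tri D" and q: "q \<in> Hom D P T" and w: "w \<in> Hom D T (shO D 1 P)"
    using cone[OF d] by blast
  have TO: "T \<in> Obj D" using Hom_Obj q by blast
  have qi: "q \<cdot> \<iota> k \<in> Hom D (N k) T" for k using comp_Hom i q by blast
  have step: "q \<cdot> \<iota> k = (q \<cdot> \<iota> (Suc k)) \<cdot> s k" for k
  proof -
    have "q \<cdot> (?d \<cdot> \<iota> k) = zeroA D (N k) T"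
      using comp_reassoc[OF Tri_comp_zero[OF t d q] d q i] comp_zero_left[OF i TO] by simp
    then have "sub (q \<cdot> \<iota> k) (q \<cdot> (\<iota> (Suc k) \<cdot> s k)) = zeroA D (N k) T"
      using d_comp[OF i] \<sigma>(2) comp_sub_right[OF i si q] by simp
    then show ?thesis using sub_eq_zero_iff[OF qi comp_Hom[OF si q]] comp_assoc[OF s i q] by simp
  qed
  have desc: "\<exists>h \<in> Hom D T M. \<forall>k. h \<cdot> (q \<cdot> \<iota> k) = g k"
    if g: "\<And>k. g k \<in> Hom D (N k) M" "\<And>k. g (Suc k) \<cdot> s k = g k" for M g
  proof -
    have MO: "M \<in> Obj D" using Hom_Obj g by blast
    have "\<exists>g'. g' \<in> Hom D P M \<and> (\<forall>k. g' \<cdot> \<iota> k = g k)"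
      by (rule coproduct_desc[OF P MO, where f = g]) (use g in auto)
    then obtain g' where g': "g' \<in> Hom D P M" "\<And>k. g' \<cdot> \<iota> k = g k" by blast
    have "g' \<cdot> ?d = zeroA D P M"
    proof (rule coproduct_eq_zero[OF P comp_Hom[OF d g'(1)]])
      fix k :: nat
      have "(g' \<cdot> ?d) \<cdot> \<iota> k = sub (g k) (g' \<cdot> (\<iota> (Suc k) \<cdot> s k))"
        using comp_assoc[OF i d g'(1)] d_comp[OF i] \<sigma>(2) comp_sub_right[OF i si g'(1)] g'(2) by simp
      also have "\<dots> = zeroA D (N k) M"
        using comp_reassoc[OF g'(2) i g'(1) s] g(2) sub_eq_zero_iff[OF g(1) g(1)] by simp
      finally show "(g' \<cdot> ?d) \<cdot> \<iota> k = zeroA D (N k) M" .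
    qed
    then obtain h where h: "h \<in> Hom D T M" "h \<cdot> q = g'"
      using Tri_weak_cokernel[OF t d q g'(1)] by blast
    have "h \<cdot> (q \<cdot> \<iota> k) = g k" for k using comp_reassoc[OF h(2) q h(1) i] g'(2) by simp
    then show ?thesis using h by blast
  qed
  \<comment> \<open>Arrows from \<open>X\<close> are not killed by \<open>1 - \<sigma>\<close>: a fixed point of \<open>\<sigma>\<close> has zero component at the
    first stage, hence at every stage.\<close>
  have fixpt: "y = zeroA D X P"
    if X: "finitely_supporting TYPE('u) X" and y: "y \<in> Hom D X P" and dy: "?d \<cdot> y = zeroA D X P" for X y
  proof -
    have XO: "X \<in> Obj D" using Hom_Obj y by blast
    have y\<sigma>: "\<sigma> \<cdot> y = y"
      using dy d_comp[OF y] sub_eq_zero_iff[OF y comp_Hom[OF y \<sigma>(1)]] by simp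
    have p0: "p \<cdot> y = zeroA D X (N k)"
      if "p \<in> Hom D P (N k)" "p \<cdot> \<iota> k = ide D (N k)" "\<And>i. i \<noteq> k \<Longrightarrow> p \<cdot> \<iota> i = zeroA D (N i) (N k)"
      for p k
      using that
    proof (induction k arbitrary: p)
      case 0
      have "p \<cdot> \<sigma> = zeroA D P (N 0)"
      proof (rule coproduct_eq_zero[OF P comp_Hom[OF \<sigma>(1) "0.prems"(1)]])
        fix k :: nat
        have "(p \<cdot> \<sigma>) \<cdot> \<iota> k = (p \<cdot> \<iota> (Suc k)) \<cdot> s k"
          using comp_assoc[OF i \<sigma>(1) "0.prems"(1)] \<sigma>(2) comp_assoc[OF s i "0.prems"(1)] by simp
        then show "(p \<cdot> \<sigma>) \<cdot> \<iota> k = zeroA D (N k) (N 0)"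
          using "0.prems"(3)[of "Suc k"] comp_zero_left[OF s NO] by simp
      qed
      then show ?case
        using comp_assoc[OF y \<sigma>(1) "0.prems"(1)] y\<sigma> comp_zero_left[OF y NO] by simp
    next
      case (Suc k)
      obtain p' where p': "p' \<in> Hom D P (N k)" "p' \<cdot> \<iota> k = ide D (N k)"
        "\<And>i. i \<noteq> k \<Longrightarrow> p' \<cdot> \<iota> i = zeroA D (N i) (N k)"
        by (rule coproduct_proj[OF P, of k]) (use NO in auto)
      have "p \<cdot> \<sigma> = s k \<cdot> p'"
      proof (rule coproduct_ext[OF P comp_Hom[OF \<sigma>(1) Suc.prems(1)] comp_Hom[OF p'(1) s]])
        fix l :: nat
        have "(p \<cdot> \<sigma>) \<cdot> \<iota> l = (p \<cdot> \<iota> (Suc l)) \<cdot> s l"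
          using comp_assoc[OF i \<sigma>(1) Suc.prems(1)] \<sigma>(2) comp_assoc[OF s i Suc.prems(1)] by simp
        moreover have "(s k \<cdot> p') \<cdot> \<iota> l = s k \<cdot> (p' \<cdot> \<iota> l)" using comp_assoc[OF i p'(1) s] .
        ultimately show "(p \<cdot> \<sigma>) \<cdot> \<iota> l = (s k \<cdot> p') \<cdot> \<iota> l"
          using Suc.prems(2) Suc.prems(3)[of "Suc l"] p'(2) p'(3)[of l] comp_ide_left[OF s] comp_ide_right[OF s]
            comp_zero_left[OF s NO] comp_zero_right[OF s NO]
          by (cases "l = k") simp_all
      qed
      moreover have "p \<cdot> y = (p \<cdot> \<sigma>) \<cdot> y" using comp_assoc[OF y \<sigma>(1) Suc.prems(1)] y\<sigma> by simp
      ultimately show ?case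
        using comp_assoc[OF y p'(1) s] Suc.IH[OF p'] comp_zero_right[OF s XO] by simp
    qed
    show ?thesis
    proof (rule finitely_supported_eq_zero[OF X small_countable[OF u] NO P y])
      fix j p assume "p \<in> Hom D P (N j)" "p \<cdot> \<iota> j = ide D (N j)"
        "\<And>i. i \<in> UNIV \<Longrightarrow> i \<noteq> j \<Longrightarrow> p \<cdot> \<iota> i = zeroA D (N i) (N j)"
      then show "p \<cdot> y = zeroA D X (N j)" using p0 by blast
    qed
  qed
  \<comment> \<open>Everything up to stage \<open>K\<close> can be pushed into stage \<open>K\<close> without changing its image in \<open>T\<close>.\<close>
  have push: "\<exists>\<rho> \<in> Hom D P (N K). (\<forall>k\<le>K. ((q \<cdot> \<iota> K) \<cdot> \<rho>) \<cdot> \<iota> k = q \<cdot> \<iota> k) \<and> (\<forall>k>K. \<rho> \<cdot> \<iota> k = zeroA D (N k) (N K))"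
    for K
  proof (induction K)
    case 0
    obtain p where p: "p \<in> Hom D P (N 0)" "p \<cdot> \<iota> 0 = ide D (N 0)"
      "\<And>i. i \<noteq> 0 \<Longrightarrow> p \<cdot> \<iota> i = zeroA D (N i) (N 0)"
      by (rule coproduct_proj[OF P, of 0]) (use NO in auto)
    have "((q \<cdot> \<iota> 0) \<cdot> p) \<cdot> \<iota> 0 = q \<cdot> \<iota> 0"
      using comp_assoc[OF i p(1) qi] p(2) comp_ide_right[OF qi] by simp
    then show ?case using p by (intro bexI[of _ p]) auto
  next
    case (Suc K)
    then obtain \<rho> where \<rho>: "\<rho> \<in> Hom D P (N K)" "\<And>k. k \<le> K \<Longrightarrow> ((q \<cdot> \<iota> K) \<cdot> \<rho>) \<cdot> \<iota> k = q \<cdot> \<iota> k"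
      "\<And>k. k > K \<Longrightarrow> \<rho> \<cdot> \<iota> k = zeroA D (N k) (N K)" by blast
    obtain p where p: "p \<in> Hom D P (N (Suc K))" "p \<cdot> \<iota> (Suc K) = ide D (N (Suc K))"
      "\<And>i. i \<noteq> Suc K \<Longrightarrow> p \<cdot> \<iota> i = zeroA D (N i) (N (Suc K))"
      by (rule coproduct_proj[OF P, of "Suc K"]) (use NO in auto)
    let ?\<rho> = "addA D (s K \<cdot> \<rho>) p"
    have s\<rho>: "s K \<cdot> \<rho> \<in> Hom D P (N (Suc K))" using comp_Hom[OF \<rho>(1) s] .
    have \<rho>': "?\<rho> \<in> Hom D P (N (Suc K))" using addA_Hom[OF s\<rho> p(1)] .
    have \<rho>i: "?\<rho> \<cdot> \<iota> k = addA D (s K \<cdot> (\<rho> \<cdot> \<iota> k)) (p \<cdot> \<iota> k)" for k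
      using comp_add_left[OF i s\<rho> p(1)] comp_assoc[OF i \<rho>(1) s] by simp
    have ri: "\<rho> \<cdot> \<iota> k \<in> Hom D (N k) (N K)" for k using comp_Hom[OF i \<rho>(1)] .
    have "((q \<cdot> \<iota> (Suc K)) \<cdot> ?\<rho>) \<cdot> \<iota> k = q \<cdot> \<iota> k" if k: "k \<le> Suc K" for k
    proof (cases "k = Suc K")
      case True
      have "?\<rho> \<cdot> \<iota> (Suc K) = ide D (N (Suc K))"
        using \<rho>i[of "Suc K"] \<rho>(3)[of "Suc K"] p(2) comp_zero_right[OF s NO, of K "Suc K"]
          add_zero_left[OF ide_Hom[OF NO], of "Suc K"] by simp
      then show ?thesis
        using comp_assoc[OF i \<rho>' qi, of "Suc K"] comp_ide_right[OF qi] True by simp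
    next
      case False
      then have kK: "k \<le> K" using k by simp
      have "?\<rho> \<cdot> \<iota> k = s K \<cdot> (\<rho> \<cdot> \<iota> k)"
        using \<rho>i[of k] p(3)[OF False] add_zero_right[OF comp_Hom[OF ri s]] by simp
      then have "((q \<cdot> \<iota> (Suc K)) \<cdot> ?\<rho>) \<cdot> \<iota> k = (q \<cdot> \<iota> K) \<cdot> (\<rho> \<cdot> \<iota> k)"
        using comp_assoc[OF i \<rho>' qi] comp_assoc[OF ri s qi] step[of K] by simp
      then show ?thesis using comp_assoc[OF i \<rho>(1) qi] \<rho>(2)[OF kK] by simp
    qed
    moreover have "?\<rho> \<cdot> \<iota> k = zeroA D (N k) (N (Suc K))" if "k > Suc K" for k
      using \<rho>i[of k] \<rho>(3)[of k] p(3)[of k] comp_zero_right[OF s NO] that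
        add_zero_left[OF zeroA_Hom[OF NO NO]] by simp
    ultimately show ?case using \<rho>' by blast
  qed
  have factor: "\<exists>k. \<exists>y \<in> Hom D X (N k). x = (q \<cdot> \<iota> k) \<cdot> y"
    if X: "finitely_supporting TYPE('u) X" and x: "x \<in> Hom D X T" for X x
  proof -
    have XO: "X \<in> Obj D" using Hom_Obj x by blast
    have X': "finitely_supporting TYPE('u) (shO D (-1) X)" using finitely_supporting_shift[OF X] .
    have X'O: "shO D (-1) X \<in> Obj D" using sh_Obj XO by blast
    have X1: "shO D 1 (shO D (-1) X) = X" using shO_inv XO by blast
    have wx: "w \<cdot> x \<in> Hom D X (shO D 1 P)" using comp_Hom[OF x w] .
    then obtain y where y: "y \<in> Hom D (shO D (-1) X) P" "w \<cdot> x = shA D 1 y"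
      using unshift_Hom[of "w \<cdot> x" 1 "shO D (-1) X" P] X1 X'O PO by metis
    have d1: "shA D 1 ?d \<in> Hom D (shO D 1 P) (shO D 1 P)" using sh_Hom[OF d] .
    have "shA D 1 (?d \<cdot> y) = zeroA D X (shO D 1 P)"
      using sh_comp[OF y(1) d, of 1] y(2) comp_reassoc[OF Tri_comp_zero_rot(2)[OF t d q] w d1 x]
        comp_zero_left[OF x] Hom_Obj(2)[OF d1] by simp
    then have "shA D 1 (?d \<cdot> y) = shA D 1 (zeroA D (shO D (-1) X) P)"
      using shA_zeroA[OF X'O PO, of 1] X1 by simp
    then have "?d \<cdot> y = zeroA D (shO D (-1) X) P"
      using shA_inject comp_Hom[OF y(1) d] zeroA_Hom[OF X'O PO] by (simp add: Hom_iff)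
    then have "y = zeroA D (shO D (-1) X) P" using fixpt[OF X' y(1)] by simp
    then have "w \<cdot> x = zeroA D X (shO D 1 P)" using y(2) shA_zeroA[OF X'O PO, of 1] X1 by simp
    then obtain z where z: "z \<in> Hom D X P" "q \<cdot> z = x"
      using Tri_weak_kernel[OF Tri_rot[OF t] q w x] by blast
    obtain F where F: "finite F" "F \<subseteq> (UNIV :: nat set)"
      "\<And>T t t'. t \<in> Hom D P T \<Longrightarrow> t' \<in> Hom D P T \<Longrightarrow> (\<And>j. j \<in> F \<Longrightarrow> t \<cdot> \<iota> j = t' \<cdot> \<iota> j) \<Longrightarrow> t \<cdot> z = t' \<cdot> z"
      by (rule finitely_supportingE[OF X small_countable[OF u] NO P z(1)]) blast+
    obtain K where K: "\<And>k. k \<in> F \<Longrightarrow> k \<le> K" using F(1) finite_nat_set_iff_bounded_le[of F] by blast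
    obtain \<rho> where \<rho>: "\<rho> \<in> Hom D P (N K)" "\<And>k. k \<le> K \<Longrightarrow> ((q \<cdot> \<iota> K) \<cdot> \<rho>) \<cdot> \<iota> k = q \<cdot> \<iota> k"
      using push[of K] by blast
    have "q \<cdot> z = ((q \<cdot> \<iota> K) \<cdot> \<rho>) \<cdot> z"
    proof (rule F(3)[OF q comp_Hom[OF \<rho>(1) qi]])
      fix k assume "k \<in> F"
      then show "q \<cdot> \<iota> k = ((q \<cdot> \<iota> K) \<cdot> \<rho>) \<cdot> \<iota> k" using \<rho>(2)[of k] K[of k] by simp
    qed
    then have "x = (q \<cdot> \<iota> K) \<cdot> (\<rho> \<cdot> z)" using z comp_assoc[OF z(1) \<rho>(1) qi] by simp
    then show ?thesis using comp_Hom[OF z(1) \<rho>(1)] by blast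
  qed
  show ?thesis using that[OF t d q step desc factor] .
qed

section \<open>Localizing subcategories and cellular approximation\<close>

text \<open>Closure under coproducts indexed by subsets of the universe gives closure under all small
  coproducts by reindexing; those over one-point sets give closure under isomorphism.\<close>

definition localizing :: "'u itself \<Rightarrow> 'o set \<Rightarrow> bool" where
  "localizing (U :: 'u itself) L \<longleftrightarrow> L \<subseteq> Obj D \<and> (\<forall>X \<in> L. \<forall>n. shO D n X \<in> L) \<and>
     (\<forall>(J :: 'u set) M P \<iota>. small U J \<longrightarrow> (\<forall>j \<in> J. M j \<in> L) \<longrightarrow> is_coproduct D J M P \<iota> \<longrightarrow> P \<in> L) \<and>
     (\<forall>u v w. (u, v, w) \<in> Tri D \<longrightarrow> src D u \<in> L \<longrightarrow> tgt D u \<in> L \<longrightarrow> tgt D v \<in> L)"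

definition perp :: "'k set \<Rightarrow> ('k \<Rightarrow> 'o) \<Rightarrow> 'o set" where
  "perp K H = {M \<in> Obj D. \<forall>k \<in> K. \<forall>n. hom_vanishes D (shO D n (H k)) M}"

lemma localizing_Obj: "localizing U L \<Longrightarrow> X \<in> L \<Longrightarrow> X \<in> Obj D"
  and localizing_shift: "localizing U L \<Longrightarrow> X \<in> L \<Longrightarrow> shO D n X \<in> L"
  by (auto simp: localizing_def)

lemma localizing_cone:
  assumes "localizing U L" "(u, v, w) \<in> Tri D" "u \<in> Hom D X Y" "v \<in> Hom D Y Z" "X \<in> L" "Y \<in> L"
  shows "Z \<in> L"
proof -
  have "\<forall>u v w. (u, v, w) \<in> Tri D \<longrightarrow> src D u \<in> L \<longrightarrow> tgt D u \<in> L \<longrightarrow> tgt D v \<in> L"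
    using assms(1) by (simp add: localizing_def)
  then show ?thesis using assms(2-) unfolding Hom_iff by blast
qed

lemma localizing_coproduct:
  fixes J :: "'b set"
  assumes L: "localizing TYPE('u) L" and J: "small TYPE('u) J" and M: "\<And>j. j \<in> J \<Longrightarrow> M j \<in> L"
    and P: "is_coproduct D J M P \<iota>"
  shows "P \<in> L"
proof -
  obtain g and K :: "'u set" where g: "bij_betw g J K" "small TYPE('u) K"
    using small_reindex J by blast
  let ?h = "inv_into J g"
  have h: "bij_betw ?h K J" using g(1) by (rule bij_betw_inv_into)
  then have hK: "?h k \<in> J" if "k \<in> K" for k using that by (auto simp: bij_betw_def)
  have cl: "\<forall>(J :: 'u set) M P \<iota>. small TYPE('u) J \<longrightarrow> (\<forall>j \<in> J. M j \<in> L) \<longrightarrow> is_coproduct D J M P \<iota> \<longrightarrow> P \<in> L"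
    using L by (simp add: localizing_def)
  show ?thesis
    by (rule cl[rule_format, OF g(2) _ coproduct_reindex[OF h P]]) (use M hK in blast)
qed

lemma localizing_Int:
  assumes "localizing TYPE('u) L" "localizing TYPE('u) L'"
  shows "localizing TYPE('u) (L \<inter> L')"
  unfolding localizing_def
proof (intro conjI allI ballI impI)
  show "L \<inter> L' \<subseteq> Obj D" using assms localizing_Obj by blast
  show "\<And>X n. X \<in> L \<inter> L' \<Longrightarrow> shO D n X \<in> L \<inter> L'" using assms localizing_shift by blast
next
  fix J :: "'u set" and M P \<iota>
  assume "small TYPE('u) J" "\<forall>j\<in>J. M j \<in> L \<inter> L'" "is_coproduct D J M P \<iota>"
  then show "P \<in> L \<inter> L'"
    using localizing_coproduct[OF assms(1), of J M] localizing_coproduct[OF assms(2), of J M] by blast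
next
  fix u v w assume t: "(u, v, w) \<in> Tri D" "src D u \<in> L \<inter> L'" "tgt D u \<in> L \<inter> L'"
  obtain X Y Z where "u \<in> Hom D X Y" "v \<in> Hom D Y Z" using TriE[OF t(1)] by blast
  then show "tgt D v \<in> L \<inter> L'"
    using localizing_cone[OF assms(1) t(1)] localizing_cone[OF assms(2) t(1)] t unfolding Hom_iff by blast
qed

lemma vanishes_cone_target:
  assumes t: "(u, v, w) \<in> Tri D" and u: "u \<in> Hom D X Y" and v: "v \<in> Hom D Y Z"
    and A: "hom_vanishes D A Y" "hom_vanishes D A (shO D 1 X)" and AO: "A \<in> Obj D"
  shows "hom_vanishes D A Z"
proof -
  have w: "w \<in> Hom D Z (shO D 1 X)" using TriD[OF t u v] .
  have "f = zeroA D A Z" if f: "f \<in> Hom D A Z" for f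
  proof -
    have "w \<cdot> f = zeroA D A (shO D 1 X)" using A(2) comp_Hom[OF f w] by (simp add: hom_vanishes_def)
    then obtain s where s: "s \<in> Hom D A Y" "v \<cdot> s = f"
      using Tri_weak_kernel[OF Tri_rot[OF t] v w f] by blast
    then show ?thesis using A(1) comp_zero_right[OF v AO] by (simp add: hom_vanishes_def)
  qed
  then show ?thesis using hom_vanishes_iff AO Hom_Obj v by blast
qed

lemma vanishes_cone_source:
  assumes t: "(u, v, w) \<in> Tri D" and u: "u \<in> Hom D X Y" and v: "v \<in> Hom D Y Z"
    and B: "hom_vanishes D Y B" "hom_vanishes D (shO D 1 X) B" and BO: "B \<in> Obj D"
  shows "hom_vanishes D Z B"
proof -
  have w: "w \<in> Hom D Z (shO D 1 X)" using TriD[OF t u v] .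
  have "f = zeroA D Z B" if f: "f \<in> Hom D Z B" for f
  proof -
    have "f \<cdot> v = zeroA D Y B" using B(1) comp_Hom[OF v f] by (simp add: hom_vanishes_def)
    then obtain s where s: "s \<in> Hom D (shO D 1 X) B" "s \<cdot> w = f"
      using Tri_weak_cokernel[OF Tri_rot[OF t] v w f] by blast
    then show ?thesis using B(2) comp_zero_left[OF w BO] by (simp add: hom_vanishes_def)
  qed
  then show ?thesis using hom_vanishes_iff BO Hom_Obj v by blast
qed

lemma perp_Obj: "M \<in> perp K H \<Longrightarrow> M \<in> Obj D"
  and perp_vanishes: "M \<in> perp K H \<Longrightarrow> k \<in> K \<Longrightarrow> hom_vanishes D (shO D n (H k)) M"
  by (auto simp: perp_def)

lemma perp_shift:
  assumes "M \<in> perp K H" and H: "\<And>k. k \<in> K \<Longrightarrow> H k \<in> Obj D"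
  shows "shO D m M \<in> perp K H"
proof -
  have M: "M \<in> Obj D" using perp_Obj assms(1) by blast
  have "hom_vanishes D (shO D n (H k)) (shO D m M)" if "k \<in> K" for k n
  proof -
    have "shO D n (H k) = shO D m (shO D (n - m) (H k))" using shO_shO H[OF that] by simp
    then show ?thesis
      using hom_vanishes_shift[of "shO D (n - m) (H k)" M m] perp_vanishes[OF assms(1) that, of "n - m"]
        M H[OF that] sh_Obj by simp
  qed
  then show ?thesis using sh_Obj M by (simp add: perp_def)
qed

text \<open>Closure of an orthogonal class under coproducts is where finite support of the \<open>H\<^sub>k\<close> is used: an
  arrow into a coproduct with vanishing components need not vanish in general.\<close>

lemma perp_localizing:
  assumes H: "\<And>k. k \<in> K \<Longrightarrow> finitely_supporting TYPE('u) (H k)"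
  shows "localizing TYPE('u) (perp K H)"
  unfolding localizing_def
proof (intro conjI allI ballI impI)
  have HO: "H k \<in> Obj D" if "k \<in> K" for k using H finitely_supporting_Obj that by blast
  show "perp K H \<subseteq> Obj D" using perp_Obj by blast
  show shift: "shO D n X \<in> perp K H" if "X \<in> perp K H" for X n using perp_shift[OF that HO] .
  fix J :: "'u set" and M P \<iota>
  assume J: "small TYPE('u) J" and M: "\<forall>j\<in>J. M j \<in> perp K H" and P: "is_coproduct D J M P \<iota>"
  have MO: "M j \<in> Obj D" if "j \<in> J" for j using M that perp_Obj by blast
  have "hom_vanishes D (shO D n (H k)) P" if k: "k \<in> K" for k n
  proof -
    have "f = zeroA D (shO D n (H k)) P" if f: "f \<in> Hom D (shO D n (H k)) P" for f
    proof (rule finitely_supported_eq_zero[OF finitely_supporting_shift[OF H[OF k]] J MO P f])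
      fix j p assume j: "j \<in> J" and p: "p \<in> Hom D P (M j)"
      have "hom_vanishes D (shO D n (H k)) (M j)" using perp_vanishes[OF _ k] M j by simp
      then show "p \<cdot> f = zeroA D (shO D n (H k)) (M j)"
        using comp_Hom[OF f p] by (simp add: hom_vanishes_def)
    qed
    then show ?thesis using hom_vanishes_iff sh_Obj HO k coproduct_Obj[OF P] by simp
  qed
  then show "P \<in> perp K H" using coproduct_Obj[OF P] by (simp add: perp_def)
next
  fix u v w assume t: "(u, v, w) \<in> Tri D" "src D u \<in> perp K H" "tgt D u \<in> perp K H"
  have HO: "H k \<in> Obj D" if "k \<in> K" for k using H finitely_supporting_Obj that by blast
  obtain X Y Z where uv: "u \<in> Hom D X Y" "v \<in> Hom D Y Z" using TriE[OF t(1)] by blast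
  then have XY: "X \<in> perp K H" "Y \<in> perp K H" "tgt D v = Z" using t by (auto simp: Hom_iff)
  have "hom_vanishes D (shO D n (H k)) Z" if "k \<in> K" for k n
    using vanishes_cone_target[OF t(1) uv] perp_vanishes[OF XY(2) that]
      perp_vanishes[OF perp_shift[OF XY(1) HO] that] sh_Obj HO[OF that] by blast
  then show "tgt D v \<in> perp K H" using XY(3) Hom_Obj(2)[OF uv(2)] by (simp add: perp_def)
qed

lemma left_orthogonal_localizing:
  assumes S: "S \<subseteq> Obj D" and sh: "\<And>Y n. Y \<in> S \<Longrightarrow> shO D n Y \<in> S"
  shows "localizing TYPE('u) {N \<in> Obj D. \<forall>Y \<in> S. hom_vanishes D N Y}" (is "localizing _ ?L")
  unfolding localizing_def
proof (intro conjI allI ballI impI)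
  show "?L \<subseteq> Obj D" by blast
  show shift: "shO D n X \<in> ?L" if "X \<in> ?L" for X n
    using that hom_vanishes_shift_left[of X _ n] sh S sh_Obj by blast
  fix J :: "'u set" and M P \<iota>
  assume M: "\<forall>j\<in>J. M j \<in> ?L" and P: "is_coproduct D J M P \<iota>"
  have "f = zeroA D P Y" if Y: "Y \<in> S" and f: "f \<in> Hom D P Y" for Y f
  proof (rule coproduct_eq_zero[OF P f])
    fix j assume j: "j \<in> J"
    have "hom_vanishes D (M j) Y" using M j Y by blast
    then show "f \<cdot> \<iota> j = zeroA D (M j) Y"
      using comp_Hom[OF coproduct_inj[OF P j] f] by (simp add: hom_vanishes_def)
  qed
  then have "hom_vanishes D P Y" if "Y \<in> S" for Y
    using hom_vanishes_iff coproduct_Obj[OF P] S that by blast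
  then show "P \<in> ?L" using coproduct_Obj[OF P] by blast
next
  fix u v w assume t: "(u, v, w) \<in> Tri D" "src D u \<in> ?L" "tgt D u \<in> ?L"
  obtain X Y Z where uv: "u \<in> Hom D X Y" "v \<in> Hom D Y Z" using TriE[OF t(1)] by blast
  then have XY: "X \<in> ?L" "Y \<in> ?L" "tgt D v = Z" using t by (auto simp: Hom_iff)
  have "hom_vanishes D Z B" if B: "B \<in> S" for B
  proof -
    have "hom_vanishes D (shO D 1 X) B"
      using XY(1) hom_vanishes_shift_left[of X B 1] sh[OF B] S B by blast
    then show ?thesis using vanishes_cone_source[OF t(1) uv] XY B S by blast
  qed
  then show "tgt D v \<in> ?L" using XY(3) Hom_Obj(2)[OF uv(2)] by blast
qed

text \<open>The coproduct of shifts of the \<open>H\<^sub>k\<close> indexed by all arrows \<open>x\<close> into \<open>N\<close> with \<open>Q x\<close>, together with its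
  evaluation arrow. With \<open>Q\<close> always true it hits everything; with \<open>Q\<close> selecting the arrows to be killed,
  its cone kills those.\<close>

lemma ex_test_coproduct:
  assumes u: "universe TYPE('u)" and c: "has_small_coproducts TYPE('u) D"
    and K: "small TYPE('u) K" and L: "localizing TYPE('u) L" and H: "\<And>k. k \<in> K \<Longrightarrow> H k \<in> L"
    and sm: "\<And>k n. k \<in> K \<Longrightarrow> small TYPE('u) (Hom D (shO D n (H k)) N)" and N: "N \<in> Obj D"
  obtains P ev where "P \<in> L" "ev \<in> Hom D P N"
    "\<And>k n x. k \<in> K \<Longrightarrow> x \<in> Hom D (shO D n (H k)) N \<Longrightarrow> Q x \<Longrightarrow>
      \<exists>i \<in> Hom D (shO D n (H k)) P. ev \<cdot> i = x"
    "\<And>g M. g \<in> Hom D N M \<Longrightarrow>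
      (\<And>k n x. k \<in> K \<Longrightarrow> x \<in> Hom D (shO D n (H k)) N \<Longrightarrow> Q x \<Longrightarrow> g \<cdot> x = zeroA D (shO D n (H k)) M)
      \<Longrightarrow> g \<cdot> ev = zeroA D P M"
proof -
  let ?S = "SIGMA k : K. SIGMA n : (UNIV :: int set). {x \<in> Hom D (shO D n (H k)) N. Q x}"
  let ?F = "\<lambda>s. shO D (fst (snd s)) (H (fst s))"
  have S: "small TYPE('u) ?S"
  proof (intro small_Sigma[OF u] K small_countable[OF u])
    fix k and n :: int assume "k \<in> K"
    then show "small TYPE('u) {x \<in> Hom D (shO D n (H k)) N. Q x}"
      by (intro small_inj[where f = id, OF _ _ sm[of k n]]) auto
  qed
  have FL: "?F s \<in> L" if "s \<in> ?S" for s using that H localizing_shift[OF L] by auto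
  then have FO: "?F s \<in> Obj D" if "s \<in> ?S" for s using that localizing_Obj[OF L] by blast
  obtain P \<iota> where P: "is_coproduct D ?S ?F P \<iota>"
    by (rule ex_small_coproduct[where M = ?F, OF c S]) (use FO in blast)
  have PL: "P \<in> L" by (rule localizing_coproduct[OF L S _ P]) (use FL in blast)
  have xH: "snd (snd s) \<in> Hom D (?F s) N" if "s \<in> ?S" for s using that by auto
  obtain ev where ev: "ev \<in> Hom D P N" "\<And>s. s \<in> ?S \<Longrightarrow> ev \<cdot> \<iota> s = snd (snd s)"
    by (rule coproduct_desc[OF P N, where f = "\<lambda>s. snd (snd s)"]) (use xH in blast)+
  show ?thesis
  proof (rule that[OF PL ev(1)])
    fix k n x assume x: "k \<in> K" "x \<in> Hom D (shO D n (H k)) N" "Q x"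
    then have s: "(k, n, x) \<in> ?S" by simp
    show "\<exists>i \<in> Hom D (shO D n (H k)) P. ev \<cdot> i = x"
      using ev(2)[OF s] coproduct_inj[OF P s] by auto
  next
    fix g M assume g: "g \<in> Hom D N M"
      "\<And>k n x. k \<in> K \<Longrightarrow> x \<in> Hom D (shO D n (H k)) N \<Longrightarrow> Q x \<Longrightarrow> g \<cdot> x = zeroA D (shO D n (H k)) M"
    show "g \<cdot> ev = zeroA D P M"
    proof (rule coproduct_eq_zero[OF P comp_Hom[OF ev(1) g(1)]])
      fix s assume s: "s \<in> ?S"
      have "(g \<cdot> ev) \<cdot> \<iota> s = g \<cdot> snd (snd s)"
        using comp_assoc[OF coproduct_inj[OF P s] ev(1) g(1)] ev(2)[OF s] by simp
      moreover have "g \<cdot> snd (snd s) = zeroA D (?F s) M"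
        by (rule g(2)) (use s in auto)
      ultimately show "(g \<cdot> ev) \<cdot> \<iota> s = zeroA D (?F s) M" by simp
    qed
  qed
qed

text \<open>\<open>N\<close> is enlarged by attaching cones on all arrows from shifts of the \<open>H\<^sub>k\<close> that vanish in \<open>M\<close>; the
  arrow to \<open>M\<close> extends because it kills what has been attached along.\<close>

lemma killing_step:
  assumes u: "universe TYPE('u)" and c: "has_small_coproducts TYPE('u) D"
    and K: "small TYPE('u) K" and L: "localizing TYPE('u) L" and H: "\<And>k. k \<in> K \<Longrightarrow> H k \<in> L"
    and sm: "\<And>k n. k \<in> K \<Longrightarrow> small TYPE('u) (Hom D (shO D n (H k)) N)"
    and N: "N \<in> L" and g: "g \<in> Hom D N M"
  obtains N' s g' where "N' \<in> L" "s \<in> Hom D N N'" "g' \<in> Hom D N' M" "g' \<cdot> s = g"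
    "\<And>k n x. k \<in> K \<Longrightarrow> x \<in> Hom D (shO D n (H k)) N \<Longrightarrow> g \<cdot> x = zeroA D (shO D n (H k)) M
      \<Longrightarrow> s \<cdot> x = zeroA D (shO D n (H k)) N'"
proof -
  let ?Q = "\<lambda>x. g \<cdot> x = zeroA D (src D x) M"
  have NO: "N \<in> Obj D" using Hom_Obj g by blast
  obtain P ev where P: "P \<in> L" and ev: "ev \<in> Hom D P N"
    and lift: "\<And>k n x. k \<in> K \<Longrightarrow> x \<in> Hom D (shO D n (H k)) N \<Longrightarrow> ?Q x \<Longrightarrow>
      \<exists>i \<in> Hom D (shO D n (H k)) P. ev \<cdot> i = x"
    and kill: "\<And>g M. g \<in> Hom D N M \<Longrightarrow>
      (\<And>k n x. k \<in> K \<Longrightarrow> x \<in> Hom D (shO D n (H k)) N \<Longrightarrow> ?Q x \<Longrightarrow> g \<cdot> x = zeroA D (shO D n (H k)) M)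
      \<Longrightarrow> g \<cdot> ev = zeroA D P M"
    by (rule ex_test_coproduct[where Q = ?Q, OF u c K L H sm NO]) (assumption | blast)+
  have gev: "g \<cdot> ev = zeroA D P M" by (rule kill[OF g]) (simp add: Hom_iff)
  obtain N' s w where t: "(ev, s, w) \<in> Tri D" and s: "s \<in> Hom D N N'" using cone[OF ev] by blast
  obtain g' where g': "g' \<in> Hom D N' M" "g' \<cdot> s = g" using Tri_weak_cokernel[OF t ev s g gev] by blast
  show ?thesis
  proof (rule that[OF localizing_cone[OF L t ev s P N] s g'])
    fix k n x assume k: "k \<in> K" and x: "x \<in> Hom D (shO D n (H k)) N" "g \<cdot> x = zeroA D (shO D n (H k)) M"
    then obtain i where i: "i \<in> Hom D (shO D n (H k)) P" "ev \<cdot> i = x"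
      using lift[OF k x(1)] by (auto simp: Hom_iff)
    then show "s \<cdot> x = zeroA D (shO D n (H k)) N'"
      using comp_reassoc[OF Tri_comp_zero[OF t ev s] ev s i(1)] comp_zero_left[OF i(1)] Hom_Obj[OF s] by simp
  qed
qed

text \<open>Bousfield localization at a small family of objects with finite support. Start with a
  coproduct mapping onto all arrows from shifts of the \<open>H\<^sub>k\<close> to \<open>M\<close> and kill iteratively the arrows
  that vanish in \<open>M\<close>. As arrows from \<open>H\<^sub>k\<close> into the telescope come from a finite stage, the telescope
  and \<open>M\<close> receive the same arrows from the shifts of the \<open>H\<^sub>k\<close>, so the cone only receives zero arrows. The
  telescope is assembled from the \<open>H\<^sub>k\<close> and so lies in every localizing subcategory that contains
  them.\<close>

lemma cellular_approximation:
  assumes u: "universe TYPE('u)" and c: "has_small_coproducts TYPE('u) D"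
    and K: "small TYPE('u) K" and L: "localizing TYPE('u) L" and H: "\<And>k. k \<in> K \<Longrightarrow> H k \<in> L"
    and fs: "\<And>k. k \<in> K \<Longrightarrow> finitely_supporting TYPE('u) (H k)"
    and sm: "\<And>k n N. k \<in> K \<Longrightarrow> N \<in> Obj D \<Longrightarrow> small TYPE('u) (Hom D (shO D n (H k)) N)"
    and M: "M \<in> Obj D"
  obtains T Q f g h where "(f, g, h) \<in> Tri D" "f \<in> Hom D T M" "g \<in> Hom D M Q" "T \<in> L" "Q \<in> perp K H"
proof -
  let ?X = "\<lambda>k n. shO D n (H k)"
  obtain N0 g0 where N0: "N0 \<in> L" "g0 \<in> Hom D N0 M"
    "\<And>k n x. k \<in> K \<Longrightarrow> x \<in> Hom D (?X k n) M \<Longrightarrow> \<exists>i \<in> Hom D (?X k n) N0. g0 \<cdot> i = x"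
    by (rule ex_test_coproduct[where Q = "\<lambda>_. True", OF u c K L H sm[OF _ M] M])
      (assumption | blast)+
  \<comment> \<open>Only stage \<open>0\<close> has to hit all arrows into \<open>M\<close>, since the later ones receive it.\<close>
  define stage where "stage = (\<lambda>Ng. fst Ng \<in> L \<and> snd Ng \<in> Hom D (fst Ng) M)"
  define onto where "onto = (\<lambda>Ng. \<forall>k \<in> K. \<forall>n. \<forall>x \<in> Hom D (?X k n) M. \<exists>i \<in> Hom D (?X k n) (fst Ng). snd Ng \<cdot> i = x)"
  define killing where "killing = (\<lambda>Ng Ng' s. s \<in> Hom D (fst Ng) (fst Ng') \<and> snd Ng' \<cdot> s = snd Ng \<and>
    (\<forall>k \<in> K. \<forall>n. \<forall>x \<in> Hom D (?X k n) (fst Ng).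
      snd Ng \<cdot> x = zeroA D (?X k n) M \<longrightarrow> s \<cdot> x = zeroA D (?X k n) (fst Ng')))"
  have "\<exists>\<Phi>. \<forall>i. (stage (\<Phi> i) \<and> (i = 0 \<longrightarrow> onto (\<Phi> i))) \<and> (\<exists>s. killing (\<Phi> i) (\<Phi> (Suc i)) s)"
  proof (rule dependent_nat_choice)
    show "\<exists>Ng. stage Ng \<and> ((0::nat) = 0 \<longrightarrow> onto Ng)"
      using N0 unfolding stage_def onto_def by (intro exI[of _ "(N0, g0)"]) auto
    fix Ng :: "'o \<times> 'a" and i :: nat assume "stage Ng \<and> (i = 0 \<longrightarrow> onto Ng)"
    then have N: "fst Ng \<in> L" "snd Ng \<in> Hom D (fst Ng) M" by (auto simp: stage_def)
    have NO: "fst Ng \<in> Obj D" using Hom_Obj N(2) by blast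
    obtain N' s g' where "N' \<in> L" "s \<in> Hom D (fst Ng) N'" "g' \<in> Hom D N' M" "g' \<cdot> s = snd Ng"
      "\<And>k n x. k \<in> K \<Longrightarrow> x \<in> Hom D (?X k n) (fst Ng) \<Longrightarrow> snd Ng \<cdot> x = zeroA D (?X k n) M
        \<Longrightarrow> s \<cdot> x = zeroA D (?X k n) N'"
      by (rule killing_step[OF u c K L H sm[OF _ NO] N]) (assumption | blast)+
    then have "stage (N', g')" "killing Ng (N', g') s" unfolding stage_def killing_def by auto
    then show "\<exists>Ng'. (stage Ng' \<and> (Suc i = 0 \<longrightarrow> onto Ng')) \<and> (\<exists>s. killing Ng Ng' s)" by blast
  qed
  then obtain \<Phi> where \<Phi>: "\<And>i. stage (\<Phi> i)" "onto (\<Phi> 0)" "\<And>i. \<exists>s. killing (\<Phi> i) (\<Phi> (Suc i)) s" by blast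
  define N \<gamma> where "N = (\<lambda>i. fst (\<Phi> i))" and "\<gamma> = (\<lambda>i. snd (\<Phi> i))"
  have "\<exists>s. \<forall>i. killing (\<Phi> i) (\<Phi> (Suc i)) (s i)" using \<Phi>(3) by (intro choice) blast
  then obtain s where "\<And>i. killing (\<Phi> i) (\<Phi> (Suc i)) (s i)" by blast
  then have s: "s i \<in> Hom D (N i) (N (Suc i))" "\<gamma> (Suc i) \<cdot> s i = \<gamma> i"
    and ker: "\<And>k n x. k \<in> K \<Longrightarrow> x \<in> Hom D (?X k n) (N i) \<Longrightarrow> \<gamma> i \<cdot> x = zeroA D (?X k n) M
      \<Longrightarrow> s i \<cdot> x = zeroA D (?X k n) (N (Suc i))" for i
    unfolding killing_def N_def \<gamma>_def by auto
  have NL: "N i \<in> L" and \<gamma>: "\<gamma> i \<in> Hom D (N i) M" for i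
    using \<Phi>(1)[of i] unfolding stage_def N_def \<gamma>_def by auto
  have onto0: "\<exists>i \<in> Hom D (?X k n) (N 0). \<gamma> 0 \<cdot> i = x" if "k \<in> K" "x \<in> Hom D (?X k n) M" for k n x
    using \<Phi>(2) that unfolding onto_def N_def \<gamma>_def by blast
  have NO: "N i \<in> Obj D" for i using NL localizing_Obj[OF L] by blast
  have nat: "small TYPE('u) (UNIV :: nat set)" using small_countable[OF u] .
  obtain P \<iota> where P: "is_coproduct D (UNIV :: nat set) N P \<iota>"
    by (rule ex_small_coproduct[where M = N, OF c nat]) (use NO in blast)
  have PL: "P \<in> L" by (rule localizing_coproduct[OF L nat _ P]) (use NL in blast)
  have i: "\<iota> k \<in> Hom D (N k) P" for k using coproduct_inj[OF P, of k] by simp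
  obtain T q d w where t: "(d, q, w) \<in> Tri D" "d \<in> Hom D P P" "q \<in> Hom D P T"
    and step: "\<And>k. q \<cdot> \<iota> k = (q \<cdot> \<iota> (Suc k)) \<cdot> s k"
    and desc: "\<And>M g. (\<And>k. g k \<in> Hom D (N k) M) \<Longrightarrow> (\<And>k. g (Suc k) \<cdot> s k = g k)
      \<Longrightarrow> \<exists>h \<in> Hom D T M. \<forall>k. h \<cdot> (q \<cdot> \<iota> k) = g k"
    and factor: "\<And>X x. finitely_supporting TYPE('u) X \<Longrightarrow> x \<in> Hom D X T
      \<Longrightarrow> \<exists>k. \<exists>y \<in> Hom D X (N k). x = (q \<cdot> \<iota> k) \<cdot> y"
    by (rule mapping_telescope[OF u P s(1)]) blast
  have qi: "q \<cdot> \<iota> k \<in> Hom D (N k) T" for k using comp_Hom i t by blast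
  have TL: "T \<in> L" using localizing_cone[OF L t PL PL] .
  obtain f where f: "f \<in> Hom D T M" "\<And>k. f \<cdot> (q \<cdot> \<iota> k) = \<gamma> k" using desc[OF \<gamma> s(2)] by blast
  obtain Q g h where t': "(f, g, h) \<in> Tri D" and g: "g \<in> Hom D M Q" and h: "h \<in> Hom D Q (shO D 1 T)"
    using cone[OF f(1)] by blast
  have HO: "?X k n \<in> Obj D" if "k \<in> K" for k n using H[OF that] localizing_Obj[OF L] sh_Obj by blast
  have f1: "shA D 1 f \<in> Hom D (shO D 1 T) (shO D 1 M)" using sh_Hom[OF f(1)] .
  \<comment> \<open>An arrow into \<open>T\<close> that vanishes in \<open>M\<close> lives on some stage and dies at the next one.\<close>
  have inj: "x = zeroA D (?X k n) T"
    if k: "k \<in> K" and x: "x \<in> Hom D (?X k n) T" "f \<cdot> x = zeroA D (?X k n) M" for k n x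
  proof -
    obtain j y where y: "y \<in> Hom D (?X k n) (N j)" "x = (q \<cdot> \<iota> j) \<cdot> y"
      using factor[OF finitely_supporting_shift[OF fs[OF k]] x(1)] by blast
    then have "\<gamma> j \<cdot> y = zeroA D (?X k n) M" using comp_reassoc[OF f(2) qi f(1) y(1)] x(2) by simp
    then have "s j \<cdot> y = zeroA D (?X k n) (N (Suc j))" using ker[OF k y(1)] by blast
    moreover have "x = (q \<cdot> \<iota> (Suc j)) \<cdot> (s j \<cdot> y)"
      using y(2) comp_assoc[OF y(1) s(1) qi] step[of j] by simp
    ultimately show ?thesis using comp_zero_right[OF qi HO[OF k]] by simp
  qed
  have "hom_vanishes D (?X k n) Q" if k: "k \<in> K" for k n
  proof -
    have "x = zeroA D (?X k n) Q" if x: "x \<in> Hom D (?X k n) Q" for x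
    proof -
      \<comment> \<open>The boundary of \<open>x\<close> vanishes by injectivity one degree lower, so \<open>x\<close> comes from \<open>M\<close> and
        hence, as stage \<open>0\<close> hits everything, from \<open>T\<close>.\<close>
      let ?Y = "?X k (n - 1)"
      have Y1: "shO D 1 ?Y = ?X k n"
        using shO_shO[of "H k" 1 "n - 1"] H[OF k] localizing_Obj[OF L] by simp
      have TO: "T \<in> Obj D" and MO: "M \<in> Obj D" using Hom_Obj f by blast+
      have "h \<cdot> x \<in> Hom D (shO D 1 ?Y) (shO D 1 T)" using comp_Hom[OF x h] Y1 by simp
      then obtain y where y: "y \<in> Hom D ?Y T" "h \<cdot> x = shA D 1 y"
        using unshift_Hom[OF _ HO[OF k] TO] by blast
      have "shA D 1 (f \<cdot> y) = zeroA D (?X k n) (shO D 1 M)"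
        using sh_comp[OF y(1) f(1), of 1] y(2) comp_reassoc[OF Tri_comp_zero_rot(2)[OF t' f(1) g] h f1 x]
          comp_zero_left[OF x] Hom_Obj(2)[OF f1] by simp
      then have "shA D 1 (f \<cdot> y) = shA D 1 (zeroA D ?Y M)"
        using shA_zeroA[OF HO[OF k] MO, of 1 "n - 1"] Y1 by simp
      then have "f \<cdot> y = zeroA D ?Y M"
        using shA_inject comp_Hom[OF y(1) f(1)] zeroA_Hom[OF HO[OF k] MO, of "n - 1"] by (simp add: Hom_iff)
      then have "y = zeroA D ?Y T" using inj[OF k y(1)] by blast
      then have "h \<cdot> x = zeroA D (?X k n) (shO D 1 T)"
        using y(2) shA_zeroA[OF HO[OF k] TO, of 1 "n - 1"] Y1 by simp
      then obtain z where z: "z \<in> Hom D (?X k n) M" "g \<cdot> z = x"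
        using Tri_weak_kernel[OF Tri_rot[OF t'] g h x] by blast
      obtain i0 where i0: "i0 \<in> Hom D (?X k n) (N 0)" "\<gamma> 0 \<cdot> i0 = z" using onto0[OF k z(1)] by blast
      have z': "z = f \<cdot> ((q \<cdot> \<iota> 0) \<cdot> i0)" using i0 comp_reassoc[OF f(2) qi f(1) i0(1)] by simp
      have qi0: "(q \<cdot> \<iota> 0) \<cdot> i0 \<in> Hom D (?X k n) T" using comp_Hom[OF i0(1) qi] .
      show ?thesis
        using z(2) comp_reassoc[OF Tri_comp_zero[OF t' f(1) g] f(1) g qi0]
          comp_zero_left[OF qi0] Hom_Obj[OF g] unfolding z' by simp
    qed
    then show ?thesis using hom_vanishes_iff HO[OF k] Hom_Obj g by blast
  qed
  then have "Q \<in> perp K H" using Hom_Obj g by (simp add: perp_def)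
  then show ?thesis using that t' f(1) g TL by blast
qed

section \<open>Orthogonal splittings and centrally split TTF triples\<close>

lemma full_iso_closedD:
  "full_iso_closed_subcat D C S \<Longrightarrow> X \<in> S \<Longrightarrow> X \<in> C"
  "full_iso_closed_subcat D C S \<Longrightarrow> X \<in> S \<Longrightarrow> Y \<in> C \<Longrightarrow> isomorphic_in D X Y \<Longrightarrow> Y \<in> S"
  by (auto simp: full_iso_closed_subcat_def)

text \<open>The identity of \<open>B\<close> factors as \<open>B \<rightarrow> M \<rightarrow> B\<close>, so it is zero as soon as one of the factors is.\<close>

lemma biproduct_absorb:
  assumes M: "biproduct A B M a b p q" and "hom_vanishes D M B \<or> hom_vanishes D B M"
  shows "isomorphic_in D A M" "ide D B = zeroA D B B"
proof -
  note bp = biproductD[OF M]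
  show "ide D B = zeroA D B B"
  proof (cases "hom_vanishes D M B")
    case True
    then have "q = zeroA D M B" using bp by (simp add: hom_vanishes_def)
    then show ?thesis using bp comp_zero_left[OF bp(5) bp(2)] by simp
  next
    case False
    then have "b = zeroA D B M" using bp assms(2) by (simp add: hom_vanishes_def)
    then show ?thesis using bp comp_zero_right[OF bp(7) bp(2)] by simp
  qed
  then show "isomorphic_in D A M" using biproduct_trivial_iso[OF M] by blast
qed

text \<open>\<open>B\<close> and the cone of \<open>a\<close> are complements of \<open>A\<close> for the same inclusion \<open>a\<close> and retraction \<open>p\<close>, and such
  complements are isomorphic. This converts biproduct decompositions into truncation triangles.\<close>

lemma biproduct_cone_iso:
  assumes M: "biproduct A B M a b p q" and t: "(a, v, w) \<in> Tri D" and v: "v \<in> Hom D M Z"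
  shows "isomorphic_in D B Z"
proof -
  note bp = biproductD[OF M]
  obtain b' where "biproduct A Z M a b' p v" using Tri_section_biproduct[OF t bp(4) v bp(6,8)] .
  note bp' = biproductD[OF this]
  have vb: "v \<cdot> b \<in> Hom D B Z" and qb: "q \<cdot> b' \<in> Hom D Z B" using comp_Hom bp bp' by blast+
  have "b = addA D (a \<cdot> (p \<cdot> b)) (b' \<cdot> (v \<cdot> b))"
    using comp_add_left[OF bp(5) comp_Hom[OF bp'(6,4)] comp_Hom[OF bp'(7,5)]] bp'(12) comp_ide_left[OF bp(5)]
      comp_assoc[OF bp(5) bp'(6,4)] comp_assoc[OF bp(5) bp'(7,5)] by simp
  then have "b = b' \<cdot> (v \<cdot> b)"
    using bp(10) comp_zero_right[OF bp(4,2)] add_zero_left[OF comp_Hom[OF vb bp'(5)]] by simp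
  then have 1: "(q \<cdot> b') \<cdot> (v \<cdot> b) = ide D B" using comp_assoc[OF vb bp'(5) bp(7)] bp(9) by simp
  have "b' = addA D (a \<cdot> (p \<cdot> b')) (b \<cdot> (q \<cdot> b'))"
    using comp_add_left[OF bp'(5) comp_Hom[OF bp(6,4)] comp_Hom[OF bp(7,5)]] bp(12) comp_ide_left[OF bp'(5)]
      comp_assoc[OF bp'(5) bp(6,4)] comp_assoc[OF bp'(5) bp(7,5)] by simp
  then have "b' = b \<cdot> (q \<cdot> b')"
    using bp'(10) comp_zero_right[OF bp(4) bp'(2)] add_zero_left[OF comp_Hom[OF qb bp(5)]] by simp
  then have 2: "(v \<cdot> b) \<cdot> (q \<cdot> b') = ide D Z" using comp_assoc[OF qb bp(5) v] bp'(9) by simp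
  show ?thesis unfolding isomorphic_in_def is_iso_arr_def
    using vb qb 1 2 by (intro bexI[of _ "v \<cdot> b"] conjI bexI[of _ "q \<cdot> b'"]) (auto simp: Hom_iff)
qed

text \<open>Decompositions of the whole category into two mutually orthogonal, shift-stable parts: the
  symmetric form of a centrally split TTF triple.\<close>

definition orthogonal_split :: "'o set \<Rightarrow> 'o set \<Rightarrow> bool" where
  "orthogonal_split X Y \<longleftrightarrow>
     full_iso_closed_subcat D (Obj D) X \<and> full_iso_closed_subcat D (Obj D) Y \<and>
     (\<forall>A \<in> X. \<forall>n. shO D n A \<in> X) \<and> (\<forall>B \<in> Y. \<forall>n. shO D n B \<in> Y) \<and>
     (\<forall>A \<in> X. \<forall>B \<in> Y. hom_vanishes D A B \<and> hom_vanishes D B A) \<and>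
     (\<forall>M \<in> Obj D. \<exists>A \<in> X. \<exists>B \<in> Y. \<exists>a b p q. biproduct A B M a b p q)"

lemma orthogonal_splitD:
  assumes "orthogonal_split X Y"
  shows "full_iso_closed_subcat D (Obj D) X" "full_iso_closed_subcat D (Obj D) Y"
    "A \<in> X \<Longrightarrow> shO D n A \<in> X" "B \<in> Y \<Longrightarrow> shO D n B \<in> Y"
    "A \<in> X \<Longrightarrow> B \<in> Y \<Longrightarrow> hom_vanishes D A B" "A \<in> X \<Longrightarrow> B \<in> Y \<Longrightarrow> hom_vanishes D B A"
    "A \<in> X \<Longrightarrow> A \<in> Obj D" "B \<in> Y \<Longrightarrow> B \<in> Obj D"
  using assms unfolding orthogonal_split_def full_iso_closed_subcat_def by auto

lemma orthogonal_splitE: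
  assumes "orthogonal_split X Y" "M \<in> Obj D"
  obtains A B a b p q where "A \<in> X" "B \<in> Y" "biproduct A B M a b p q"
  using assms unfolding orthogonal_split_def by blast

lemma orthogonal_split_sym:
  assumes "orthogonal_split X Y" shows "orthogonal_split Y X"
proof -
  have "\<exists>B \<in> Y. \<exists>A \<in> X. \<exists>b a q p. biproduct B A M b a q p" if "M \<in> Obj D" for M
    using orthogonal_splitE[OF assms that] biproduct_sym by metis
  then show ?thesis using assms unfolding orthogonal_split_def by blast
qed

lemma coaisle_shift_closed:
  assumes "S \<subseteq> Obj D" and sh: "\<And>B n. B \<in> S \<Longrightarrow> shO D n B \<in> S"
  shows "coaisle D S = S"
proof
  show "coaisle D S \<subseteq> S" using sh unfolding coaisle_def by blast
  show "S \<subseteq> coaisle D S"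
  proof
    fix B assume B: "B \<in> S"
    then have "B = shO D (-1) (shO D 1 B)" using shO_inv(2)[of B 1] assms(1) by auto
    then show "B \<in> coaisle D S" unfolding coaisle_def using sh[OF B, of 1] by blast
  qed
qed

lemma shift_closedI:
  assumes "S \<subseteq> Obj D" "\<And>A. A \<in> S \<Longrightarrow> shO D 1 A \<in> S" "\<And>A. A \<in> S \<Longrightarrow> shO D (-1) A \<in> S" "A \<in> S"
  shows "shO D n A \<in> S"
proof (induction n rule: int_induct[where k = 0])
  case base
  then show ?case using assms(1,4) shO_0 by auto
next
  case (step1 i)
  then show ?case using assms(2)[OF step1(2)] shO_shO[of A 1 i] assms(1,4) by (auto simp: add.commute)
next
  case (step2 i)
  then show ?case using assms(3)[OF step2(2)] shO_shO[of A "-1" i] assms(1,4) by auto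
qed

lemma orthogonal_split_t_structure:
  assumes S: "orthogonal_split X Y"
  shows "t_structure D X Y" "t_structure_splits D X Y"
proof -
  note s = orthogonal_splitD[OF S]
  have co: "coaisle D Y = Y" using coaisle_shift_closed[of Y] s by blast
  have "\<exists>f g h. t_truncation D X Y M f g h" if M: "M \<in> Obj D" for M
  proof -
    obtain A B a b p q where m: "A \<in> X" "B \<in> Y" "biproduct A B M a b p q"
      using orthogonal_splitE[OF S M] .
    note bp = biproductD[OF m(3)]
    obtain Z v w where t: "(a, v, w) \<in> Tri D" "v \<in> Hom D M Z" using cone[OF bp(4)] by blast
    have "Z \<in> Y"
      using full_iso_closedD(2)[OF s(2) m(2) _ biproduct_cone_iso[OF m(3) t]] Hom_Obj[OF t(2)] by blast
    then have "t_truncation D X Y M a v w"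
      unfolding t_truncation_def using t m bp by (auto simp: Hom_iff)
    then show ?thesis by blast
  qed
  then show "t_structure D X Y"
    unfolding t_structure_def Let_def co using s by blast
  show "t_structure_splits D X Y"
    unfolding t_structure_splits_def co
  proof (intro ballI allI impI)
    fix M f g h assume tt: "t_truncation D X Y M f g h"
    then have t: "(f, g, h) \<in> Tri D" and tX: "src D f \<in> X" and tY: "tgt D g \<in> Y"
      by (auto simp: t_truncation_def)
    obtain A M' B where f: "f \<in> Hom D A M'" and g: "g \<in> Hom D M' B" and h: "h \<in> Hom D B (shO D 1 A)"
      using TriE[OF t] .
    have "hom_vanishes D B (shO D 1 A)" using s(6)[OF s(3)] tX tY f g by (simp add: Hom_iff)
    then have "h = zeroA D B (shO D 1 A)" using h by (simp add: hom_vanishes_def)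
    then obtain r where "r \<in> Hom D M' A" "r \<cdot> f = ide D A" using Tri_zero_imp_section[OF t f g] by blast
    then show "is_section D f" unfolding is_section_def using f by (auto simp: Hom_iff)
  qed
qed

lemma t_structureD:
  assumes "t_structure D U W"
  shows "W \<subseteq> Obj D" "full_iso_closed_subcat D (Obj D) U" "full_iso_closed_subcat D (Obj D) (coaisle D W)"
    "\<And>A B. A \<in> U \<Longrightarrow> B \<in> coaisle D W \<Longrightarrow> hom_vanishes D A B"
    "\<And>A. A \<in> U \<Longrightarrow> shO D 1 A \<in> U" "\<And>B. B \<in> coaisle D W \<Longrightarrow> shO D (-1) B \<in> coaisle D W"
    "\<And>M. M \<in> Obj D \<Longrightarrow> \<exists>f g h. t_truncation D U (coaisle D W) M f g h"
  using assms unfolding t_structure_def Let_def image_subset_iff by simp_all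

text \<open>That \<open>Y\<close> is at once a coaisle and an aisle makes it stable under all shifts. The splittings then
  identify \<open>X\<close> with the coaisle \<open>V\<close> of \<open>Z\<close>: an object of either class has no nonzero summand in \<open>Y\<close>,
  which leaves the summand in the other class. So \<open>X\<close> is stable under all shifts as well and the
  shift between \<open>V\<close> and \<open>Z\<close> disappears.\<close>

lemma centrally_split_TTF_iff:
  "(X, Y, Z) \<in> centrally_split_TTF_triples D \<longleftrightarrow> Z = X \<and> orthogonal_split X Y"
proof
  assume "Z = X \<and> orthogonal_split X Y"
  then show "(X, Y, Z) \<in> centrally_split_TTF_triples D"
    using orthogonal_split_t_structure orthogonal_split_sym
    unfolding centrally_split_TTF_triples_def TTF_triple_def by blast
next
  assume "(X, Y, Z) \<in> centrally_split_TTF_triples D"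
  then have tX: "t_structure D X Y" and tY: "t_structure D Y Z"
    and sX: "t_structure_splits D X Y" and sY: "t_structure_splits D Y Z"
    by (auto simp: centrally_split_TTF_triples_def TTF_triple_def)
  define V where "V = coaisle D Z"
  note 1 = t_structureD(1)[OF tX] t_structureD(2)[OF tX] t_structureD(4-7)[OF tX]
  note 2 = t_structureD[OF tY, folded V_def]
  have unsh: "A = B" if "shO D (-1) A = shO D (-1) B" "A \<in> Obj D" "B \<in> Obj D" for A B
  proof -
    have "A = shO D 1 (shO D (-1) A)" using shO_inv(1)[OF that(2), of 1] by simp
    also have "\<dots> = shO D 1 (shO D (-1) B)" by (simp only: that(1))
    also have "\<dots> = B" using shO_inv(1)[OF that(3), of 1] by simp
    finally show ?thesis .
  qed
  have "shO D (-1) B \<in> Y" if B: "B \<in> Y" for B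
  proof -
    have "shO D (-1) (shO D (-1) B) \<in> coaisle D Y" using 1(5) B unfolding coaisle_def by blast
    then obtain C where C: "C \<in> Y" "shO D (-1) (shO D (-1) B) = shO D (-1) C" unfolding coaisle_def by blast
    then have "shO D (-1) B = C" using unsh 1(1) B sh_Obj by blast
    then show ?thesis using C by blast
  qed
  then have Ysh: "shO D n B \<in> Y" if "B \<in> Y" for B n
    using shift_closedI[OF 1(1) 2(5)] that by blast
  have co: "coaisle D Y = Y" using coaisle_shift_closed[OF 1(1)] Ysh by blast
  have biprod: "\<exists>A \<in> S. \<exists>B \<in> W. \<exists>a b p q. biproduct A B M a b p q"
    if t: "t_truncation D S W M f g h" and f: "is_section D f" for S W M f g h
  proof -
    have t': "(f, g, h) \<in> Tri D" and ST: "src D f \<in> S" "tgt D f = M" "tgt D g \<in> W"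
      using t by (auto simp: t_truncation_def)
    obtain A M' B where fg: "f \<in> Hom D A M'" "g \<in> Hom D M' B" using TriE[OF t'] .
    have M': "M' = M" "A \<in> S" "B \<in> W" using fg ST by (auto simp: Hom_iff)
    obtain r where "r \<in> Hom D M A" "r \<cdot> f = ide D A"
      using f fg M' unfolding is_section_def by (auto simp: Hom_iff)
    then show ?thesis using Tri_section_biproduct[OF t'] fg M' by metis
  qed
  have decX: "\<exists>A \<in> X. \<exists>B \<in> Y. \<exists>a b p q. biproduct A B M a b p q" if M: "M \<in> Obj D" for M
  proof -
    obtain f g h where "t_truncation D X (coaisle D Y) M f g h" using 1(6)[OF M] by blast
    then show ?thesis using biprod[of X Y M f g h] sX M unfolding t_structure_splits_def co by blast
  qed
  have decY: "\<exists>B \<in> Y. \<exists>C \<in> V. \<exists>a b p q. biproduct B C M a b p q" if M: "M \<in> Obj D" for M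
  proof -
    obtain f g h where "t_truncation D Y V M f g h" using 2(7)[OF M] by blast
    then show ?thesis using biprod[of Y V M f g h] sY M unfolding t_structure_splits_def V_def by blast
  qed
  \<comment> \<open>Both \<open>X\<close> and \<open>V\<close> consist of the objects without nonzero summand in \<open>Y\<close>.\<close>
  have "X \<subseteq> V"
  proof
    fix M assume M: "M \<in> X"
    have MO: "M \<in> Obj D" using full_iso_closedD(1)[OF 1(2) M] .
    obtain B C a b p q where m: "B \<in> Y" "C \<in> V" "biproduct B C M a b p q" using decY[OF MO] by blast
    have "hom_vanishes D M B" using 1(3)[OF M] m(1) co by blast
    then have "isomorphic_in D C M" using biproduct_absorb(1)[OF biproduct_sym[OF m(3)]] by blast
    then show "M \<in> V" using full_iso_closedD(2)[OF 2(3) m(2) MO] by blast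
  qed
  moreover have "V \<subseteq> X"
  proof
    fix M assume M: "M \<in> V"
    have MO: "M \<in> Obj D" using full_iso_closedD(1)[OF 2(3) M] .
    obtain A B a b p q where m: "A \<in> X" "B \<in> Y" "biproduct A B M a b p q" using decX[OF MO] by blast
    have "hom_vanishes D B M" using 2(4)[OF m(2) M] .
    then have "isomorphic_in D A M" using biproduct_absorb(1)[OF m(3)] by blast
    then show "M \<in> X" using full_iso_closedD(2)[OF 1(2) m(1) MO] by blast
  qed
  ultimately have XV: "X = V" by blast
  have XO: "X \<subseteq> Obj D" using 1(2) by (auto simp: full_iso_closed_subcat_def)
  have Xsh: "shO D n A \<in> X" if "A \<in> X" for A n
    using shift_closedI[OF XO 1(4) _ that] 2(6) XV by blast
  have "Z = X"
  proof
    show "Z \<subseteq> X"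
    proof
      fix A assume A: "A \<in> Z"
      then have "shO D (-1) A \<in> X" unfolding XV V_def coaisle_def by blast
      then show "A \<in> X" using Xsh[of "shO D (-1) A" 1] shO_inv(1)[of A 1] A 2(1) by auto
    qed
    show "X \<subseteq> Z"
    proof
      fix A assume A: "A \<in> X"
      then have "shO D (-1) A \<in> V" using Xsh XV by blast
      then obtain C where C: "C \<in> Z" "shO D (-1) A = shO D (-1) C" unfolding V_def coaisle_def by blast
      then have "A = C" using unsh XO A 2(1) by blast
      then show "A \<in> Z" using C by blast
    qed
  qed
  moreover have "orthogonal_split X Y"
    unfolding orthogonal_split_def
    using 1(2) 2(2) Xsh Ysh 1(3) 2(4) decX unfolding co XV[symmetric] by blast
  ultimately show "Z = X \<and> orthogonal_split X Y" by blast
qed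

section \<open>Splitting by orthogonal summands of the generators\<close>

lemma biproduct_shift:
  assumes "biproduct A B M a b p q"
  shows "biproduct (shO D n A) (shO D n B) (shO D n M) (shA D n a) (shA D n b) (shA D n p) (shA D n q)"
proof -
  note bp = biproductD[OF assms]
  have "addA D (shA D n (a \<cdot> p)) (shA D n (b \<cdot> q)) = ide D (shO D n M)"
    using sh_add[OF comp_Hom[OF bp(6,4)] comp_Hom[OF bp(7,5)], of n] bp(12) sh_ide[OF bp(3), of n] by simp
  then have 1: "addA D (shA D n a \<cdot> shA D n p) (shA D n b \<cdot> shA D n q) = ide D (shO D n M)"
    using sh_comp[OF bp(6,4), of n] sh_comp[OF bp(7,5), of n] by simp
  have 2: "shA D n p \<cdot> shA D n a = ide D (shO D n A)" "shA D n q \<cdot> shA D n b = ide D (shO D n B)"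
    "shA D n p \<cdot> shA D n b = zeroA D (shO D n B) (shO D n A)"
    "shA D n q \<cdot> shA D n a = zeroA D (shO D n A) (shO D n B)"
    using sh_comp[OF bp(4,6), of n] sh_comp[OF bp(5,7), of n] sh_comp[OF bp(5,6), of n]
      sh_comp[OF bp(4,7), of n] bp sh_ide shA_zeroA by auto
  show ?thesis
    unfolding biproduct_def using 1 2 bp(1-3) sh_Obj sh_Hom[OF bp(4)] sh_Hom[OF bp(5)]
      sh_Hom[OF bp(6)] sh_Hom[OF bp(7)] by simp
qed

lemma perp_iso_closed: "full_iso_closed_subcat D (Obj D) (perp K H)"
  unfolding full_iso_closed_subcat_def
proof (intro conjI ballI impI)
  show "perp K H \<subseteq> Obj D" using perp_Obj by blast
  fix X Y assume X: "X \<in> perp K H" and Y: "Y \<in> Obj D" and "isomorphic_in D X Y"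
  then obtain f g where f: "f \<in> Hom D X Y" and g: "g \<in> Hom D Y X" "f \<cdot> g = ide D Y"
    unfolding isomorphic_in_def is_iso_arr_def by (auto simp: Hom_iff)
  have "hom_vanishes D (shO D n (H k)) Y" if k: "k \<in> K" for k n
  proof -
    have v: "hom_vanishes D (shO D n (H k)) X" using perp_vanishes[OF X k] .
    have "Hom D (shO D n (H k)) X \<noteq> {}" using v by (simp add: hom_vanishes_def)
    then have HO: "shO D n (H k) \<in> Obj D" using Hom_Obj by blast
    have "x = zeroA D (shO D n (H k)) Y" if x: "x \<in> Hom D (shO D n (H k)) Y" for x
    proof -
      have "g \<cdot> x = zeroA D (shO D n (H k)) X" using v comp_Hom[OF x g(1)] by (simp add: hom_vanishes_def)
      moreover have "x = f \<cdot> (g \<cdot> x)" using comp_assoc[OF x g(1) f] g(2) comp_ide_left[OF x] by simp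
      ultimately show ?thesis using comp_zero_right[OF f HO] by simp
    qed
    then show ?thesis using hom_vanishes_iff HO Y by blast
  qed
  then show "Y \<in> perp K H" using Y by (simp add: perp_def)
qed

text \<open>Arrows from \<open>perp I B\<close> to \<open>perp I A\<close> vanish because \<open>perp I B\<close> is generated by the \<open>A\<^sub>i\<close>: the
  cone of a cellular approximation by the \<open>A\<^sub>i\<close> is orthogonal to both families.\<close>

lemma perp_orthogonal:
  assumes u: "universe TYPE('u)" and c: "has_small_coproducts TYPE('u) D" and I: "small TYPE('u) I"
    and fsA: "\<And>i. i \<in> I \<Longrightarrow> finitely_supporting TYPE('u) (A i)"
    and fsB: "\<And>i. i \<in> I \<Longrightarrow> finitely_supporting TYPE('u) (B i)"
    and sm: "\<And>i n N. i \<in> I \<Longrightarrow> N \<in> Obj D \<Longrightarrow> small TYPE('u) (Hom D (shO D n (A i)) N)"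
    and AB: "\<And>i. i \<in> I \<Longrightarrow> A i \<in> perp I B"
    and zero: "\<And>M. M \<in> perp I A \<Longrightarrow> M \<in> perp I B \<Longrightarrow> is_zero_object D M"
    and X: "X \<in> perp I B" and Y: "Y \<in> perp I A"
  shows "hom_vanishes D X Y"
proof -
  have AO: "A i \<in> Obj D" if "i \<in> I" for i using fsA finitely_supporting_Obj that by blast
  let ?O = "{N \<in> Obj D. \<forall>Y \<in> perp I A. hom_vanishes D N Y}"
  have LB: "localizing TYPE('u) (perp I B)" using perp_localizing[OF fsB] .
  have LO: "localizing TYPE('u) ?O"
    using left_orthogonal_localizing[of "perp I A"] perp_Obj perp_shift AO by blast
  have AO': "A i \<in> ?O" if i: "i \<in> I" for i
    using perp_vanishes[OF _ i, of _ A 0] shO_0[OF AO[OF i]] AO[OF i] by auto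
  obtain T Q f g h where t: "(f, g, h) \<in> Tri D" "f \<in> Hom D T X" "g \<in> Hom D X Q"
    and T: "T \<in> perp I B \<inter> ?O" and Q: "Q \<in> perp I A"
    by (rule cellular_approximation[OF u c I localizing_Int[OF LB LO] _ fsA sm perp_Obj[OF X]])
      (use AB AO' in blast)+
  have "Q \<in> perp I B" using localizing_cone[OF LB t _ X] T by blast
  then have Q0: "is_zero_object D Q" using zero Q by blast
  have YO: "Y \<in> Obj D" and XO: "X \<in> Obj D" using X Y perp_Obj by blast+
  have "e = zeroA D X Y" if e: "e \<in> Hom D X Y" for e
  proof -
    have "hom_vanishes D T Y" using T Y by blast
    then have "e \<cdot> f = zeroA D T Y" using comp_Hom[OF t(2) e] by (simp add: hom_vanishes_def)
    then obtain s where s: "s \<in> Hom D Q Y" "s \<cdot> g = e" using Tri_weak_cokernel[OF t e] by blast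
    then show ?thesis using zero_object_Hom(2)[OF Q0 s(1)] comp_zero_left[OF t(3) YO] by simp
  qed
  then show ?thesis using hom_vanishes_iff XO YO by blast
qed

text \<open>The cellular approximation of \<open>M\<close> by the \<open>A\<^sub>i\<close> is a triangle from \<open>perp I B\<close> to \<open>perp I A\<close>; its
  connecting arrow goes from the second class to the first and so vanishes.\<close>

lemma perp_split:
  assumes u: "universe TYPE('u)" and c: "has_small_coproducts TYPE('u) D" and I: "small TYPE('u) I"
    and fs: "\<And>i. i \<in> I \<Longrightarrow> finitely_supporting TYPE('u) (G i)"
    and sm: "\<And>i n N. i \<in> I \<Longrightarrow> N \<in> Obj D \<Longrightarrow> small TYPE('u) (Hom D (shO D n (G i)) N)"
    and gen: "\<And>M. M \<in> perp I G \<Longrightarrow> is_zero_object D M"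
    and bp: "\<And>i. i \<in> I \<Longrightarrow> biproduct (A i) (B i) (G i) (a i) (b i) (p i) (q i)"
    and orth: "\<And>i j n. i \<in> I \<Longrightarrow> j \<in> I \<Longrightarrow> hom_vanishes D (A i) (shO D n (B j))"
      "\<And>i j n. i \<in> I \<Longrightarrow> j \<in> I \<Longrightarrow> hom_vanishes D (B i) (shO D n (A j))"
  shows "orthogonal_split (perp I B) (perp I A)" "\<And>i. i \<in> I \<Longrightarrow> A i \<in> perp I B" "\<And>i. i \<in> I \<Longrightarrow> B i \<in> perp I A"
proof -
  have fsA: "finitely_supporting TYPE('u) (A i)" and fsB: "finitely_supporting TYPE('u) (B i)"
    if "i \<in> I" for i
    using finitely_supporting_retract[OF fs[OF that]] biproductD[OF bp[OF that]] by blast+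
  have AO: "A i \<in> Obj D" and BO: "B i \<in> Obj D" if "i \<in> I" for i
    using biproductD[OF bp[OF that]] by blast+
  \<comment> \<open>Arrows out of a retract embed into arrows out of the whole object.\<close>
  have smretr: "small TYPE('u) (Hom D X N)"
    if "small TYPE('u) (Hom D Y N)" "s \<in> Hom D X Y" "r \<in> Hom D Y X" "r \<cdot> s = ide D X" for X Y N s r
  proof (rule small_inj[OF _ _ that(1)])
    have e: "(f \<cdot> r) \<cdot> s = f" if "f \<in> Hom D X N" for f
      using that \<open>s \<in> _\<close> \<open>r \<in> _\<close> \<open>r \<cdot> s = _\<close> comp_assoc[of s X Y r X f N] comp_ide_right by simp
    show "inj_on (\<lambda>f. f \<cdot> r) (Hom D X N)"
    proof (rule inj_onI)
      fix f g assume "f \<in> Hom D X N" "g \<in> Hom D X N" "f \<cdot> r = g \<cdot> r"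
      then have "f \<in> Hom D X N" "g \<in> Hom D X N" "(f \<cdot> r) \<cdot> s = (g \<cdot> r) \<cdot> s" by simp_all
      then show "f = g" by (simp only: e)
    qed
    show "(\<lambda>f. f \<cdot> r) ` Hom D X N \<subseteq> Hom D Y N" using comp_Hom[OF that(3)] by auto
  qed
  have smA: "small TYPE('u) (Hom D (shO D n (A i)) N)" and smB: "small TYPE('u) (Hom D (shO D n (B i)) N)"
    if "i \<in> I" "N \<in> Obj D" for i n N
    using smretr[OF sm[OF that, of n]] biproductD[OF biproduct_shift[OF bp[OF that(1)], of n]] by simp_all
  show AB: "A i \<in> perp I B" if i: "i \<in> I" for i
    using orth(2)[OF _ i] hom_vanishes_shift_left[OF BO AO[OF i]] AO[OF i] by (auto simp: perp_def)
  show BA: "B i \<in> perp I A" if i: "i \<in> I" for i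
    using orth(1)[OF _ i] hom_vanishes_shift_left[OF AO BO[OF i]] BO[OF i] by (auto simp: perp_def)
  have zero: "is_zero_object D M" if M: "M \<in> perp I A" "M \<in> perp I B" for M
  proof (rule gen)
    have "hom_vanishes D (shO D n (G i)) M" if i: "i \<in> I" for i n
    proof -
      note g = biproduct_shift[OF bp[OF i], of n]
      note bp = biproductD[OF g]
      have MO: "M \<in> Obj D" using M perp_Obj by blast
      have "f = zeroA D (shO D n (G i)) M" if f: "f \<in> Hom D (shO D n (G i)) M" for f
      proof (rule biproduct_ext_source[OF g f])
        show "zeroA D (shO D n (G i)) M \<in> Hom D (shO D n (G i)) M" using zeroA_Hom bp MO by blast
        show "f \<cdot> shA D n (a i) = zeroA D (shO D n (G i)) M \<cdot> shA D n (a i)"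
          using comp_Hom[OF bp(4) f] perp_vanishes[OF M(1) i, of n] comp_zero_left[OF bp(4) MO]
          by (simp add: hom_vanishes_def)
        show "f \<cdot> shA D n (b i) = zeroA D (shO D n (G i)) M \<cdot> shA D n (b i)"
          using comp_Hom[OF bp(5) f] perp_vanishes[OF M(2) i, of n] comp_zero_left[OF bp(5) MO]
          by (simp add: hom_vanishes_def)
      qed
      then show ?thesis using hom_vanishes_iff bp MO by blast
    qed
    then show "M \<in> perp I G" using M by (simp add: perp_def)
  qed
  have BAorth: "hom_vanishes D X Y" if "X \<in> perp I B" "Y \<in> perp I A" for X Y
    by (rule perp_orthogonal[OF u c I fsA fsB smA AB zero that])
  have ABorth: "hom_vanishes D Y X" if "X \<in> perp I B" "Y \<in> perp I A" for X Y
    by (rule perp_orthogonal[OF u c I fsB fsA smB BA zero that(2,1)])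
  have "\<exists>X \<in> perp I B. \<exists>Y \<in> perp I A. \<exists>a b p q. biproduct X Y M a b p q" if M: "M \<in> Obj D" for M
  proof -
    obtain T Q f g h where t: "(f, g, h) \<in> Tri D" "f \<in> Hom D T M" "g \<in> Hom D M Q"
      and T: "T \<in> perp I B" and Q: "Q \<in> perp I A"
      by (rule cellular_approximation[OF u c I perp_localizing[OF fsB] AB fsA smA M])
    have "hom_vanishes D Q (shO D 1 T)" using ABorth[OF perp_shift[OF T BO] Q] .
    then have "h = zeroA D Q (shO D 1 T)" using TriD[OF t] by (simp add: hom_vanishes_def)
    then obtain r where "r \<in> Hom D M T" "r \<cdot> f = ide D T" using Tri_zero_imp_section[OF t] by blast
    then show ?thesis using Tri_section_biproduct[OF t] T Q by metis
  qed
  moreover have "shO D n X \<in> perp I A" if "X \<in> perp I A" for X n using that AO by (rule perp_shift)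
  moreover have "shO D n X \<in> perp I B" if "X \<in> perp I B" for X n using that BO by (rule perp_shift)
  ultimately show "orthogonal_split (perp I B) (perp I A)"
    unfolding orthogonal_split_def using perp_iso_closed[of I A] perp_iso_closed[of I B] ABorth BAorth by simp
qed

section \<open>The additive closure\<close>

lemma add_closureI:
  fixes n :: nat
  assumes "\<And>j. j < n \<Longrightarrow> k j \<in> I" "is_coproduct D {..<n} (\<lambda>j. G (k j)) P \<iota>"
    "s \<in> Hom D M P" "r \<in> Hom D P M" "r \<cdot> s = ide D M"
  shows "M \<in> add_closure D I G"
proof -
  obtain N b v where m: "biproduct M N P s b r v" using section_biproduct[OF assms(3-5)] .
  show ?thesis
    unfolding add_closure_def
    using assms(1,2) biproductD(1,2)[OF m] biproduct_imp_coproduct2[OF m]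
    by (intro CollectI conjI exI[of _ n] exI[of _ k] exI[of _ P] exI[of _ \<iota>] bexI[of _ N]
        exI[of _ s] exI[of _ b]) auto
qed

lemma generator_in_add_closure:
  assumes i: "i \<in> I" and G: "G i \<in> Obj D"
  shows "G i \<in> add_closure D I G"
proof -
  have id: "ide D (G i) \<in> Hom D (G i) (G i)" using ide_Hom[OF G] .
  have P: "is_coproduct D {..<1 :: nat} (\<lambda>r. G i) (G i) (\<lambda>r. ide D (G i))"
    unfolding is_coproduct_def
  proof (intro conjI ballI allI impI G id)
    fix T f assume "\<forall>j\<in>{..<1 :: nat}. f j \<in> Hom D (G i) T"
    then have f: "f 0 \<in> Hom D (G i) T" by simp
    show "\<exists>!h. h \<in> Hom D (G i) T \<and> (\<forall>j\<in>{..<1 :: nat}. h \<cdot> ide D (G i) = f j)"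
      using f comp_ide_right by (intro ex1I[of _ "f 0"]) auto
  qed
  show ?thesis
    by (rule add_closureI[where n = 1 and k = "\<lambda>_. i" and G = G and I = I, OF _ P id id comp_ide_left[OF id]])
      (use i in auto)
qed

lemma add_closureE:
  assumes "M \<in> add_closure D I G"
  obtains n :: nat and k P \<iota> s r where "M \<in> Obj D" "\<And>j. j < n \<Longrightarrow> k j \<in> I"
    "is_coproduct D {..<n} (\<lambda>j. G (k j)) P \<iota>" "s \<in> Hom D M P" "r \<in> Hom D P M" "r \<cdot> s = ide D M"
proof -
  obtain n k P \<iota> N a b where M: "M \<in> Obj D" and k: "\<forall>r < (n :: nat). k r \<in> I"
    and P: "is_coproduct D {..<n} (\<lambda>r. G (k r)) P \<iota>" and N: "N \<in> Obj D"
    and c: "is_coproduct2 D M N P a b"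
    using assms unfolding add_closure_def by blast
  obtain p q where "biproduct M N P a b p q" using coproduct2_imp_biproduct[OF c M N] .
  then show ?thesis using that[OF M _ P biproductD(4,6,8)] k by blast
qed

lemma add_closure_retract:
  assumes M: "M \<in> add_closure D I G" and s: "s \<in> Hom D M' M" and r: "r \<in> Hom D M M'" "r \<cdot> s = ide D M'"
  shows "M' \<in> add_closure D I G"
proof -
  obtain n :: nat and k P \<iota> s' r' where "M \<in> Obj D" and k: "\<And>j. j < n \<Longrightarrow> k j \<in> I"
    and P: "is_coproduct D {..<n} (\<lambda>j. G (k j)) P \<iota>"
    and s': "s' \<in> Hom D M P" "r' \<in> Hom D P M" "r' \<cdot> s' = ide D M"
    by (rule add_closureE[OF M]) blast
  have "(r \<cdot> r') \<cdot> (s' \<cdot> s) = r \<cdot> ((r' \<cdot> s') \<cdot> s)" using s r(1) s'(1,2) by (simp add: arr)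
  then have "(r \<cdot> r') \<cdot> (s' \<cdot> s) = ide D M'" using s'(3) r(2) comp_ide_left[OF s] by simp
  then show ?thesis using add_closureI[OF k P comp_Hom[OF s s'(1)] comp_Hom[OF s'(2) r(1)]] by blast
qed

section \<open>TTF triples and decompositions of the additive closure\<close>

lemma hom_vanishes_biproduct:
  assumes m: "biproduct A B M a b p q" and v: "hom_vanishes D A N" "hom_vanishes D B N" and N: "N \<in> Obj D"
  shows "hom_vanishes D M N"
proof -
  note bp = biproductD[OF m]
  have "f = zeroA D M N" if f: "f \<in> Hom D M N" for f
  proof (rule biproduct_ext_source[OF m f])
    show "zeroA D M N \<in> Hom D M N" using zeroA_Hom bp N by blast
    show "f \<cdot> a = zeroA D M N \<cdot> a"
      using comp_Hom[OF bp(4) f] v(1) comp_zero_left[OF bp(4) N] by (simp add: hom_vanishes_def)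
    show "f \<cdot> b = zeroA D M N \<cdot> b"
      using comp_Hom[OF bp(5) f] v(2) comp_zero_left[OF bp(5) N] by (simp add: hom_vanishes_def)
  qed
  then show ?thesis using hom_vanishes_iff bp N by blast
qed

lemma hom_vanishes_retract_target:
  assumes "hom_vanishes D X M" and b: "b \<in> Hom D B M" and q: "q \<in> Hom D M B" "q \<cdot> b = ide D B"
    and X: "X \<in> Obj D"
  shows "hom_vanishes D X B"
proof -
  have "f = zeroA D X B" if f: "f \<in> Hom D X B" for f
  proof -
    have "b \<cdot> f = zeroA D X M" using comp_Hom[OF f b] assms(1) by (simp add: hom_vanishes_def)
    then have "q \<cdot> (b \<cdot> f) = zeroA D X B" using comp_zero_right[OF q(1) X] by simp
    then show ?thesis using comp_assoc[OF f b q(1)] q(2) comp_ide_left[OF f] by simp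
  qed
  then show ?thesis using hom_vanishes_iff X Hom_Obj[OF b] by blast
qed

text \<open>The decomposition of an object of the additive closure stays in the additive closure, which is
  closed under retracts.\<close>

lemma orthogonal_split_restricts:
  assumes S: "orthogonal_split X Y"
  shows "(X \<inter> add_closure D I G, Y \<inter> add_closure D I G) \<in> graded_orthogonal_decompositions D (add_closure D I G)"
proof -
  note s = orthogonal_splitD[OF S]
  let ?C = "add_closure D I G"
  have CO: "?C \<subseteq> Obj D" unfolding add_closure_def by blast
  have "full_iso_closed_subcat D ?C (X \<inter> ?C)" "full_iso_closed_subcat D ?C (Y \<inter> ?C)"
    using s(1,2) CO unfolding full_iso_closed_subcat_def by blast+
  moreover have "\<exists>A \<in> X \<inter> ?C. \<exists>B \<in> Y \<inter> ?C. \<exists>a b. is_coproduct2 D A B M a b" if M: "M \<in> ?C" for M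
  proof -
    obtain A B a b p q where m: "A \<in> X" "B \<in> Y" "biproduct A B M a b p q"
      using orthogonal_splitE[OF S] M CO by blast
    note bp = biproductD[OF m(3)]
    have "A \<in> ?C" "B \<in> ?C" using add_closure_retract[OF M] bp by blast+
    then show ?thesis using m biproduct_imp_coproduct2[OF m(3)] by blast
  qed
  ultimately show ?thesis
    unfolding graded_orthogonal_decompositions_def two_decomposition_def using s by auto
qed

text \<open>An orthogonal splitting is recovered from its restriction: the summand in \<open>Y\<close> of an object \<open>M\<close>
  is detected by the generators, hence by their summands in \<open>Y\<close>.\<close>

lemma orthogonal_split_eq:
  assumes S: "orthogonal_split X Y" and gen: "\<And>M. M \<in> perp I G \<Longrightarrow> is_zero_object D M"
    and G: "\<And>i. i \<in> I \<Longrightarrow> G i \<in> Obj D"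
  shows "X = {M \<in> Obj D. \<forall>N \<in> Y \<inter> add_closure D I G. \<forall>n. hom_vanishes D (shO D n N) M}" (is "X = ?X")
proof
  note s = orthogonal_splitD[OF S]
  show "X \<subseteq> ?X" using s by blast
  show "?X \<subseteq> X"
  proof
    fix M assume M: "M \<in> ?X"
    then have MO: "M \<in> Obj D" by blast
    obtain A B a b p q where m: "A \<in> X" "B \<in> Y" "biproduct A B M a b p q"
      using orthogonal_splitE[OF S MO] .
    note bp = biproductD[OF m(3)]
    have "hom_vanishes D (shO D n (G i)) B" if i: "i \<in> I" for i n
    proof -
      obtain A' B' a' b' p' q' where m': "A' \<in> X" "B' \<in> Y" "biproduct A' B' (G i) a' b' p' q'"
        using orthogonal_splitE[OF S G[OF i]] .
      note bp' = biproductD[OF m'(3)]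
      have B': "B' \<in> add_closure D I G"
        using add_closure_retract[OF generator_in_add_closure[of i I G, OF i G[OF i]] bp'(5,7,9)] .
      have "hom_vanishes D (shO D n B') M" using M m'(2) B' by blast
      then have "hom_vanishes D (shO D n B') B"
        using hom_vanishes_retract_target[OF _ bp(5,7,9)] sh_Obj bp' by blast
      moreover have "hom_vanishes D (shO D n A') B" using s(5)[OF s(3)[OF m'(1)] m(2)] .
      ultimately show ?thesis using hom_vanishes_biproduct[OF biproduct_shift[OF m'(3)]] bp by blast
    qed
    then have "B \<in> perp I G" using bp by (simp add: perp_def)
    then have "ide D B = zeroA D B B" using gen is_zero_object_iff bp by blast
    then show "M \<in> X"
      using full_iso_closedD(2)[OF s(1) m(1) MO biproduct_trivial_iso[OF m(3)]] by blast
  qed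
qed

lemma decomposition_summands:
  assumes C: "(C1, C2) \<in> graded_orthogonal_decompositions D (add_closure D I G)"
    and G: "\<And>i. i \<in> I \<Longrightarrow> G i \<in> Obj D"
  obtains A B a b p q where "\<And>i. i \<in> I \<Longrightarrow> A i \<in> C1" "\<And>i. i \<in> I \<Longrightarrow> B i \<in> C2"
    "\<And>i. i \<in> I \<Longrightarrow> biproduct (A i) (B i) (G i) (a i) (b i) (p i) (q i)"
proof -
  have CO: "C1 \<subseteq> Obj D" "C2 \<subseteq> Obj D"
    and dec: "\<And>M. M \<in> add_closure D I G \<Longrightarrow> \<exists>A \<in> C1. \<exists>B \<in> C2. \<exists>a b. is_coproduct2 D A B M a b"
    using C unfolding graded_orthogonal_decompositions_def two_decomposition_def full_iso_closed_subcat_def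
      add_closure_def by auto
  have "\<exists>A B a b p q. A \<in> C1 \<and> B \<in> C2 \<and> biproduct A B (G i) a b p q" if i: "i \<in> I" for i
  proof -
    obtain A B a b where AB: "A \<in> C1" "B \<in> C2" "is_coproduct2 D A B (G i) a b"
      using dec[OF generator_in_add_closure[of i I G, OF i G[OF i]]] by blast
    obtain p q where "biproduct A B (G i) a b p q"
      by (rule coproduct2_imp_biproduct[OF AB(3)]) (use CO AB in blast)+
    then show ?thesis using AB by blast
  qed
  then obtain A B a b p q where
    "\<forall>i \<in> I. A i \<in> C1 \<and> B i \<in> C2 \<and> biproduct (A i) (B i) (G i) (a i) (b i) (p i) (q i)"
    by metis
  then show ?thesis using that by blast
qed

text \<open>An object of \<open>perp I B\<close> in the additive closure decomposes into parts in \<open>C1\<close> and \<open>C2\<close>. The part in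
  \<open>C2\<close> receives nothing from the \<open>A i\<close> by orthogonality and nothing from the \<open>B i\<close> as a summand, so it is
  zero.\<close>

lemma perp_restricts:
  assumes C: "(C1, C2) \<in> graded_orthogonal_decompositions D (add_closure D I G)"
    and gen: "\<And>M. M \<in> perp I G \<Longrightarrow> is_zero_object D M"
    and A: "\<And>i. i \<in> I \<Longrightarrow> A i \<in> C1" and B: "\<And>i. i \<in> I \<Longrightarrow> B i \<in> C2"
    and bp: "\<And>i. i \<in> I \<Longrightarrow> biproduct (A i) (B i) (G i) (a i) (b i) (p i) (q i)"
  shows "perp I B \<inter> add_closure D I G = C1"
proof
  let ?C = "add_closure D I G"
  have CO: "C1 \<subseteq> ?C" "C2 \<subseteq> ?C" "?C \<subseteq> Obj D"
    and iso: "full_iso_closed_subcat D ?C C1"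
    and dec: "\<And>M. M \<in> ?C \<Longrightarrow> \<exists>A \<in> C1. \<exists>B \<in> C2. \<exists>a b. is_coproduct2 D A B M a b"
    and orth: "\<And>M N n. M \<in> C1 \<Longrightarrow> N \<in> C2 \<Longrightarrow> hom_vanishes D M (shO D n N)"
      "\<And>M N n. M \<in> C1 \<Longrightarrow> N \<in> C2 \<Longrightarrow> hom_vanishes D N (shO D n M)"
    using C unfolding graded_orthogonal_decompositions_def two_decomposition_def full_iso_closed_subcat_def
      add_closure_def by auto
  have left: "hom_vanishes D (shO D n N) M" "hom_vanishes D (shO D n M) N" if "M \<in> C1" "N \<in> C2" for M N n
  proof -
    have "M \<in> Obj D" "N \<in> Obj D" using that CO by blast+
    then show "hom_vanishes D (shO D n N) M" "hom_vanishes D (shO D n M) N"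
      using orth[OF that] by (simp_all add: hom_vanishes_shift_left)
  qed
  show "C1 \<subseteq> perp I B \<inter> ?C" using left(1) B CO unfolding perp_def by blast
  show "perp I B \<inter> ?C \<subseteq> C1"
  proof
    fix M assume M: "M \<in> perp I B \<inter> ?C"
    then obtain A' B' a' b' where m: "A' \<in> C1" "B' \<in> C2" "is_coproduct2 D A' B' M a' b'" using dec by blast
    obtain p' q' where m': "biproduct A' B' M a' b' p' q'"
      by (rule coproduct2_imp_biproduct[OF m(3)]) (use CO m in blast)+
    note bp' = biproductD[OF m']
    have "hom_vanishes D (shO D n (G i)) B'" if i: "i \<in> I" for i n
    proof -
      have m: "biproduct (shO D n (A i)) (shO D n (B i)) (shO D n (G i)) (shA D n (a i)) (shA D n (b i))
          (shA D n (p i)) (shA D n (q i))"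
        using biproduct_shift[OF bp[OF i]] .
      have "hom_vanishes D (shO D n (B i)) M" using M perp_vanishes[OF _ i] by blast
      then have "hom_vanishes D (shO D n (B i)) B'"
        using hom_vanishes_retract_target[OF _ bp'(5,7,9)] biproductD(2)[OF m] by blast
      moreover have "hom_vanishes D (shO D n (A i)) B'" using left(2)[OF A[OF i] \<open>B' \<in> C2\<close>] .
      ultimately show ?thesis using hom_vanishes_biproduct[OF m] bp' by blast
    qed
    then have "B' \<in> perp I G" using bp' by (simp add: perp_def)
    then have "ide D B' = zeroA D B' B'" using gen is_zero_object_iff bp' by blast
    then have "isomorphic_in D A' M" using biproduct_trivial_iso[OF m'] by blast
    then show "M \<in> C1" using full_iso_closedD(2)[OF iso m(1)] M by blast
  qed
qed

lemma graded_orthogonal_decompositions_swap: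
  assumes "(C1, C2) \<in> graded_orthogonal_decompositions D C" "C \<subseteq> Obj D"
  shows "(C2, C1) \<in> graded_orthogonal_decompositions D C"
proof -
  have dec: "\<forall>M \<in> C. \<exists>A \<in> C1. \<exists>B \<in> C2. \<exists>a b. is_coproduct2 D A B M a b"
    and CO: "C1 \<subseteq> Obj D" "C2 \<subseteq> Obj D"
    using assms unfolding graded_orthogonal_decompositions_def two_decomposition_def
      full_iso_closed_subcat_def by auto
  have "\<exists>B \<in> C2. \<exists>A \<in> C1. \<exists>b a. is_coproduct2 D B A M b a" if M: "M \<in> C" for M
  proof -
    obtain A B a b where m: "A \<in> C1" "B \<in> C2" "is_coproduct2 D A B M a b" using dec M by blast
    obtain p q where "biproduct A B M a b p q"
      by (rule coproduct2_imp_biproduct[OF m(3)]) (use CO m in blast)+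
    then show ?thesis using biproduct_imp_coproduct2[OF biproduct_sym] m by blast
  qed
  then show ?thesis
    using assms(1) unfolding graded_orthogonal_decompositions_def two_decomposition_def by auto
qed

section \<open>Decompositions and central idempotents\<close>

text \<open>The value does not depend on the chosen biproduct: by orthogonality the summands of one
  decomposition map into the corresponding summands of any other.\<close>

lemma component_idempotent_eq:
  assumes orth: "\<And>X Y. X \<in> C1 \<Longrightarrow> Y \<in> C2 \<Longrightarrow> hom_vanishes D X Y" "\<And>X Y. X \<in> C1 \<Longrightarrow> Y \<in> C2 \<Longrightarrow> hom_vanishes D Y X"
    and CO: "C1 \<subseteq> Obj D" "C2 \<subseteq> Obj D"
    and m: "biproduct A B M a b p q" "A \<in> C1" "B \<in> C2"
  shows "component_idempotent D C1 C2 M = a \<cdot> p"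
  unfolding component_idempotent_def
proof (rule the_equality)
  note bp = biproductD[OF m(1)]
  have e: "a \<cdot> p \<in> Hom D M M" using comp_Hom[OF bp(6,4)] .
  have ea: "(a \<cdot> p) \<cdot> a = a" using comp_assoc[OF bp(4) bp(6,4)] bp(8) comp_ide_right[OF bp(4)] by simp
  have eb: "(a \<cdot> p) \<cdot> b = zeroA D B M"
    using comp_assoc[OF bp(5) bp(6,4)] bp(10) comp_zero_right[OF bp(4) bp(2)] by simp
  show "a \<cdot> p \<in> Hom D M M \<and> (\<exists>X\<in>C1. \<exists>Y\<in>C2. \<exists>a' b'. is_coproduct2 D X Y M a' b' \<and>
      (a \<cdot> p) \<cdot> a' = a' \<and> (a \<cdot> p) \<cdot> b' = zeroA D Y M)"
    using e ea eb m(2,3) biproduct_imp_coproduct2[OF m(1)] by blast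
  fix f assume "f \<in> Hom D M M \<and> (\<exists>X\<in>C1. \<exists>Y\<in>C2. \<exists>a' b'. is_coproduct2 D X Y M a' b' \<and>
      f \<cdot> a' = a' \<and> f \<cdot> b' = zeroA D Y M)"
  then obtain X Y a' b' where f: "f \<in> Hom D M M" and XY: "X \<in> C1" "Y \<in> C2" "is_coproduct2 D X Y M a' b'"
    and fa: "f \<cdot> a' = a'" and fb: "f \<cdot> b' = zeroA D Y M" by blast
  obtain p' q' where m': "biproduct X Y M a' b' p' q'"
    by (rule coproduct2_imp_biproduct[OF XY(3)]) (use CO XY in blast)+
  note bp' = biproductD[OF m']
  \<comment> \<open>By orthogonality the inclusion of \<open>A\<close> factors through \<open>X\<close> and that of \<open>B\<close> through \<open>Y\<close>.\<close>
  have split: "x = addA D (a' \<cdot> (p' \<cdot> x)) (b' \<cdot> (q' \<cdot> x))" if x: "x \<in> Hom D N M" for x N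
    using comp_add_left[OF x comp_Hom[OF bp'(6,4)] comp_Hom[OF bp'(7,5)]] bp'(12) comp_ide_left[OF x]
      comp_assoc[OF x bp'(6,4)] comp_assoc[OF x bp'(7,5)] by simp
  have "q' \<cdot> a = zeroA D A Y"
    using orth(1)[OF m(2) XY(2)] comp_Hom[OF bp(4) bp'(7)] by (simp add: hom_vanishes_def)
  then have a: "a' \<cdot> (p' \<cdot> a) = a"
    using split[OF bp(4)] comp_zero_right[OF bp'(5) bp(1)]
      add_zero_right[OF comp_Hom[OF comp_Hom[OF bp(4) bp'(6)] bp'(4)]] by simp
  have "p' \<cdot> b = zeroA D B X"
    using orth(2)[OF XY(1) m(3)] comp_Hom[OF bp(5) bp'(6)] by (simp add: hom_vanishes_def)
  then have b: "b' \<cdot> (q' \<cdot> b) = b"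
    using split[OF bp(5)] comp_zero_right[OF bp'(4) bp(2)]
      add_zero_left[OF comp_Hom[OF comp_Hom[OF bp(5) bp'(7)] bp'(5)]] by simp
  show "f = a \<cdot> p"
  proof (rule biproduct_ext_source[OF m(1) f e])
    have "f \<cdot> (a' \<cdot> (p' \<cdot> a)) = a' \<cdot> (p' \<cdot> a)"
      using comp_reassoc[OF fa bp'(4) f comp_Hom[OF bp(4) bp'(6)]] .
    then show "f \<cdot> a = (a \<cdot> p) \<cdot> a" using a ea by simp
    have "f \<cdot> (b' \<cdot> (q' \<cdot> b)) = zeroA D B M"
      using comp_reassoc[OF fb bp'(5) f comp_Hom[OF bp(5) bp'(7)]]
        comp_zero_left[OF comp_Hom[OF bp(5) bp'(7)] bp(3)] by simp
    then show "f \<cdot> b = (a \<cdot> p) \<cdot> b" using b eb by simp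
  qed
qed

text \<open>Centrality in the product ring is the case \<open>i = j\<close>, \<open>n = 0\<close> of the graded commutation.\<close>

lemma graded_central_idempotents_iff:
  assumes G: "G ` I \<subseteq> Obj D"
  shows "e \<in> graded_central_idempotents D I G \<longleftrightarrow>
    e \<in> (\<Pi>\<^sub>E i\<in>I. Hom D (G i) (G i)) \<and> (\<forall>i\<in>I. e i \<cdot> e i = e i) \<and>
    (\<forall>i \<in> I. \<forall>j \<in> I. \<forall>n. \<forall>f \<in> Hom D (G i) (shO D n (G j)). shA D n (e j) \<cdot> f = f \<cdot> e i)"
    (is "_ \<longleftrightarrow> ?E \<and> ?id \<and> ?nat")
proof -
  let ?R = "prod_ring I (\<lambda>i. endo_ring D (G i))"
  have carr: "carrier ?R = (\<Pi>\<^sub>E i\<in>I. Hom D (G i) (G i))" by (simp add: prod_ring_def endo_ring_def)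
  have mult: "x \<otimes>\<^bsub>?R\<^esub> y = (\<lambda>i\<in>I. x i \<cdot> y i)" for x y by (simp add: prod_ring_def endo_ring_def)
  have idem: "e \<otimes>\<^bsub>?R\<^esub> e = e \<longleftrightarrow> ?id" if E: ?E
  proof
    assume "e \<otimes>\<^bsub>?R\<^esub> e = e"
    then have "(\<lambda>i\<in>I. e i \<cdot> e i) i = e i" for i by (simp add: mult)
    then show ?id by (metis restrict_apply')
  next
    assume id: ?id
    show "e \<otimes>\<^bsub>?R\<^esub> e = e"
    proof
      fix i
      show "(e \<otimes>\<^bsub>?R\<^esub> e) i = e i"
        unfolding mult using id PiE_arb[OF E, of i] by (cases "i \<in> I") simp_all
    qed
  qed
  have central: "e \<otimes>\<^bsub>?R\<^esub> x = x \<otimes>\<^bsub>?R\<^esub> e" if E: ?E and N: ?nat and x: "x \<in> carrier ?R" for x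
    unfolding mult
  proof (rule restrict_ext)
    fix i assume i: "i \<in> I"
    have ei: "e i \<in> Hom D (G i) (G i)" and xi: "x i \<in> Hom D (G i) (G i)" using PiE_mem[OF E i] PiE_mem[OF x[unfolded carr] i] by simp_all
    have "shA D 0 (e i) \<cdot> x i = x i \<cdot> e i" using N[rule_format, OF i i, of "x i" 0] xi shO_0[of "G i"] G i by (simp add: image_subset_iff)
    then show "e i \<cdot> x i = x i \<cdot> e i" using shA_0[of "e i"] ei by (simp add: Hom_iff)
  qed
  show ?thesis
    unfolding graded_central_idempotents_def central_idempotents_def carr
    using idem central[unfolded carr] by blast
qed

lemma decomposition_to_idempotent_apply:
  assumes C: "(C1, C2) \<in> graded_orthogonal_decompositions D (add_closure D I G)"
    and i: "i \<in> I"
    and m: "biproduct A B (G i) a b p q" "A \<in> C1" "B \<in> C2"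
  shows "decomposition_to_idempotent D I G (C1, C2) i = a \<cdot> p"
proof -
  have "component_idempotent D C1 C2 (G i) = a \<cdot> p"
  proof (rule component_idempotent_eq[OF _ _ _ _ m])
    show "hom_vanishes D X Y" "hom_vanishes D Y X" if "X \<in> C1" "Y \<in> C2" for X Y
      using C that unfolding graded_orthogonal_decompositions_def two_decomposition_def by auto
    show "C1 \<subseteq> Obj D" "C2 \<subseteq> Obj D"
      using C unfolding graded_orthogonal_decompositions_def two_decomposition_def
        full_iso_closed_subcat_def add_closure_def by auto
  qed
  then show ?thesis using i by (simp add: decomposition_to_idempotent_def)
qed

text \<open>Orthogonality makes every arrow between shifted generators block diagonal, so it commutes with
  the projections onto the first blocks.\<close>

lemma decomposition_to_idempotent_graded_central:
  assumes C: "(C1, C2) \<in> graded_orthogonal_decompositions D (add_closure D I G)"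
    and G: "\<And>i. i \<in> I \<Longrightarrow> G i \<in> Obj D"
  shows "decomposition_to_idempotent D I G (C1, C2) \<in> graded_central_idempotents D I G"
proof -
  obtain A B a b p q where A: "\<And>i. i \<in> I \<Longrightarrow> A i \<in> C1" and B: "\<And>i. i \<in> I \<Longrightarrow> B i \<in> C2"
    and bp: "\<And>i. i \<in> I \<Longrightarrow> biproduct (A i) (B i) (G i) (a i) (b i) (p i) (q i)"
    using decomposition_summands[OF C G] by blast
  have GI: "G ` I \<subseteq> Obj D" using G by blast
  let ?e = "decomposition_to_idempotent D I G (C1, C2)"
  have e: "?e i = a i \<cdot> p i" if "i \<in> I" for i
    using decomposition_to_idempotent_apply[OF C that bp[OF that] A[OF that] B[OF that]] .
  have eH: "a i \<cdot> p i \<in> Hom D (G i) (G i)" if "i \<in> I" for i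
    using comp_Hom biproductD[OF bp[OF that]] by blast
  have ee: "(a i \<cdot> p i) \<cdot> (a i \<cdot> p i) = a i \<cdot> p i" if i: "i \<in> I" for i
  proof -
    note bp = biproductD[OF bp[OF i]]
    show ?thesis
      using comp_assoc[OF comp_Hom[OF bp(6,4)] bp(6,4)] comp_reassoc[OF bp(8,4,6,6)] comp_ide_left[OF bp(6)]
      by simp
  qed
  have nat: "shA D n (a j \<cdot> p j) \<cdot> f = f \<cdot> (a i \<cdot> p i)"
    if i: "i \<in> I" and j: "j \<in> I" and f: "f \<in> Hom D (G i) (shO D n (G j))" for i j n f
  proof -
    have orth: "hom_vanishes D (A i) (shO D n (B j))" "hom_vanishes D (B i) (shO D n (A j))"
      using C A B i j unfolding graded_orthogonal_decompositions_def by auto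
    note bi = biproductD[OF bp[OF i]]
    note mj = biproduct_shift[OF bp[OF j], of n]
    note bj = biproductD[OF mj]
    have ei: "a i \<cdot> p i \<in> Hom D (G i) (G i)" using eH[OF i] .
    have fa: "f \<cdot> a i \<in> Hom D (A i) (shO D n (G j))" and fb: "f \<cdot> b i \<in> Hom D (B i) (shO D n (G j))"
      using comp_Hom f bi by blast+
    have ej: "shA D n (a j \<cdot> p j) = shA D n (a j) \<cdot> shA D n (p j)"
      using sh_comp biproductD(4,6)[OF bp[OF j]] by blast
    have ejH: "shA D n (a j \<cdot> p j) \<in> Hom D (shO D n (G j)) (shO D n (G j))" using sh_Hom[OF eH[OF j]] .
    have "shA D n (q j) \<cdot> (f \<cdot> a i) = zeroA D (A i) (shO D n (B j))"
      using orth(1) comp_Hom[OF fa bj(7)] by (simp add: hom_vanishes_def)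
    moreover have "f \<cdot> a i = addA D (shA D n (a j) \<cdot> (shA D n (p j) \<cdot> (f \<cdot> a i))) (shA D n (b j) \<cdot> (shA D n (q j) \<cdot> (f \<cdot> a i)))"
      using comp_add_left[OF fa comp_Hom[OF bj(6,4)] comp_Hom[OF bj(7,5)]] bj(12) comp_ide_left[OF fa]
        comp_assoc[OF fa bj(6,4)] comp_assoc[OF fa bj(7,5)] by simp
    ultimately have 1: "shA D n (a j) \<cdot> (shA D n (p j) \<cdot> (f \<cdot> a i)) = f \<cdot> a i"
      using comp_zero_right[OF bj(5) bi(1)]
        add_zero_right[OF comp_Hom[OF comp_Hom[OF fa bj(6)] bj(4)]] by simp
    have 2: "shA D n (p j) \<cdot> (f \<cdot> b i) = zeroA D (B i) (shO D n (A j))"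
      using orth(2) comp_Hom[OF fb bj(6)] by (simp add: hom_vanishes_def)
    show ?thesis
    proof (rule biproduct_ext_source[OF bp[OF i] comp_Hom[OF f ejH] comp_Hom[OF ei f]])
      have "(f \<cdot> (a i \<cdot> p i)) \<cdot> a i = f \<cdot> a i"
        using comp_assoc[OF bi(4) ei f] comp_assoc[OF bi(4,6,4)] bi(8) comp_ide_right[OF bi(4)] by simp
      moreover have "(shA D n (a j \<cdot> p j) \<cdot> f) \<cdot> a i = f \<cdot> a i"
        using comp_assoc[OF bi(4) f ejH] ej comp_assoc[OF fa bj(6,4)] 1 by simp
      ultimately show "(shA D n (a j \<cdot> p j) \<cdot> f) \<cdot> a i = (f \<cdot> (a i \<cdot> p i)) \<cdot> a i" by simp
      have "(f \<cdot> (a i \<cdot> p i)) \<cdot> b i = zeroA D (B i) (shO D n (G j))"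
        using comp_assoc[OF bi(5) ei f] comp_assoc[OF bi(5,6,4)] bi(10) comp_zero_right[OF bi(4,2)]
          comp_zero_right[OF f bi(2)] by simp
      moreover have "(shA D n (a j \<cdot> p j) \<cdot> f) \<cdot> b i = zeroA D (B i) (shO D n (G j))"
        using comp_assoc[OF bi(5) f ejH] ej comp_assoc[OF fb bj(6,4)] 2 comp_zero_right[OF bj(4) bi(2)] by simp
      ultimately show "(shA D n (a j \<cdot> p j) \<cdot> f) \<cdot> b i = (f \<cdot> (a i \<cdot> p i)) \<cdot> b i" by simp
    qed
  qed
  have "?e \<in> (\<Pi>\<^sub>E i\<in>I. Hom D (G i) (G i))"
  proof (rule PiE_I)
    show "?e i \<in> Hom D (G i) (G i)" if "i \<in> I" for i using e[OF that] eH[OF that] by simp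
    show "?e i = undefined" if "i \<notin> I" for i using that by (simp add: decomposition_to_idempotent_def)
  qed
  then show ?thesis
    unfolding graded_central_idempotents_iff[OF GI] using e ee nat by simp
qed

text \<open>The orthogonal of one family of summands only depends on the idempotents.\<close>

lemma perp_complement_eq:
  assumes bp: "\<And>i. i \<in> I \<Longrightarrow> biproduct (A i) (B i) (G i) (a i) (b i) (p i) (q i)"
  shows "perp I B = {M \<in> Obj D. \<forall>i \<in> I. \<forall>n. \<forall>f \<in> Hom D (shO D n (G i)) M. f \<cdot> shA D n (a i \<cdot> p i) = f}"
    "perp I A = {M \<in> Obj D. \<forall>i \<in> I. \<forall>n. \<forall>f \<in> Hom D (shO D n (G i)) M.
      f \<cdot> shA D n (a i \<cdot> p i) = zeroA D (shO D n (G i)) M}"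
proof -
  have *: "(hom_vanishes D (shO D n (B i)) M \<longleftrightarrow> (\<forall>f \<in> Hom D (shO D n (G i)) M. f \<cdot> shA D n (a i \<cdot> p i) = f)) \<and>
     (hom_vanishes D (shO D n (A i)) M \<longleftrightarrow>
      (\<forall>f \<in> Hom D (shO D n (G i)) M. f \<cdot> shA D n (a i \<cdot> p i) = zeroA D (shO D n (G i)) M))"
    if i: "i \<in> I" and M: "M \<in> Obj D" for i n M
  proof -
    note m = biproduct_shift[OF bp[OF i], of n]
    note b = biproductD[OF m]
    let ?a = "shA D n (a i)" and ?b = "shA D n (b i)" and ?p = "shA D n (p i)" and ?q = "shA D n (q i)"
    let ?A = "shO D n (A i)" and ?B = "shO D n (B i)" and ?G = "shO D n (G i)"
    have ap: "shA D n (a i \<cdot> p i) = ?a \<cdot> ?p" using sh_comp biproductD(4,6)[OF bp[OF i]] by blast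
    have e: "f \<cdot> (?a \<cdot> ?p) = (f \<cdot> ?a) \<cdot> ?p" if "f \<in> Hom D ?G M" for f
      using comp_assoc[OF b(6,4) that] by simp
    have eH: "(f \<cdot> ?a) \<cdot> ?p \<in> Hom D ?G M" if "f \<in> Hom D ?G M" for f
      using comp_Hom[OF b(6) comp_Hom[OF b(4) that]] .
    have ea: "((f \<cdot> ?a) \<cdot> ?p) \<cdot> ?a = f \<cdot> ?a" and eb: "((f \<cdot> ?a) \<cdot> ?p) \<cdot> ?b = zeroA D ?B M"
      if f: "f \<in> Hom D ?G M" for f
      using comp_assoc[OF b(4,6) comp_Hom[OF b(4) f]] comp_assoc[OF b(5,6) comp_Hom[OF b(4) f]] b(8,10)
        comp_ide_right[OF comp_Hom[OF b(4) f]] comp_zero_right[OF comp_Hom[OF b(4) f] b(2)] by simp_all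
    have "hom_vanishes D ?B M \<longleftrightarrow> (\<forall>f \<in> Hom D ?G M. f \<cdot> ?b = zeroA D ?B M)"
    proof
      show "\<forall>f \<in> Hom D ?G M. f \<cdot> ?b = zeroA D ?B M" if "hom_vanishes D ?B M"
        using that comp_Hom[OF b(5)] by (auto simp: hom_vanishes_def)
      assume z: "\<forall>f \<in> Hom D ?G M. f \<cdot> ?b = zeroA D ?B M"
      have "g = zeroA D ?B M" if g: "g \<in> Hom D ?B M" for g
        using z comp_Hom[OF b(7) g] comp_assoc[OF b(5,7) g] b(9) comp_ide_right[OF g] by force
      then show "hom_vanishes D ?B M" using hom_vanishes_iff b M by blast
    qed
    moreover have "f \<cdot> ?b = zeroA D ?B M \<longleftrightarrow> f \<cdot> (?a \<cdot> ?p) = f" if f: "f \<in> Hom D ?G M" for f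
    proof
      assume "f \<cdot> ?b = zeroA D ?B M"
      then have "(f \<cdot> ?a) \<cdot> ?p = f" using biproduct_ext_source[OF m eH[OF f] f] ea[OF f] eb[OF f] by simp
      then show "f \<cdot> (?a \<cdot> ?p) = f" using e[OF f] by simp
    next
      assume "f \<cdot> (?a \<cdot> ?p) = f"
      then have "(f \<cdot> ?a) \<cdot> ?p = f" using e[OF f] by simp
      then show "f \<cdot> ?b = zeroA D ?B M" using eb[OF f] by simp
    qed
    ultimately have 1: "hom_vanishes D ?B M \<longleftrightarrow> (\<forall>f \<in> Hom D ?G M. f \<cdot> (?a \<cdot> ?p) = f)" by blast
    have "hom_vanishes D ?A M \<longleftrightarrow> (\<forall>f \<in> Hom D ?G M. f \<cdot> ?a = zeroA D ?A M)"
    proof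
      show "\<forall>f \<in> Hom D ?G M. f \<cdot> ?a = zeroA D ?A M" if "hom_vanishes D ?A M"
        using that comp_Hom[OF b(4)] by (auto simp: hom_vanishes_def)
      assume z: "\<forall>f \<in> Hom D ?G M. f \<cdot> ?a = zeroA D ?A M"
      have "g = zeroA D ?A M" if g: "g \<in> Hom D ?A M" for g
        using z comp_Hom[OF b(6) g] comp_assoc[OF b(4,6) g] b(8) comp_ide_right[OF g] by force
      then show "hom_vanishes D ?A M" using hom_vanishes_iff b M by blast
    qed
    moreover have "f \<cdot> ?a = zeroA D ?A M \<longleftrightarrow> f \<cdot> (?a \<cdot> ?p) = zeroA D ?G M" if f: "f \<in> Hom D ?G M" for f
    proof
      assume "f \<cdot> ?a = zeroA D ?A M"
      then show "f \<cdot> (?a \<cdot> ?p) = zeroA D ?G M" using e[OF f] comp_zero_left[OF b(6) M] by simp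
    next
      assume "f \<cdot> (?a \<cdot> ?p) = zeroA D ?G M"
      then have "((f \<cdot> ?a) \<cdot> ?p) \<cdot> ?a = zeroA D ?A M" using e[OF f] comp_zero_left[OF b(4) M] by simp
      then show "f \<cdot> ?a = zeroA D ?A M" using ea[OF f] by simp
    qed
    ultimately have 2: "hom_vanishes D ?A M \<longleftrightarrow> (\<forall>f \<in> Hom D ?G M. f \<cdot> (?a \<cdot> ?p) = zeroA D ?G M)" by blast
    show ?thesis unfolding ap using 1 2 by blast
  qed
  show "perp I B = {M \<in> Obj D. \<forall>i \<in> I. \<forall>n. \<forall>f \<in> Hom D (shO D n (G i)) M. f \<cdot> shA D n (a i \<cdot> p i) = f}"
    unfolding perp_def using * by (intro Collect_cong) (simp cong: conj_cong)
  show "perp I A = {M \<in> Obj D. \<forall>i \<in> I. \<forall>n. \<forall>f \<in> Hom D (shO D n (G i)) M.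
      f \<cdot> shA D n (a i \<cdot> p i) = zeroA D (shO D n (G i)) M}"
    unfolding perp_def using * by (intro Collect_cong) (simp cong: conj_cong)
qed

text \<open>Conversely a graded central family of idempotents splits the generators into summands, and
  an arrow between summands of different kind is multiplied by \<open>0\<close> on one side and by \<open>1\<close> on the
  other.\<close>

lemma graded_central_idempotent_splits:
  assumes G: "\<And>i. i \<in> I \<Longrightarrow> G i \<in> Obj D" and e: "e \<in> graded_central_idempotents D I G"
    and u: "universe TYPE('u)" and c: "has_small_coproducts TYPE('u) D"
  obtains A B a b p q where "\<And>i. i \<in> I \<Longrightarrow> biproduct (A i) (B i) (G i) (a i) (b i) (p i) (q i)"
    "\<And>i. i \<in> I \<Longrightarrow> e i = a i \<cdot> p i"
    "\<And>i j n. i \<in> I \<Longrightarrow> j \<in> I \<Longrightarrow> hom_vanishes D (A i) (shO D n (B j))"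
    "\<And>i j n. i \<in> I \<Longrightarrow> j \<in> I \<Longrightarrow> hom_vanishes D (B i) (shO D n (A j))"
proof -
  have GI: "G ` I \<subseteq> Obj D" using G by blast
  have eH: "e i \<in> Hom D (G i) (G i)" and ee: "e i \<cdot> e i = e i" if "i \<in> I" for i
    using e that unfolding graded_central_idempotents_iff[OF GI] by auto
  have nat: "shA D n (e j) \<cdot> f = f \<cdot> e i" if "i \<in> I" "j \<in> I" "f \<in> Hom D (G i) (shO D n (G j))" for i j n f
    using e that unfolding graded_central_idempotents_iff[OF GI] by auto
  have "\<exists>A B a b p q. biproduct A B (G i) a b p q \<and> e i = a \<cdot> p" if i: "i \<in> I" for i
  proof -
    obtain P \<iota> where P: "is_coproduct D (UNIV :: nat set) (\<lambda>_. G i) P \<iota>"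
      by (rule ex_small_coproduct[where M = "\<lambda>_. G i", OF c small_countable[OF u, where A = "UNIV :: nat set"]]) (use G i in blast)
    obtain T j r where s: "j \<in> Hom D (G i) T" "r \<in> Hom D T (G i)" "j \<cdot> r = ide D T" "r \<cdot> j = e i"
      using idempotent_splits[OF P eH[OF i] ee[OF i]] .
    obtain B b q where "biproduct T B (G i) r b j q" using section_biproduct[OF s(2,1,3)] .
    then show ?thesis using s(4)[symmetric] by blast
  qed
  then obtain A B a b p q where
    AB: "\<forall>i \<in> I. biproduct (A i) (B i) (G i) (a i) (b i) (p i) (q i) \<and> e i = a i \<cdot> p i"
    by metis
  have bp: "biproduct (A i) (B i) (G i) (a i) (b i) (p i) (q i)" and eq: "e i = a i \<cdot> p i" if "i \<in> I" for i
    using AB that by auto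
  have 1: "hom_vanishes D (A i) (shO D n (B j))" if i: "i \<in> I" and j: "j \<in> I" for i j n
  proof -
    note bi = biproductD[OF bp[OF i]]
    note bj = biproductD[OF biproduct_shift[OF bp[OF j], of n]]
    have ej: "shA D n (e j) = shA D n (a j) \<cdot> shA D n (p j)"
      using sh_comp biproductD(4,6)[OF bp[OF j]] eq[OF j] by auto
    have "f = zeroA D (A i) (shO D n (B j))" if f: "f \<in> Hom D (A i) (shO D n (B j))" for f
    proof -
      have fp: "f \<cdot> p i \<in> Hom D (G i) (shO D n (B j))" using comp_Hom[OF bi(6) f] .
      let ?g = "shA D n (b j) \<cdot> (f \<cdot> p i)"
      have g: "?g \<in> Hom D (G i) (shO D n (G j))" using comp_Hom[OF fp bj(5)] .
      have z: "shA D n (p j) \<cdot> ?g = zeroA D (G i) (shO D n (A j))"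
        using comp_reassoc[OF bj(10) bj(5,6) fp] comp_zero_left[OF fp bj(1)] by simp
      have "shA D n (e j) \<cdot> ?g = zeroA D (G i) (shO D n (G j))"
        using ej comp_assoc[OF g bj(6,4)] z comp_zero_right[OF bj(4) bi(3)] by simp
      then have "?g \<cdot> (a i \<cdot> p i) = zeroA D (G i) (shO D n (G j))"
        using nat[OF i j g] eq[OF i] by simp
      moreover have "?g \<cdot> (a i \<cdot> p i) = ?g"
        using comp_assoc[OF comp_Hom[OF bi(6,4)] fp bj(5)] comp_assoc[OF comp_Hom[OF bi(6,4)] bi(6) f]
          comp_reassoc[OF bi(8,4,6,6)] comp_ide_left[OF bi(6)] by simp
      ultimately have g0: "?g = zeroA D (G i) (shO D n (G j))" by simp
      have "f \<cdot> p i = shA D n (q j) \<cdot> ?g"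
        using comp_reassoc[OF bj(9) bj(5,7) fp] comp_ide_left[OF fp] by simp
      then have fp0: "f \<cdot> p i = zeroA D (G i) (shO D n (B j))" using g0 comp_zero_right[OF bj(7) bi(3)] by simp
      have "f = (f \<cdot> p i) \<cdot> a i" using comp_assoc[OF bi(4,6) f] bi(8) comp_ide_right[OF f] by simp
      then show ?thesis using fp0 comp_zero_left[OF bi(4) bj(2)] by simp
    qed
    then show ?thesis using hom_vanishes_iff bi bj by blast
  qed
  have 2: "hom_vanishes D (B i) (shO D n (A j))" if i: "i \<in> I" and j: "j \<in> I" for i j n
  proof -
    note bi = biproductD[OF bp[OF i]]
    note bj = biproductD[OF biproduct_shift[OF bp[OF j], of n]]
    have ej: "shA D n (e j) = shA D n (a j) \<cdot> shA D n (p j)"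
      using sh_comp biproductD(4,6)[OF bp[OF j]] eq[OF j] by auto
    have "f = zeroA D (B i) (shO D n (A j))" if f: "f \<in> Hom D (B i) (shO D n (A j))" for f
    proof -
      have fq: "f \<cdot> q i \<in> Hom D (G i) (shO D n (A j))" using comp_Hom[OF bi(7) f] .
      let ?g = "shA D n (a j) \<cdot> (f \<cdot> q i)"
      have g: "?g \<in> Hom D (G i) (shO D n (G j))" using comp_Hom[OF fq bj(4)] .
      have pg: "shA D n (p j) \<cdot> ?g = f \<cdot> q i"
        using comp_reassoc[OF bj(8) bj(4,6) fq] comp_ide_left[OF fq] by simp
      have "(f \<cdot> q i) \<cdot> (a i \<cdot> p i) = zeroA D (G i) (shO D n (A j))"
        using comp_assoc[OF comp_Hom[OF bi(6,4)] bi(7) f] comp_reassoc[OF bi(11,4,7,6)]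
          comp_zero_left[OF bi(6,2)] comp_zero_right[OF f bi(3)] by simp
      then have "?g \<cdot> (a i \<cdot> p i) = zeroA D (G i) (shO D n (G j))"
        using comp_assoc[OF comp_Hom[OF bi(6,4)] fq bj(4)] comp_zero_right[OF bj(4) bi(3)] by simp
      moreover have "shA D n (e j) \<cdot> ?g = ?g" using ej comp_assoc[OF g bj(6,4)] pg by simp
      ultimately have g0: "?g = zeroA D (G i) (shO D n (G j))" using nat[OF i j g] eq[OF i] by simp
      then have fq0: "f \<cdot> q i = zeroA D (G i) (shO D n (A j))" using pg comp_zero_right[OF bj(6) bi(3)] by simp
      have "f = (f \<cdot> q i) \<cdot> b i" using comp_assoc[OF bi(5,7) f] bi(9) comp_ide_right[OF f] by simp
      then show ?thesis using fq0 comp_zero_left[OF bi(5) bj(1)] by simp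
    qed
    then show ?thesis using hom_vanishes_iff bi bj by blast
  qed
  show ?thesis using that[OF bp eq 1 2] .
qed

end

section \<open>The correspondences\<close>

theorem corollary1p7p12:
  fixes D :: "('o, 'a, 'm) tri_cat_scheme"
    and I :: "'i set" and G :: "'i \<Rightarrow> 'o"
  assumes "triangulated_category D"
    and "universe TYPE('u)"
    and "small TYPE('u) I"
    and "\<And>i n M. \<lbrakk>i \<in> I; M \<in> Obj D\<rbrakk> \<Longrightarrow> small TYPE('u) (Hom D (shO D n (G i)) M)"
    and "has_small_coproducts TYPE('u) D"
    and "compactly_generated TYPE('u) D I G"
  shows "bij_betw (TTF_to_decomposition D I G)
           (centrally_split_TTF_triples D)
           (graded_orthogonal_decompositions D (add_closure D I G))
       \<and> bij_betw (decomposition_to_idempotent D I G)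
           (graded_orthogonal_decompositions D (add_closure D I G))
           (graded_central_idempotents D I G)"
proof -
  interpret triangulated_category D by fact
  let ?C = "add_closure D I G"
  let ?T = "TTF_to_decomposition D I G" and ?E = "decomposition_to_idempotent D I G"
  have fs: "finitely_supporting TYPE('u) (G i)" if "i \<in> I" for i
    using assms(6) compact_imp_finitely_supporting that unfolding compactly_generated_def by blast
  have G: "G i \<in> Obj D" if "i \<in> I" for i using finitely_supporting_Obj[OF fs[OF that]] .
  have gen: "is_zero_object D M" if "M \<in> perp I G" for M
    using assms(6) that unfolding compactly_generated_def perp_def by blast
  have GI: "G ` I \<subseteq> Obj D" using G by blast
  have CO: "?C \<subseteq> Obj D" unfolding add_closure_def by blast
  note split = perp_split[where I = I and G = G, OF assms(2,5,3) fs assms(4) gen]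
  have T: "?T (X, Y, Z) = (X \<inter> ?C, Y \<inter> ?C)" for X Y Z by (simp add: TTF_to_decomposition_def)

  have "inj_on ?T (centrally_split_TTF_triples D)"
  proof (rule inj_onI)
    fix t t' assume tt: "t \<in> centrally_split_TTF_triples D" "t' \<in> centrally_split_TTF_triples D" "?T t = ?T t'"
    obtain X Y Z X' Y' Z' where t: "t = (X, Y, Z)" "t' = (X', Y', Z')" by (metis prod_cases3)
    have S: "Z = X" "orthogonal_split X Y" "Z' = X'" "orthogonal_split X' Y'"
      using tt t centrally_split_TTF_iff by auto
    have eq: "X \<inter> ?C = X' \<inter> ?C" "Y \<inter> ?C = Y' \<inter> ?C" using tt(3) T t by auto
    have "X = X'"
      using orthogonal_split_eq[where G = G and I = I, OF S(2) gen G] orthogonal_split_eq[where G = G and I = I, OF S(4) gen G] eq by simp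
    moreover have "Y = Y'"
      using orthogonal_split_eq[where G = G and I = I, OF orthogonal_split_sym[OF S(2)] gen G]
        orthogonal_split_eq[where G = G and I = I, OF orthogonal_split_sym[OF S(4)] gen G] eq by simp
    ultimately show "t = t'" using S t by simp
  qed
  moreover have "?T ` centrally_split_TTF_triples D = graded_orthogonal_decompositions D ?C"
  proof
    show "?T ` centrally_split_TTF_triples D \<subseteq> graded_orthogonal_decompositions D ?C"
      using T centrally_split_TTF_iff orthogonal_split_restricts by auto
    show "graded_orthogonal_decompositions D ?C \<subseteq> ?T ` centrally_split_TTF_triples D"
    proof
      fix c assume c: "c \<in> graded_orthogonal_decompositions D ?C"
      obtain C1 C2 where C: "c = (C1, C2)" by (cases c)
      have C12: "(C1, C2) \<in> graded_orthogonal_decompositions D ?C" using c C by simp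
      have orth: "hom_vanishes D M (shO D n N)" "hom_vanishes D N (shO D n M)"
        if "M \<in> C1" "N \<in> C2" for M N n
        using C12 that unfolding graded_orthogonal_decompositions_def by auto
      obtain A B a b p q where A: "\<And>i. i \<in> I \<Longrightarrow> A i \<in> C1" and B: "\<And>i. i \<in> I \<Longrightarrow> B i \<in> C2"
        and bp: "\<And>i. i \<in> I \<Longrightarrow> biproduct (A i) (B i) (G i) (a i) (b i) (p i) (q i)"
        using decomposition_summands[OF C12 G] by blast
      have "hom_vanishes D (A i) (shO D n (B j))" "hom_vanishes D (B i) (shO D n (A j))"
        if "i \<in> I" "j \<in> I" for i j n
        using orth(1)[OF A B] orth(2)[OF A B] that by blast+
      then have S: "orthogonal_split (perp I B) (perp I A)"
        by (intro split(1)[where A = A and B = B and a = a and b = b and p = p and q = q] bp)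
      have "perp I B \<inter> ?C = C1" using perp_restricts[where I = I and G = G and A = A and B = B, OF C12 gen A B bp] .
      moreover have "perp I A \<inter> ?C = C2"
        using perp_restricts[where I = I and G = G and A = B and B = A, OF graded_orthogonal_decompositions_swap[OF C12 CO] gen B A biproduct_sym[OF bp]] .
      ultimately have "?T (perp I B, perp I A, perp I B) = c" using T C by simp
      moreover have "(perp I B, perp I A, perp I B) \<in> centrally_split_TTF_triples D"
        using centrally_split_TTF_iff S by blast
      ultimately show "c \<in> ?T ` centrally_split_TTF_triples D" by blast
    qed
  qed
  ultimately have 1: "bij_betw ?T (centrally_split_TTF_triples D) (graded_orthogonal_decompositions D ?C)"
    by (simp add: bij_betw_def)

  have "inj_on ?E (graded_orthogonal_decompositions D ?C)"
  proof (rule inj_onI)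
    fix c c' assume c: "c \<in> graded_orthogonal_decompositions D ?C" "c' \<in> graded_orthogonal_decompositions D ?C"
      and E: "?E c = ?E c'"
    \<comment> \<open>A decomposition can be read off from its idempotents: the orthogonals of the \<open>B i\<close> and the \<open>A i\<close> are
      given by the objects on which the idempotents act as \<open>1\<close> and \<open>0\<close>.\<close>
    have recover: "d = ({M \<in> Obj D. \<forall>i \<in> I. \<forall>n. \<forall>f \<in> Hom D (shO D n (G i)) M.
          f \<cdot>\<^bsub>D\<^esub> shA D n (?E d i) = f} \<inter> ?C,
        {M \<in> Obj D. \<forall>i \<in> I. \<forall>n. \<forall>f \<in> Hom D (shO D n (G i)) M.
          f \<cdot>\<^bsub>D\<^esub> shA D n (?E d i) = zeroA D (shO D n (G i)) M} \<inter> ?C)"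
      if d: "d \<in> graded_orthogonal_decompositions D ?C" for d
    proof -
      obtain C1 C2 where C: "d = (C1, C2)" by (cases d)
      have C12: "(C1, C2) \<in> graded_orthogonal_decompositions D ?C" using d C by simp
      obtain A B a b p q where A: "\<And>i. i \<in> I \<Longrightarrow> A i \<in> C1" and B: "\<And>i. i \<in> I \<Longrightarrow> B i \<in> C2"
        and bp: "\<And>i. i \<in> I \<Longrightarrow> biproduct (A i) (B i) (G i) (a i) (b i) (p i) (q i)"
        using decomposition_summands[OF C12 G] by blast
      have e: "?E d i = a i \<cdot>\<^bsub>D\<^esub> p i" if "i \<in> I" for i
        unfolding C using decomposition_to_idempotent_apply[OF C12 that bp[OF that] A[OF that] B[OF that]] .
      have "C1 = perp I B \<inter> ?C" using perp_restricts[where I = I and G = G and A = A and B = B, OF C12 gen A B bp] by simp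
      moreover have "C2 = perp I A \<inter> ?C"
        using perp_restricts[where I = I and G = G and A = B and B = A, OF graded_orthogonal_decompositions_swap[OF C12 CO] gen B A biproduct_sym[OF bp]]
        by simp
      ultimately show ?thesis
        using C e perp_complement_eq[where I = I and A = A and B = B and G = G, OF bp] by simp
    qed
    show "c = c'" using recover[OF c(1)] recover[OF c(2)] unfolding E by (rule trans[OF _ sym])
  qed
  moreover have "?E ` graded_orthogonal_decompositions D ?C = graded_central_idempotents D I G"
  proof
    show "?E ` graded_orthogonal_decompositions D ?C \<subseteq> graded_central_idempotents D I G"
      using decomposition_to_idempotent_graded_central[OF _ G] by auto
    show "graded_central_idempotents D I G \<subseteq> ?E ` graded_orthogonal_decompositions D ?C"
    proof
      fix e assume e: "e \<in> graded_central_idempotents D I G"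
      obtain A B a b p q where bp: "\<And>i. i \<in> I \<Longrightarrow> biproduct (A i) (B i) (G i) (a i) (b i) (p i) (q i)"
        and eq: "\<And>i. i \<in> I \<Longrightarrow> e i = a i \<cdot>\<^bsub>D\<^esub> p i"
        and orth: "\<And>i j n. i \<in> I \<Longrightarrow> j \<in> I \<Longrightarrow> hom_vanishes D (A i) (shO D n (B j))"
          "\<And>i j n. i \<in> I \<Longrightarrow> j \<in> I \<Longrightarrow> hom_vanishes D (B i) (shO D n (A j))"
        by (rule graded_central_idempotent_splits[where I = I and G = G, OF G e assms(2,5)]) blast+
      let ?c = "(perp I B \<inter> ?C, perp I A \<inter> ?C)"
      have c: "?c \<in> graded_orthogonal_decompositions D ?C"
        by (intro orthogonal_split_restricts split(1)[where A = A and B = B and a = a and b = b and p = p and q = q] bp orth)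
      have "?E ?c i = e i" for i
      proof (cases "i \<in> I")
        case True
        note b = biproductD[OF bp[OF True]]
        have "A i \<in> ?C" "B i \<in> ?C"
          using add_closure_retract[OF generator_in_add_closure[of i I G, OF True G[OF True]]] b by blast+
        moreover have "A i \<in> perp I B"
          by (intro split(2)[where A = A and B = B and a = a and b = b and p = p and q = q] bp orth True)
        moreover have "B i \<in> perp I A"
          by (intro split(3)[where A = A and B = B and a = a and b = b and p = p and q = q] bp orth True)
        ultimately have "A i \<in> perp I B \<inter> ?C" "B i \<in> perp I A \<inter> ?C" by blast+
        then show ?thesis using decomposition_to_idempotent_apply[OF c True bp[OF True]] eq[OF True] by simp
      next
        case False
        then show ?thesis
          using e unfolding graded_central_idempotents_iff[OF GI]
          by (auto simp: decomposition_to_idempotent_def PiE_def extensional_def)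
      qed
      then show "e \<in> ?E ` graded_orthogonal_decompositions D ?C" using c by (intro image_eqI[of _ _ ?c]) auto
    qed
  qed
  ultimately have 2: "bij_betw ?E (graded_orthogonal_decompositions D ?C) (graded_central_idempotents D I G)"
    by (simp add: bij_betw_def)
  show ?thesis using 1 2 by blast
qed

end
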